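(* Let $m,n\in\mathbb{N}$ and let $X=(X_t)_{t\in\mathbb{Z}^m}$ be a (strictly) stationary ergodic centered $\mathbb{R}^n$-valued random field with $E[\|X_t\|^{2+\delta}]<\infty$ for some $\delta>0$. Assume that its $\theta$-lex-coefficients satisfy $\theta(h)\in\mathcal{O}(h^{-\alpha})$ as $h\to\infty$ with $\alpha>m(1+\frac1\delta)$. Let $(D_N)_{N\in\mathbb{N}}$ be a sequence of finite subsets of $\mathbb{Z}^m$ with $\lim_{N\to\infty}|D_N|=\infty$ and $\lim_{N\to\infty}|\partial D_N|/|D_N|=0$. Then $$\Sigma=\sum_{k\in\mathbb{Z}^m}E[X_0X_k']$$ is finite, positive definite, and $$\frac{1}{|D_N|^{1/2}}\sum_{j\in D_N}X_j\xrightarrow[N\to\infty]{d}N(0,\Sigma),$$ where $N(0,\Sigma)$ is the multivariate normal distribution with mean $0$ and covariance matrix $\Sigma$.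
   Context: Lexicographic order: for distinct $y,z\in\mathbb{Z}^m$, $y<_{lex}z$ iff $y_1<z_1$, or for some $p\in\{2,\dots,m\}$ one has $y_p<z_p$ and $y_q=z_q$ for $q=1,\dots,p-1$. $V_t=\{s\in\mathbb{Z}^m: s<_{lex}t\}\cup\{t\}$ and $V_t^h=V_t\cap\{s:\|t-s\|_\infty\ge h\}$. $\theta$-lex-coefficients: for an $\mathbb{R}^n$-valued field $X=(X_t)_{t\in\mathbb{Z}^m}$, let $\mathcal{G}^*_u$ be the bounded (Borel) functions $(\mathbb{R}^n)^u\to\mathbb{R}$ and $\mathcal{G}_1$ the bounded (globally) Lipschitz functions $\mathbb{R}^n\to\mathbb{R}$, with Lipschitz constant $Lip(G)$ with respect to the Euclidean norm. For $\Gamma=(i_1,\dots,i_u)$ write $X_\Gamma=(X_{i_1},\dots,X_{i_u})$. Then $\theta(h)=\sup_{u\in\mathbb{N}}\theta_u(h)$ with $$\theta_u(h)=\sup\Big\{\frac{|Cov(F(X_\Gamma),G(X_j))|}{\|F\|_\infty Lip(G)}: F\in\mathcal{G}_u^*,\,G\in\mathcal{G}_1,\,j\in\mathbb{Z}^m,\,\Gamma\subset V_j^h,\,|\Gamma|=u\Big\},$$ the supremum being over $F,G$ with non-zero denominator. Boundary: $\partial\Gamma=\{i\in\Gamma:\exists j\in\mathbb{Z}^m\setminus\Gamma,\ \|i-j\|_\infty=1\}$. A prime denotes transposition. Ergodic means that the $\sigma$-algebra of events invariant under all shifts of $\mathbb{Z}^m$ is trivial.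
   Formalization: "Positive definite" is proved as positive semidefinite (symmetric, v'Σv ≥ 0), with N(0,Σ) possibly degenerate; strict positive definiteness fails under the stated hypotheses, e.g. for X = 0, where Σ = 0. *)

theory Defs
  imports "HOL-Probability.Probability"
begin

(* Z^m is the type int ^ 'm, where 'm is a finite linearly ordered index type playing the
   role of {1,...,m}; its order is what the lexicographic order refers to. *)

definition lex_less :: "int ^ 'm::{finite,linorder} \<Rightarrow> int ^ 'm::{finite,linorder} \<Rightarrow> bool" where
  "lex_less y z \<longleftrightarrow> (\<exists>p. y $ p < z $ p \<and> (\<forall>q<p. y $ q = z $ q))"

definition supnorm :: "int ^ 'm::finite \<Rightarrow> int" where
  "supnorm t = Max (range (\<lambda>i. \<bar>t $ i\<bar>))"

definition V_lex :: "int ^ 'm::{finite,linorder} \<Rightarrow> (int ^ 'm::{finite,linorder}) set" where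
  "V_lex t = {s. lex_less s t} \<union> {t}"

definition V_lex_dist :: "int ^ 'm::{finite,linorder} \<Rightarrow> nat \<Rightarrow> (int ^ 'm::{finite,linorder}) set" where
  "V_lex_dist t h = V_lex t \<inter> {s. supnorm (t - s) \<ge> int h}"

definition boundary :: "(int ^ 'm::finite) set \<Rightarrow> (int ^ 'm) set" where
  "boundary \<Gamma> = {i \<in> \<Gamma>. \<exists>j. j \<notin> \<Gamma> \<and> supnorm (i - j) = 1}"


definition covariance :: "'a measure \<Rightarrow> ('a \<Rightarrow> real) \<Rightarrow> ('a \<Rightarrow> real) \<Rightarrow> real" where
  "covariance M U V =
     (\<integral>\<omega>. (U \<omega> - (\<integral>\<omega>'. U \<omega>' \<partial>M)) * (V \<omega> - (\<integral>\<omega>'. V \<omega>' \<partial>M)) \<partial>M)"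

(* (R^n)^u is represented by the extensional functions {1..u} \<rightarrow>\<^sub>E UNIV. As R^n is second
   countable, the product sigma-algebra used here is the Borel sigma-algebra of (R^n)^u. *)

definition bounded_borel :: "nat \<Rightarrow> ((nat \<Rightarrow> real ^ 'n::finite) \<Rightarrow> real) set" where
  "bounded_borel u = {F. F \<in> borel_measurable (Pi\<^sub>M {1..u} (\<lambda>_. borel)) \<and>
                         bounded (F ` ({1..u} \<rightarrow>\<^sub>E UNIV))}"

definition sup_abs :: "nat \<Rightarrow> ((nat \<Rightarrow> real ^ 'n::finite) \<Rightarrow> real) \<Rightarrow> real" where
  "sup_abs u F = (SUP x \<in> {1..u} \<rightarrow>\<^sub>E UNIV. \<bar>F x\<bar>)"

definition bounded_lipschitz :: "(real ^ 'n::finite \<Rightarrow> real) set" where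
  "bounded_lipschitz = {G. bounded (range G) \<and> (\<exists>L. L-lipschitz_on UNIV G)}"

definition Lip :: "(real ^ 'n::finite \<Rightarrow> real) \<Rightarrow> real" where
  "Lip G = Sup {\<bar>G x - G y\<bar> / norm (x - y) | x y. x \<noteq> y}"

(* The tuple \<Gamma> = (i_1, ..., i_u) of distinct points is given by its enumeration i.
   The suprema are taken in the extended nonnegative reals, so theta may a priori be infinite. *)

definition theta_u ::
  "'a measure \<Rightarrow> (int ^ 'm::{finite,linorder} \<Rightarrow> 'a \<Rightarrow> real ^ 'n::finite) \<Rightarrow> nat \<Rightarrow> nat \<Rightarrow> ennreal"
where
  "theta_u M X u h = Sup
     {ennreal (\<bar>covariance M (\<lambda>\<omega>. F (\<lambda>k\<in>{1..u}. X (i k) \<omega>)) (\<lambda>\<omega>. G (X j \<omega>))\<bar>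
               / (sup_abs u F * Lip G)) | F G j i.
        F \<in> bounded_borel u \<and> G \<in> bounded_lipschitz \<and> sup_abs u F * Lip G \<noteq> 0 \<and>
        inj_on i {1..u} \<and> i ` {1..u} \<subseteq> V_lex_dist j h}"

definition theta ::
  "'a measure \<Rightarrow> (int ^ 'm::{finite,linorder} \<Rightarrow> 'a \<Rightarrow> real ^ 'n::finite) \<Rightarrow> nat \<Rightarrow> ennreal"
where
  "theta M X h = (SUP u\<in>{1..}. theta_u M X u h)"


definition random_field ::
  "'a measure \<Rightarrow> (int ^ 'm::finite \<Rightarrow> 'a \<Rightarrow> real ^ 'n::finite) \<Rightarrow> bool" where
  "random_field M X \<longleftrightarrow> (\<forall>t. X t \<in> borel_measurable M)"

definition strictly_stationary ::
  "'a measure \<Rightarrow> (int ^ 'm::finite \<Rightarrow> 'a \<Rightarrow> real ^ 'n::finite) \<Rightarrow> bool" where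
  "strictly_stationary M X \<longleftrightarrow>
     (\<forall>J h. finite J \<longrightarrow>
        distr M (Pi\<^sub>M J (\<lambda>_. borel)) (\<lambda>\<omega>. \<lambda>t\<in>J. X (t + h) \<omega>) =
        distr M (Pi\<^sub>M J (\<lambda>_. borel)) (\<lambda>\<omega>. \<lambda>t\<in>J. X t \<omega>))"

definition field_law ::
  "'a measure \<Rightarrow> (int ^ 'm::finite \<Rightarrow> 'a \<Rightarrow> real ^ 'n::finite) \<Rightarrow> (int ^ 'm \<Rightarrow> real ^ 'n) measure"
where
  "field_law M X = distr M (Pi\<^sub>M UNIV (\<lambda>_. borel)) (\<lambda>\<omega> t. X t \<omega>)"

definition shift :: "int ^ 'm::finite \<Rightarrow> (int ^ 'm \<Rightarrow> real ^ 'n::finite) \<Rightarrow> int ^ 'm \<Rightarrow> real ^ 'n" where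
  "shift h x = (\<lambda>t. x (t + h))"

definition ergodic_field ::
  "'a measure \<Rightarrow> (int ^ 'm::finite \<Rightarrow> 'a \<Rightarrow> real ^ 'n::finite) \<Rightarrow> bool" where
  "ergodic_field M X \<longleftrightarrow>
     (\<forall>A \<in> sets (Pi\<^sub>M UNIV (\<lambda>_. borel)).
        (\<forall>h. shift h -` A = A) \<longrightarrow> measure (field_law M X) A \<in> {0, 1})"


definition outer_product :: "real ^ 'n \<Rightarrow> real ^ 'n \<Rightarrow> real ^ 'n ^ 'n" where
  "outer_product x y = (\<chi> i j. x $ i * y $ j)"

(* This is the sense of "positive definite" for limiting covariance matrices here. Strictness
   fails for degenerate fields, for instance for X = 0. *)

definition pos_semidefinite :: "real ^ 'n ^ 'n::finite \<Rightarrow> bool" where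
  "pos_semidefinite S \<longleftrightarrow> transpose S = S \<and> (\<forall>v. 0 \<le> v \<bullet> (S *v v))"

definition std_normal_vec :: "(real ^ 'n::finite) measure" where
  "std_normal_vec = density lborel (\<lambda>x. ennreal (\<Prod>i\<in>UNIV. std_normal_density (x $ i)))"

(* Law of \<mu> + A Z, where Z is standard normal and A A' = S. It depends on A only through S,
   so the choice of A is immaterial. Such an A exists exactly when S is positive semidefinite.
   The covariance matrix S may be singular. *)

definition multivariate_normal ::
  "real ^ 'n::finite \<Rightarrow> real ^ 'n ^ 'n \<Rightarrow> (real ^ 'n) measure" where
  "multivariate_normal \<mu> S =
     distr std_normal_vec borel (\<lambda>z. \<mu> + (SOME A :: real ^ 'n ^ 'n. A ** transpose A = S) *v z)"

(* The library's weak_conv is restricted to measures on the real line. *)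

definition converges_in_distribution ::
  "'a measure \<Rightarrow> (nat \<Rightarrow> 'a \<Rightarrow> real ^ 'n::finite) \<Rightarrow> (real ^ 'n) measure \<Rightarrow> bool" where
  "converges_in_distribution M Y \<nu> \<longleftrightarrow>
     (\<forall>f :: real ^ 'n \<Rightarrow> real. continuous_on UNIV f \<longrightarrow> bounded (range f) \<longrightarrow>
        (\<lambda>N. \<integral>\<omega>. f (Y N \<omega>) \<partial>M) \<longlonglongrightarrow> (\<integral>x. f x \<partial>\<nu>))"

end

theory Submission
  imports Defs
begin

text \<open>
Projecting the field on a vector \<open>v\<close> reduces the claim to the scalar field \<open>v \<bullet> X\<close>: by Levy's continuity
theorem in several dimensions (\<open>converges_in_distribution_if_char\<close>) it suffices that the characteristic function
of the normalised sum at \<open>v\<close> tends to \<open>exp (- \<sigma>2 v / 2)\<close>, where \<open>\<sigma>2 v\<close> is the sum of all autocovariances of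
\<open>v \<bullet> X\<close>.

The theta-lex coefficients compare the past with a single later site. Truncating at a level that balances the
decay of theta against the moment of order \<open>2 + \<delta>\<close> turns them into the bound \<open>far_covariance_bound\<close>: if a
function of the past at distance \<open>h\<close> from \<open>j\<close> is dominated by \<open>norm (X p)\<close> for one site \<open>p\<close> of that past, then its
covariance with \<open>v \<bullet> X j\<close> is of order \<open>h powr - \<beta>\<close> with \<open>\<beta> = \<alpha> * \<delta> / (1 + \<delta>)\<close>. The hypothesis on
\<open>\<alpha>\<close> says exactly that \<open>\<beta>\<close> exceeds the dimension of the lattice, so these bounds are summable. Hence the
autocovariances are summable, sums over \<open>A\<close> have variance of order \<open>card A\<close>, and, removing the sites of the past
one at a time from the nearest on, the phase of the far past is almost uncorrelated with \<open>v \<bullet> X k\<close>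
(\<open>past_expectation_bound\<close>).

The sites of \<open>D\<close>, with \<open>n\<close> elements, are added in lexicographic order. With \<open>s = 1 / sqrt n\<close> and
\<open>a = \<sigma>2 v / (2 * n)\<close>, the quantity \<open>exp (a * card A)\<close> times the characteristic function of the sum over \<open>A\<close> at \<open>s\<close>
starts from 1 and telescopes. A Taylor expansion of the increment at \<open>k\<close>, with the past split into a near and a far
part, leaves the phase of the past times \<open>- s\<^sup>2 / 2\<close> times a local quadratic expression minus its mean, up to errors
that are negligible when summed (\<open>single_site_estimate\<close>).

Theta says nothing about products of two nearby sites, so this last term needs ergodicity. By the mean ergodic
theorem some average of shifts of the centred quadratic expression has small \<open>L\<^sup>1\<close> norm
(\<open>ergodic_shift_average_small\<close>). Such shifts may be inserted because the phase of the past hardly changes between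
\<open>k\<close> and \<open>k + l\<close>: a large set with relatively small boundary has small slices, so only \<open>o(n)\<close> of its points lie lexicographically
between the two sites (\<open>lex_between_negligible\<close>), and their sum is negligible after normalisation
(\<open>weight_slow\<close>).

Positive semidefiniteness is a by-product: \<open>exp (- \<sigma>2 v / 2)\<close> is a limit of numbers of modulus at most 1, so
\<open>\<sigma>2 v\<close>, which is the value at \<open>v\<close> of the quadratic form of the matrix in the theorem, is nonnegative.
\<close>

section \<open>Lexicographic order and counting on the integer lattice\<close>

lemma supnorm_le_iff: "supnorm t \<le> c \<longleftrightarrow> (\<forall>i. \<bar>t $ i\<bar> \<le> c)"
  unfolding supnorm_def by (subst Max_le_iff) auto

lemma supnorm_ge_component: "\<bar>t $ i\<bar> \<le> supnorm t"
  using supnorm_le_iff[of t "supnorm t"] by simp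

lemma supnorm_nonneg: "0 \<le> supnorm t"
  using supnorm_ge_component[of t undefined] by linarith

lemma supnorm_minus [simp]: "supnorm (- t) = supnorm t"
  by (simp add: supnorm_def)

lemma supnorm_diff_commute: "supnorm (s - t) = supnorm (t - s)"
  by (metis minus_diff_eq supnorm_minus)

lemma supnorm_eq_0_iff [simp]: "supnorm t = 0 \<longleftrightarrow> t = 0"
  by (metis (mono_tags, opaque_lifting) abs_0 abs_le_zero_iff order_refl supnorm_ge_component
      supnorm_le_iff supnorm_nonneg vec_eq_iff zero_index order_antisym)

lemma finite_supnorm_less: "finite {t :: int ^ 'm::finite. supnorm t < c}"
proof -
  have "{t :: int ^ 'm. supnorm t < c} \<subseteq> vec_lambda ` (UNIV \<rightarrow>\<^sub>E {-c..c})"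
  proof
    fix t :: "int ^ 'm" assume "t \<in> {t. supnorm t < c}"
    then have "\<bar>t $ i\<bar> \<le> c" for i
      using supnorm_ge_component[of t i] by simp
    then have "vec_nth t \<in> UNIV \<rightarrow>\<^sub>E {-c..c}"
      by (auto simp: abs_le_iff minus_le_iff)
    then show "t \<in> vec_lambda ` (UNIV \<rightarrow>\<^sub>E {-c..c})"
      by (metis image_eqI vec_nth_inverse)
  qed
  then show ?thesis
    by (rule finite_subset) (intro finite_imageI finite_PiE, auto)
qed

lemma lex_less_irrefl [simp]: "\<not> lex_less x x"
  by (simp add: lex_less_def)

lemma lex_less_trans:
  assumes "lex_less x y" "lex_less y z"
  shows "lex_less x z"
proof -
  obtain p where p: "x $ p < y $ p" "\<And>q. q < p \<Longrightarrow> x $ q = y $ q"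
    using assms(1) unfolding lex_less_def by blast
  obtain r where r: "y $ r < z $ r" "\<And>q. q < r \<Longrightarrow> y $ q = z $ q"
    using assms(2) unfolding lex_less_def by blast
  have "x $ min p r < z $ min p r"
    using p r by (cases p r rule: linorder_cases) (auto simp: min_def)
  moreover have "\<forall>q < min p r. x $ q = z $ q"
    using p r by simp
  ultimately show ?thesis
    unfolding lex_less_def by blast
qed

lemma lex_less_linear:
  fixes x y :: "int ^ 'm::{finite,linorder}"
  shows "lex_less x y \<or> x = y \<or> lex_less y x"
proof (cases "x = y")
  case False
  let ?P = "{p. x $ p \<noteq> y $ p}"
  have ne: "?P \<noteq> {}" using False by (auto simp: vec_eq_iff)
  define p where "p = Min ?P"
  have "x $ p \<noteq> y $ p" using Min_in[of ?P] ne unfolding p_def by auto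
  moreover have "\<forall>q<p. x $ q = y $ q"
    using Min_le[of ?P] unfolding p_def by (meson finite leD mem_Collect_eq)
  ultimately show ?thesis
    unfolding lex_less_def by (metis linorder_neqE)
qed simp

lemma lex_less_translate [simp]: "lex_less (x + z) (y + z) \<longleftrightarrow> lex_less x y"
  by (simp add: lex_less_def)

lemma lex_less_zero_diff: "lex_less (x - y) 0 \<longleftrightarrow> lex_less x y"
  by (simp add: lex_less_def)

lemma lex_less_first_coordinate:
  fixes x y :: "int ^ 'm::{finite,linorder}"
  assumes "lex_less x y"
  shows "x $ Min UNIV \<le> y $ Min UNIV"
proof -
  obtain p where p: "x $ p < y $ p" "\<forall>q<p. x $ q = y $ q"
    using assms unfolding lex_less_def by blast
  have "Min UNIV \<le> p" by simp
  then show ?thesis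
    using p by (cases "Min UNIV = p") (auto simp: order_less_le)
qed

lemma finite_lex_max:
  fixes A :: "(int ^ 'm::{finite,linorder}) set"
  assumes "finite A" "A \<noteq> {}"
  obtains a where "a \<in> A" "\<And>x. x \<in> A \<Longrightarrow> x \<noteq> a \<Longrightarrow> lex_less x a"
proof -
  have "\<exists>a\<in>A. \<forall>x\<in>A. x \<noteq> a \<longrightarrow> lex_less x a"
    using assms
  proof (induction rule: finite_ne_induct)
    case (insert b B)
    then obtain a where a: "a \<in> B" "\<forall>x\<in>B. x \<noteq> a \<longrightarrow> lex_less x a" by blast
    show ?case
    proof (cases "lex_less a b")
      case True
      then have "\<forall>x\<in>insert b B. x \<noteq> b \<longrightarrow> lex_less x b"
        using a(2) lex_less_trans[of _ a b] by (metis insertE)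
      then show ?thesis by blast
    next
      case False
      then have "lex_less b a" using a(1) lex_less_linear[of a b] insert.hyps by metis
      then have "\<forall>x\<in>insert b B. x \<noteq> a \<longrightarrow> lex_less x a"
        using a(2) by (metis insertE)
      then show ?thesis using a(1) by blast
    qed
  qed simp
  then show ?thesis using that by blast
qed

text \<open>Building up \<open>D\<close> in lexicographic order telescopes every set function; the point removed in the induction is the largest one.\<close>
lemma lex_telescope:
  fixes g :: "(int ^ 'm::{finite,linorder}) set \<Rightarrow> 'b::ab_group_add"
  assumes "finite D"
  shows "(\<Sum>k\<in>D. g (insert k {j\<in>D. lex_less j k}) - g {j\<in>D. lex_less j k}) = g D - g {}"
  using assms
proof (induction "card D" arbitrary: D)
  case (Suc n)
  then obtain a where a: "a \<in> D" "\<And>x. x \<in> D \<Longrightarrow> x \<noteq> a \<Longrightarrow> lex_less x a"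
    by (metis card.empty finite_lex_max nat.distinct(1))
  let ?E = "D - {a}"
  have na: "\<not> lex_less a k" if "k \<in> ?E" for k
    using a(2)[of k] that lex_less_trans[of a k a] lex_less_irrefl[of a] by (metis Diff_iff insertI1)
  have E: "{j\<in>D. lex_less j k} = {j\<in>?E. lex_less j k}" if "k \<in> ?E" for k
    using na[OF that] by auto
  have P: "{j\<in>D. lex_less j a} = ?E" using a by auto
  have "(\<Sum>k\<in>D. g (insert k {j\<in>D. lex_less j k}) - g {j\<in>D. lex_less j k})
    = (g (insert a ?E) - g ?E) + (\<Sum>k\<in>?E. g (insert k {j\<in>D. lex_less j k}) - g {j\<in>D. lex_less j k})"
    using a Suc.prems by (simp add: sum.remove[of D a] P)
  also have "(\<Sum>k\<in>?E. g (insert k {j\<in>D. lex_less j k}) - g {j\<in>D. lex_less j k}) = g ?E - g {}"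
    using Suc a E by (subst Suc(1)[symmetric]) (auto intro!: sum.cong)
  finally show ?case using a by (simp add: insert_absorb)
qed simp

text \<open>Every lattice point that leaves \<open>D\<close> under the translation by \<open>l\<close> crosses the boundary on a path of \<open>supnorm l\<close> steps of
  sup-length at most one. Clamping the coordinates of \<open>l\<close> produces the last step of such a path.\<close>
lemma card_exit_le:
  fixes D :: "(int ^ 'm::finite) set"
  assumes "finite D" "supnorm l \<le> int h"
  shows "card {k\<in>D. k + l \<notin> D} \<le> h * card (boundary D)"
  using assms(2)
proof (induction h arbitrary: l)
  case 0
  then have "l = 0" using supnorm_nonneg[of l] supnorm_eq_0_iff[of l] by linarith
  then show ?case by simp
next
  case (Suc h)
  define l' :: "int ^ 'm" where "l' = (\<chi> i. max (- int h) (min (int h) (l $ i)))"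
  define u where "u = l - l'"
  have l: "\<bar>l $ i\<bar> \<le> int h + 1" for i
    using Suc.prems by (auto simp: supnorm_le_iff add.commute)
  have "supnorm l' \<le> int h"
    by (auto simp: supnorm_le_iff l'_def)
  note IH = Suc.IH[OF this]
  have "supnorm u \<le> 1"
  proof (unfold supnorm_le_iff, rule allI)
    fix i show "\<bar>u $ i\<bar> \<le> 1"
      using l[of i] by (auto simp: u_def l'_def)
  qed
  then have u: "supnorm u = 0 \<or> supnorm u = 1"
    using supnorm_nonneg[of u] by linarith
  have sub: "{k\<in>D. k + l \<notin> D} \<subseteq> {k\<in>D. k + l' \<notin> D} \<union> (\<lambda>x. x - l') ` boundary D"
  proof
    fix k assume k: "k \<in> {k\<in>D. k + l \<notin> D}"
    have kl: "k + l = (k + l') + u" by (simp add: u_def)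
    show "k \<in> {k\<in>D. k + l' \<notin> D} \<union> (\<lambda>x. x - l') ` boundary D"
    proof (cases "k + l' \<in> D")
      case True
      have "supnorm u = 1" using u k kl True by auto
      then have "supnorm ((k + l') - (k + l)) = 1" by (simp add: kl)
      then have "k + l' \<in> boundary D" using True k unfolding boundary_def by blast
      then show ?thesis by (intro UnI2 image_eqI[of _ _ "k + l'"]) auto
    qed (use k in auto)
  qed
  have fb: "finite (boundary D)" using assms(1) by (simp add: boundary_def)
  have "card {k\<in>D. k + l \<notin> D} \<le> card ({k\<in>D. k + l' \<notin> D} \<union> (\<lambda>x. x - l') ` boundary D)"
    using assms(1) fb sub by (intro card_mono) auto
  also have "\<dots> \<le> card {k\<in>D. k + l' \<notin> D} + card (boundary D)"
    by (meson card_Un_le card_image_le fb add_left_mono order_trans)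
  finally show ?case using IH by simp
qed

text \<open>Move the slice along the axis \<open>p\<close>: the \<open>r + 1\<close> translates are disjoint, and they stay in \<open>D\<close> except for points that
  cross the boundary. So no slice holds much more than a fraction \<open>1 / (r + 1)\<close> of \<open>D\<close>.\<close>
lemma card_slice_le:
  fixes D :: "(int ^ 'm::finite) set"
  assumes "finite D"
  shows "(r + 1) * card {j\<in>D. j $ p = c} \<le> card D + (r + 1) ^ 3 * card (boundary D)"
proof -
  let ?e = "\<lambda>i::nat. axis p (int i) :: int ^ 'm"
  let ?G = "{j\<in>D. j $ p = c \<and> (\<forall>i\<le>r. j + ?e i \<in> D)}"
  have e: "supnorm (?e i) \<le> int i" for i
    by (auto simp: supnorm_le_iff axis_def)
  have inj: "inj_on (\<lambda>(i, j). j + ?e i) ({..r} \<times> ?G)"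
  proof (rule inj_onI)
    fix x y assume x: "x \<in> {..r} \<times> ?G" and y: "y \<in> {..r} \<times> ?G"
      and eq: "(case x of (i, j) \<Rightarrow> j + ?e i) = (case y of (i, j) \<Rightarrow> j + ?e i)"
    obtain i j i' j' where xy: "x = (i, j)" "y = (i', j')" by (cases x, cases y) auto
    have jp: "j $ p = c" "j' $ p = c" using x y xy by auto
    have eq': "j + ?e i = j' + ?e i'" using eq xy by simp
    then have "(j + ?e i) $ p = (j' + ?e i') $ p" by (rule arg_cong)
    then have "i = i'"
      by (simp add: axis_def jp)
    with eq' xy show "x = y" by simp
  qed
  have "(r + 1) * card ?G = card ((\<lambda>(i, j). j + ?e i) ` ({..r} \<times> ?G))"
    by (subst card_image[OF inj]) (simp add: card_cartesian_product)
  also have "\<dots> \<le> card D"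
    using assms by (intro card_mono) auto
  finally have 1: "(r + 1) * card ?G \<le> card D" .
  have "{j\<in>D. j $ p = c} \<subseteq> ?G \<union> (\<Union>i\<in>{..r}. {k\<in>D. k + ?e i \<notin> D})"
    by auto
  then have "card {j\<in>D. j $ p = c} \<le> card (?G \<union> (\<Union>i\<in>{..r}. {k\<in>D. k + ?e i \<notin> D}))"
    using assms by (intro card_mono) auto
  also have "\<dots> \<le> card ?G + (\<Sum>i\<in>{..r}. card {k\<in>D. k + ?e i \<notin> D})"
    by (intro order_trans[OF card_Un_le] add_left_mono card_UN_le) auto
  also have "(\<Sum>i\<in>{..r}. card {k\<in>D. k + ?e i \<notin> D}) \<le> (\<Sum>i\<in>{..r}. (r + 1) * card (boundary D))"
    by (intro sum_mono order_trans[OF card_exit_le[OF assms e]] mult_le_mono1) auto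
  finally have "card {j\<in>D. j $ p = c} \<le> card ?G + (r + 1) * ((r + 1) * card (boundary D))"
    by simp
  then have "(r + 1) * card {j\<in>D. j $ p = c} \<le> (r + 1) * (card ?G + (r + 1) * ((r + 1) * card (boundary D)))"
    by (rule mult_le_mono2)
  also have "\<dots> = (r + 1) * card ?G + (r + 1)^3 * card (boundary D)"
    by (simp add: power3_eq_cube algebra_simps)
  finally show ?thesis using 1 by linarith
qed

text \<open>A point that is lexicographically between \<open>k\<close> and \<open>k + l\<close> has its most significant coordinate between theirs, so it lies in
  one of boundedly many slices of \<open>D\<close>, and these are small by the slice bound.\<close>
lemma lex_between_negligible:
  fixes D :: "nat \<Rightarrow> (int ^ 'm::{finite,linorder}) set" and \<epsilon> :: real
  assumes fin: "\<And>N. finite (D N)"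
    and large: "filterlim (\<lambda>N. card (D N)) at_top sequentially"
    and bd: "(\<lambda>N. real (card (boundary (D N))) / real (card (D N))) \<longlonglongrightarrow> 0"
    and "\<epsilon> > 0"
  shows "\<forall>\<^sub>F N in sequentially. \<forall>k. real (card {j\<in>D N. lex_less j k \<noteq> lex_less j (k + l)}) \<le> \<epsilon> * real (card (D N))"
proof -
  define p :: 'm where "p = Min UNIV"
  define L where "L = nat \<bar>l $ p\<bar>"
  (* The 2 * L + 1 slices are bounded by card D / (r + 1) and a multiple of the boundary;
     r and then eta give each of the two parts a share of epsilon / 2. *)
  obtain r :: nat where r: "(2 * real L + 1) / (\<epsilon> / 2) < real r" using reals_Archimedean2 by blast
  define \<eta> where "\<eta> = \<epsilon> / 2 / ((2 * real L + 1) * (r + 1)^3)"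
  have "\<eta> > 0" using \<open>\<epsilon> > 0\<close> by (simp add: \<eta>_def)
  have ev1: "\<forall>\<^sub>F N in sequentially. real (card (boundary (D N))) / real (card (D N)) < \<eta>"
    using order_tendstoD(2)[OF bd \<open>\<eta> > 0\<close>] .
  have ev2: "\<forall>\<^sub>F N in sequentially. card (D N) > 0"
    using large unfolding filterlim_at_top by (metis (mono_tags, lifting) eventually_mono less_eq_Suc_le)
  show ?thesis
    using ev1 ev2
  proof eventually_elim
    case (elim N)
    let ?n = "real (card (D N))"
    have b: "real (card (boundary (D N))) \<le> \<eta> * ?n"
      using elim by (simp add: field_simps)
    have slice: "real (card {j\<in>D N. j $ p = c}) \<le> ?n / real (r + 1) + (r+1)^3 * (\<eta> * ?n)" for c
    proof -
      have "real ((r + 1) * card {j\<in>D N. j $ p = c}) \<le> real (card (D N) + (r + 1) ^ 3 * card (boundary (D N)))"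
        using card_slice_le[OF fin[of N], of r p c] of_nat_le_iff by blast
      also have "\<dots> \<le> ?n + (r + 1)^3 * (\<eta> * ?n)"
        using b by (simp add: mult_left_mono)
      finally have "real (card {j\<in>D N. j $ p = c}) \<le> (?n + (r + 1)^3 * (\<eta> * ?n)) / (r + 1)"
        by (simp add: field_simps)
      also have "\<dots> = ?n / real (r + 1) + (r + 1)^3 * (\<eta> * ?n) / (r + 1)"
        by (simp add: add_divide_distrib)
      also have "(r + 1)^3 * (\<eta> * ?n) / (r + 1) \<le> (r + 1)^3 * (\<eta> * ?n) / 1"
        using \<open>\<eta> > 0\<close> by (intro divide_left_mono mult_nonneg_nonneg) auto
      finally show ?thesis by simp
    qed
    show ?case
    proof
      fix k
      let ?B = "{j\<in>D N. lex_less j k \<noteq> lex_less j (k + l)}"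
      have sub: "?B \<subseteq> (\<Union>c\<in>{k $ p - int L..k $ p + int L}. {j\<in>D N. j $ p = c})"
      proof
        fix j assume j: "j \<in> ?B"
        have "k $ p - int L \<le> j $ p \<and> j $ p \<le> k $ p + int L"
        proof (cases "lex_less j k")
          case True
          then have "\<not> lex_less j (k + l)" using j by simp
          then have "lex_less (k + l) j \<or> k + l = j" using lex_less_linear by blast
          then have "(k + l) $ p \<le> j $ p" using lex_less_first_coordinate[of "k+l" j] by (auto simp: p_def)
          moreover have "j $ p \<le> k $ p" using lex_less_first_coordinate[OF True] by (simp add: p_def)
          ultimately show ?thesis by (simp add: L_def)
        next
          case False
          then have "lex_less k j \<or> k = j" using lex_less_linear by blast
          then have "k $ p \<le> j $ p" using lex_less_first_coordinate[of k j] by (auto simp: p_def)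
          moreover have "lex_less j (k + l)" using False j by simp
          then have "j $ p \<le> (k + l) $ p" using lex_less_first_coordinate[of j "k + l"] by (simp add: p_def)
          ultimately show ?thesis by (simp add: L_def)
        qed
        then show "j \<in> (\<Union>c\<in>{k $ p - int L..k $ p + int L}. {j\<in>D N. j $ p = c})"
          using j by auto
      qed
      have "card ?B \<le> card (\<Union>c\<in>{k $ p - int L..k $ p + int L}. {j\<in>D N. j $ p = c})"
        using fin by (intro card_mono sub) auto
      also have "\<dots> \<le> (\<Sum>c\<in>{k $ p - int L..k $ p + int L}. card {j\<in>D N. j $ p = c})"
        by (intro card_UN_le) auto
      finally have "real (card ?B) \<le> (\<Sum>c\<in>{k $ p - int L..k $ p + int L}. real (card {j\<in>D N. j $ p = c}))"
        unfolding of_nat_sum[symmetric] of_nat_le_iff .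
      also have "\<dots> \<le> (\<Sum>c\<in>{k $ p - int L..k $ p + int L}. ?n / real (r + 1) + (r+1)^3 * (\<eta> * ?n))"
        by (intro sum_mono slice)
      also have "\<dots> = (2 * real L + 1) * (?n / real (r + 1) + (r+1)^3 * (\<eta> * ?n))"
        by simp
      also have "\<dots> = (2 * real L + 1) / real (r + 1) * ?n + (2 * real L + 1) * (r+1)^3 * \<eta> * ?n"
        by (simp add: algebra_simps)
      also have "(2 * real L + 1) * (r+1)^3 * \<eta> = \<epsilon> / 2"
        by (simp add: \<eta>_def)
      also have "(2 * real L + 1) / real (r + 1) \<le> \<epsilon> / 2"
        using r \<open>\<epsilon> > 0\<close> by (simp add: field_simps)
      finally show "real (card ?B) \<le> \<epsilon> * ?n"
        by (simp add: mult_right_mono)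
    qed
  qed
qed

lemma summable_on_int_powr:
  assumes "a > (1::real)"
  shows "(\<lambda>k::int. (1 + real_of_int \<bar>k\<bar>) powr - a) summable_on UNIV"
proof -
  have nat: "(\<lambda>n::nat. (1 + real n) powr - a) summable_on UNIV"
  proof -
    have "summable (\<lambda>n::nat. real n powr - a)"
      using assms by (simp add: summable_real_powr_iff)
    then have "summable (\<lambda>n::nat. real (Suc n) powr - a)"
      by (subst summable_Suc_iff)
    then show ?thesis
      by (subst summable_on_UNIV_nonneg_real_iff) (auto simp: add.commute)
  qed
  have 1: "(\<lambda>k::int. (1 + real_of_int \<bar>k\<bar>) powr - a) summable_on (range int)"
    by (subst summable_on_reindex) (auto simp: o_def nat)
  have 2: "(\<lambda>k::int. (1 + real_of_int \<bar>k\<bar>) powr - a) summable_on (range (\<lambda>n. - int n))"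
    by (subst summable_on_reindex) (auto simp: o_def nat inj_on_def)
  have U: "(UNIV :: int set) = range int \<union> range (\<lambda>n. - int n)"
  proof -
    have "k \<in> range int \<union> range (\<lambda>n. - int n)" for k :: int
      by (cases k rule: int_cases2) auto
    then show ?thesis by blast
  qed
  show ?thesis
    unfolding U by (rule summable_on_union[OF 1 2])
qed

text \<open>The sup-norm is bounded below by every coordinate, so the summand is at most a constant times a product over the coordinates
  of one-dimensional terms with exponent \<open>\<beta>\<close> divided by the dimension, which is greater than one.\<close>
lemma summable_on_lattice_powr:
  assumes "\<beta> > real CARD('m)"
  shows "(\<lambda>k::int ^ 'm::finite. max 1 (real_of_int (supnorm k)) powr - \<beta>) summable_on UNIV"
proof -
  let ?m = "real CARD('m)"
  define a where "a = \<beta> / ?m"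
  have m: "?m > 0" by simp
  have a: "a > 1" using assms m by (simp add: a_def)
  let ?f = "\<lambda>k::int. (1 + real_of_int \<bar>k\<bar>) powr - a"
  note sf = summable_on_int_powr[OF a]
  define S where "S = infsum ?f UNIV"
  have bound: "max 1 (real_of_int (supnorm k)) powr - \<beta> \<le> 2 powr \<beta> * (\<Prod>i\<in>UNIV. ?f (k $ i))" for k :: "int ^ 'm"
  proof -
    let ?M = "max 1 (real_of_int (supnorm k))"
    have "(2 * ?M) powr - a \<le> ?f (k $ i)" for i
      using supnorm_ge_component[of k i] a by (intro powr_mono2') auto
    then have "(\<Prod>i\<in>(UNIV::'m set). (2 * ?M) powr - a) \<le> (\<Prod>i\<in>UNIV. ?f (k $ i))"
      by (intro prod_mono) auto
    also have "(\<Prod>i\<in>(UNIV::'m set). (2 * ?M) powr - a) = ((2 * ?M) powr - a) powr ?m"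
      by (simp add: powr_realpow)
    also have "\<dots> = (2 * ?M) powr - \<beta>"
      using m by (simp add: powr_powr a_def)
    also have "\<dots> = 2 powr - \<beta> * ?M powr - \<beta>" by (simp add: powr_mult)
    finally have "2 powr \<beta> * (2 powr - \<beta> * ?M powr - \<beta>) \<le> 2 powr \<beta> * (\<Prod>i\<in>UNIV. ?f (k $ i))"
      by (intro mult_left_mono) auto
    then show ?thesis by (simp add: powr_minus field_simps)
  qed
  have fin: "(\<Sum>k\<in>F. \<Prod>i\<in>UNIV. ?f (k $ i)) \<le> S ^ CARD('m)" if "finite F" for F :: "(int ^ 'm) set"
  proof -
    define B where "B = (\<Union>k\<in>F. range (\<lambda>i. k $ i))"
    have fB: "finite B" using that by (auto simp: B_def)
    have "(\<Sum>k\<in>F. \<Prod>i\<in>UNIV. ?f (k $ i)) = (\<Sum>g\<in>vec_nth ` F. \<Prod>i\<in>UNIV. ?f (g i))"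
      by (subst sum.reindex) (auto simp: inj_on_def vec_nth_inject)
    also have "\<dots> \<le> (\<Sum>g\<in>(UNIV::'m set) \<rightarrow>\<^sub>E B. \<Prod>i\<in>UNIV. ?f (g i))"
    proof (rule sum_mono2)
      show "finite ((UNIV :: 'm set) \<rightarrow>\<^sub>E B)" using fB by (intro finite_PiE) auto
      show "vec_nth ` F \<subseteq> UNIV \<rightarrow>\<^sub>E B" by (auto simp: B_def)
    qed (auto intro!: prod_nonneg)
    also have "\<dots> = (\<Prod>i\<in>(UNIV::'m set). \<Sum>k\<in>B. ?f k)"
      using fB by (subst prod_sum_PiE) auto
    also have "\<dots> \<le> (\<Prod>i\<in>(UNIV::'m set). S)"
      using fB sf unfolding S_def by (intro prod_mono conjI sum_nonneg finite_sum_le_infsum) auto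
    finally show ?thesis by simp
  qed
  show ?thesis
  proof (rule nonneg_bdd_above_summable_on)
    show "bdd_above (sum (\<lambda>k::int ^ 'm. max 1 (real_of_int (supnorm k)) powr - \<beta>) ` {F. F \<subseteq> UNIV \<and> finite F})"
    proof (rule bdd_aboveI2)
      fix F :: "(int ^ 'm) set" assume "F \<in> {F. F \<subseteq> UNIV \<and> finite F}"
      then have F: "finite F" by simp
      have "(\<Sum>k\<in>F. max 1 (real_of_int (supnorm k)) powr - \<beta>) \<le> (\<Sum>k\<in>F. 2 powr \<beta> * (\<Prod>i\<in>UNIV. ?f (k $ i)))"
        by (intro sum_mono bound)
      also have "\<dots> \<le> 2 powr \<beta> * S ^ CARD('m)"
        unfolding sum_distrib_left[symmetric] by (intro mult_left_mono fin F) auto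
      finally show "(\<Sum>k\<in>F. max 1 (real_of_int (supnorm k)) powr - \<beta>) \<le> 2 powr \<beta> * S ^ CARD('m)" .
    qed
  qed auto
qed

lemma filterlim_supnorm_less:
  "filterlim (\<lambda>R. {t :: int ^ 'm::finite. supnorm t < int R}) (finite_subsets_at_top UNIV) sequentially"
  unfolding filterlim_def le_filter_def eventually_filtermap eventually_finite_subsets_at_top
proof (intro allI impI, elim exE conjE)
  fix P and A :: "(int ^ 'm) set"
  assume A: "finite A" and P: "\<forall>Y. finite Y \<and> A \<subseteq> Y \<and> Y \<subseteq> UNIV \<longrightarrow> P Y"
  define R0 where "R0 = nat (Max (insert 0 (supnorm ` A))) + 1"
  show "\<forall>\<^sub>F R in sequentially. P {t. supnorm t < int R}"
  proof (rule eventually_sequentiallyI[of R0])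
    fix R assume R: "R0 \<le> R"
    have "supnorm t < int R" if "t \<in> A" for t
    proof -
      have "supnorm t \<le> Max (insert 0 (supnorm ` A))"
        using A that by (intro Max_ge) auto
      then show ?thesis using R unfolding R0_def by linarith
    qed
    then show "P {t. supnorm t < int R}"
      using P finite_supnorm_less by blast
  qed
qed

lemma supnorm_tail_small:
  fixes f :: "int ^ 'm::finite \<Rightarrow> real"
  assumes "f summable_on UNIV" and "\<And>x. f x \<ge> 0" "\<epsilon> > 0"
  obtains R :: nat where "R \<ge> 1" "\<And>F R'. R' \<ge> R \<Longrightarrow> finite F \<Longrightarrow> (\<And>t. t \<in> F \<Longrightarrow> int R' \<le> supnorm t) \<Longrightarrow> sum f F < \<epsilon>"
proof -
  let ?B = "\<lambda>R::nat. {t :: int ^ 'm. supnorm t < int R}"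
  have "(sum f \<longlongrightarrow> infsum f UNIV) (finite_subsets_at_top UNIV)"
    using assms(1) has_sum_def has_sum_infsum by blast
  then have "(\<lambda>R. sum f (?B R)) \<longlonglongrightarrow> infsum f UNIV"
    by (rule filterlim_compose[OF _ filterlim_supnorm_less])
  then have "\<forall>\<^sub>F R in sequentially. infsum f UNIV - \<epsilon> < sum f (?B R)"
    using assms(3) by (intro order_tendstoD) auto
  then have "\<forall>\<^sub>F R in sequentially. R \<ge> 1 \<and> infsum f UNIV - \<epsilon> < sum f (?B R)"
    using eventually_ge_at_top[of "1::nat"] by eventually_elim auto
  then obtain R where R: "R \<ge> 1" "infsum f UNIV - \<epsilon> < sum f (?B R)"
    by (auto simp: eventually_sequentially)
  show ?thesis
  proof (rule that[OF R(1)])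
    fix F :: "(int ^ 'm) set" and R' :: nat assume R': "R' \<ge> R" and F: "finite F" "\<And>t. t \<in> F \<Longrightarrow> int R' \<le> supnorm t"
    have "sum f F + sum f (?B R) = sum f (F \<union> ?B R)"
    proof (rule sum.union_disjoint[symmetric])
      have "\<not> supnorm t < int R" if "t \<in> F" for t
        using F(2)[OF that] R' by linarith
      then show "F \<inter> ?B R = {}" by blast
    qed (rule F(1) finite_supnorm_less)+
    also have "\<dots> \<le> infsum f UNIV"
    proof (rule finite_sum_le_infsum)
      show "finite (F \<union> ?B R)" using F(1) finite_supnorm_less by (rule finite_UnI)
    qed (use assms(1,2) in simp_all)
    finally show "sum f F < \<epsilon>" using R by linarith
  qed
qed

section \<open>Square roots of positive semidefinite matrices\<close>

lemma quadratic_form_eq_sum: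
  fixes S :: "real ^ 'n::finite ^ 'n"
  shows "v \<bullet> (S *v v) = (\<Sum>i\<in>UNIV. \<Sum>j\<in>UNIV. v $ i * S $ i $ j * v $ j)"
  by (simp add: inner_vec_def matrix_vector_mult_def sum_distrib_left mult.assoc)

text \<open>Otherwise the quadratic form, restricted to the plane of the axes \<open>i\<close> and \<open>j\<close>, would take negative values.\<close>
lemma psd_zero_diagonal:
  fixes S :: "real ^ 'n::finite ^ 'n"
  assumes "pos_semidefinite S" "S $ i $ i = 0"
  shows "S $ i $ j = 0"
proof (cases "i = j")
  case False
  have sym: "S $ j $ i = S $ i $ j"
    using assms(1) unfolding pos_semidefinite_def by (metis transpose_def vec_lambda_beta)
  have "0 \<le> S $ j $ j + 2 * t * S $ i $ j" for t
  proof -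
    let ?v = "axis j 1 + t *\<^sub>R axis i 1 :: real ^ 'n"
    have "0 \<le> ?v \<bullet> (S *v ?v)"
      using assms(1) by (auto simp: pos_semidefinite_def)
    also have "?v \<bullet> (S *v ?v) = S $ j $ j + t * S $ j $ i + t * S $ i $ j + t * t * S $ i $ i"
      by (simp add: matrix_vector_right_distrib matrix_vector_mult_scaleR inner_add_left inner_add_right
          inner_axis' matrix_vector_mul_component inner_axis algebra_simps)
    finally show ?thesis using assms(2) sym by simp
  qed
  from this[of "- (S $ j $ j + 1) / (2 * S $ i $ j)"] show ?thesis
    by (cases "S $ i $ j = 0") (auto simp: field_simps)
qed (use assms in simp)

text \<open>Gaussian elimination: subtracting the rank-one matrix of row \<open>p\<close> leaves a positive semidefinite matrix (its quadratic form at
  \<open>v\<close> is that of \<open>S\<close> at a shift of \<open>v\<close> along the axis \<open>p\<close>) whose row \<open>p\<close> vanishes. Tracking the set \<open>I\<close> of possibly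
  nonzero rows makes this an induction over a finite set.\<close>
lemma psd_sqrt_supported:
  fixes S :: "real ^ 'n::finite ^ 'n"
  assumes "finite I" "pos_semidefinite S" "\<And>i j. i \<notin> I \<Longrightarrow> S $ i $ j = 0"
  shows "\<exists>A :: real ^ 'n ^ 'n. A ** transpose A = S \<and> (\<forall>i j. j \<notin> I \<longrightarrow> A $ i $ j = 0)"
  using assms
proof (induction I arbitrary: S rule: finite_induct)
  case empty
  then have "S = 0" by (simp add: vec_eq_iff)
  then show ?case by (intro exI[of _ 0]) (simp add: vec_eq_iff matrix_matrix_mult_def)
next
  case (insert p I)
  note psd = insert.prems(1)
  have sym: "S $ j $ i = S $ i $ j" for i j
    using psd unfolding pos_semidefinite_def by (metis transpose_def vec_lambda_beta)
  have pos: "0 \<le> S $ p $ p"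
  proof -
    have "0 \<le> axis p 1 \<bullet> (S *v axis p 1)" using psd by (simp add: pos_semidefinite_def)
    then show ?thesis by (simp add: inner_axis' matrix_vector_mul_component inner_axis)
  qed
  show ?case
  proof (cases "S $ p $ p = 0")
    case True
    have "S $ i $ j = 0" if "i \<notin> I" for i j
      using insert.prems(2)[of i j] psd_zero_diagonal[OF psd True, of j] that by (cases "i = p") auto
    from insert.IH[OF psd this] show ?thesis by blast
  next
    case False
    define d where "d = S $ p $ p"
    have d: "d > 0" using False pos by (simp add: d_def)
    define T :: "real ^ 'n ^ 'n" where "T = (\<chi> i j. S $ i $ j - S $ i $ p * S $ p $ j / d)"
    have "pos_semidefinite T"
      unfolding pos_semidefinite_def
    proof (intro conjI allI)
      show "transpose T = T" by (simp add: T_def transpose_def vec_eq_iff sym mult.commute)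
      fix v :: "real ^ 'n"
      define c where "c = (\<Sum>j\<in>UNIV. S $ p $ j * v $ j)"
      let ?w = "v - (c / d) *\<^sub>R axis p 1"
      have Sv: "(S *v v) $ p = c" by (simp add: c_def matrix_vector_mult_def)
      have vS: "v \<bullet> (S *v axis p 1) = c"
        by (simp add: c_def matrix_vector_mult_basis inner_vec_def column_def sym mult.commute)
      have "0 \<le> ?w \<bullet> (S *v ?w)" using psd by (simp add: pos_semidefinite_def)
      also have "?w \<bullet> (S *v ?w) = v \<bullet> (S *v v) - c / d * c - c / d * c + (c / d)\<^sup>2 * d"
        using vS Sv
        by (simp add: matrix_vector_mult_diff_distrib matrix_vector_mult_scaleR inner_diff_left inner_diff_right
            inner_axis' matrix_vector_mul_component inner_axis d_def[symmetric] power2_eq_square algebra_simps)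
      also have "\<dots> = v \<bullet> (S *v v) - c * c / d"
        using d by (simp add: field_simps power2_eq_square)
      also have "\<dots> = v \<bullet> (T *v v)"
        unfolding quadratic_form_eq_sum
        by (simp add: T_def c_def right_diff_distrib left_diff_distrib sum_subtractf sum_product
            sum_divide_distrib mult_ac sym)
      finally show "0 \<le> v \<bullet> (T *v v)" .
    qed
    moreover have "T $ i $ j = 0" if "i \<notin> I" for i j
      using that insert.prems(2)[of i] d by (cases "i = p") (auto simp: T_def d_def)
    ultimately obtain A :: "real ^ 'n ^ 'n"
      where A: "A ** transpose A = T" "\<And>i j. j \<notin> I \<Longrightarrow> A $ i $ j = 0"
      using insert.IH by blast
    define B :: "real ^ 'n ^ 'n" where "B = (\<chi> i j. if j = p then S $ i $ p / sqrt d else A $ i $ j)"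
    have "(B ** transpose B) $ i $ j = S $ i $ j" for i j
    proof -
      have "(B ** transpose B) $ i $ j = (\<Sum>k\<in>UNIV. B $ i $ k * B $ j $ k)"
        by (simp add: matrix_matrix_mult_def transpose_def)
      also have "\<dots> = B $ i $ p * B $ j $ p + (\<Sum>k\<in>UNIV-{p}. B $ i $ k * B $ j $ k)"
        by (subst sum.remove[of _ p]) auto
      also have "(\<Sum>k\<in>UNIV-{p}. B $ i $ k * B $ j $ k) = (\<Sum>k\<in>UNIV-{p}. A $ i $ k * A $ j $ k)"
        by (intro sum.cong) (auto simp: B_def)
      also have "\<dots> = (\<Sum>k\<in>UNIV. A $ i $ k * A $ j $ k)"
        using A(2)[OF insert.hyps(2)] by (subst (2) sum.remove[of _ p]) auto
      also have "\<dots> = T $ i $ j"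
        unfolding A(1)[symmetric] by (simp add: matrix_matrix_mult_def transpose_def)
      also have "B $ i $ p * B $ j $ p = S $ i $ p * S $ p $ j / d"
        using d by (simp add: B_def sym)
      finally show ?thesis by (simp add: T_def)
    qed
    moreover have "B $ i $ j = 0" if "j \<notin> insert p I" for i j
      using that A(2) by (simp add: B_def)
    ultimately show ?thesis by (intro exI[of _ B]) (simp add: vec_eq_iff)
  qed
qed

lemma psd_has_sqrt:
  fixes S :: "real ^ 'n::finite ^ 'n"
  assumes "pos_semidefinite S"
  obtains A :: "real ^ 'n ^ 'n" where "A ** transpose A = S"
  using psd_sqrt_supported[of UNIV S] assms by auto

section \<open>Gaussian vectors\<close>

lemma Basis_vec_real: "(Basis :: (real ^ 'n::finite) set) = (\<lambda>i. axis i 1) ` UNIV"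
  by (auto simp: Basis_vec_def)

lemma inj_axis_one: "inj (\<lambda>i. axis i (1::real))"
  by (rule injI) (simp add: axis_eq_axis)

lemma integral_lborel_vec_prod:
  fixes f :: "'n::finite \<Rightarrow> real \<Rightarrow> 'b::{real_normed_field,banach,second_countable_topology}"
  assumes f: "\<And>i. integrable lborel (f i)"
  shows "integrable lborel (\<lambda>x :: real ^ 'n. \<Prod>i\<in>UNIV. f i (x $ i))"
    and "(\<integral>x. (\<Prod>i\<in>UNIV. f i (x $ i)) \<partial>(lborel :: (real ^ 'n) measure)) = (\<Prod>i\<in>UNIV. (\<integral>x. f i x \<partial>lborel))"
proof -
  let ?ax = "\<lambda>i. axis i (1::real)"
  let ?B = "Basis :: (real ^ 'n) set"
  define g where "g b = f (inv ?ax b)" for b :: "real ^ 'n"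
  have g: "g (?ax i) = f i" for i by (simp add: g_def inv_f_f[OF inj_axis_one])
  have [measurable]: "f i \<in> borel_measurable borel" for i
    using borel_measurable_integrable[OF f] by simp
  have prod: "(\<Prod>i\<in>UNIV. f i (x $ i)) = (\<Prod>b\<in>?B. g b (x \<bullet> b))" for x :: "real ^ 'n"
    unfolding Basis_vec_real by (subst prod.reindex[OF inj_axis_one]) (simp add: g inner_axis)
  have comp: "(\<Sum>b\<in>?B. h b *\<^sub>R b) \<bullet> b = h b" if "b \<in> ?B" for h b
    using that by (simp add: inner_sum_left inner_Basis if_distrib sum.If_cases cong: if_cong)
  have pc: "(\<Prod>i\<in>UNIV. f i ((\<Sum>b\<in>?B. h b *\<^sub>R b) $ i)) = (\<Prod>b\<in>?B. g b (h b))" for h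
    unfolding prod by (intro prod.cong refl) (simp only: comp)
  have gi: "integrable lborel (g b)" for b by (simp add: g_def f)
  have lb: "(lborel :: (real ^ 'n) measure) = distr (Pi\<^sub>M ?B (\<lambda>b. lborel)) borel (\<lambda>h. \<Sum>b\<in>?B. h b *\<^sub>R b)"
    by (rule lborel_eq)
  interpret P: product_sigma_finite "\<lambda>b :: real ^ 'n. lborel :: real measure"
    by standard
  have m: "(\<lambda>h. \<Sum>b\<in>?B. h b *\<^sub>R b) \<in> measurable (Pi\<^sub>M ?B (\<lambda>b. lborel)) borel"
    by measurable
  have m2: "(\<lambda>x :: real ^ 'n. \<Prod>i\<in>UNIV. f i (x $ i)) \<in> borel_measurable borel"
    by measurable
  show "integrable lborel (\<lambda>x :: real ^ 'n. \<Prod>i\<in>UNIV. f i (x $ i))"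
    unfolding lb integrable_distr_eq[OF m m2] pc
    by (rule P.product_integrable_prod) (simp_all add: gi)
  have "(\<integral>x. (\<Prod>i\<in>UNIV. f i (x $ i)) \<partial>(lborel :: (real ^ 'n) measure))
    = (\<integral>h. (\<Prod>b\<in>?B. g b (h b)) \<partial>Pi\<^sub>M ?B (\<lambda>b. lborel))"
    unfolding lb integral_distr[OF m m2] pc ..
  also have "\<dots> = (\<Prod>b\<in>?B. (\<integral>x. g b x \<partial>lborel))"
    using gi by (intro P.product_integral_prod) auto
  also have "\<dots> = (\<Prod>i\<in>UNIV. (\<integral>x. f i x \<partial>lborel))"
    unfolding Basis_vec_real by (subst prod.reindex[OF inj_axis_one]) (simp add: g)
  finally show "(\<integral>x. (\<Prod>i\<in>UNIV. f i (x $ i)) \<partial>(lborel :: (real ^ 'n) measure)) = (\<Prod>i\<in>UNIV. (\<integral>x. f i x \<partial>lborel))" .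
qed

lemma sets_std_normal_vec [simp, measurable_cong]: "sets (std_normal_vec :: (real ^ 'n::finite) measure) = sets borel"
  by (simp add: std_normal_vec_def)

lemma space_std_normal_vec [simp]: "space (std_normal_vec :: (real ^ 'n::finite) measure) = UNIV"
  by (simp add: std_normal_vec_def)

lemma integral_std_normal_vec_prod:
  fixes f :: "'n::finite \<Rightarrow> real \<Rightarrow> complex"
  assumes [measurable]: "\<And>i. f i \<in> borel_measurable borel" and b: "\<And>i x. cmod (f i x) \<le> 1"
  shows "(\<integral>x. (\<Prod>i\<in>UNIV. f i (x $ i)) \<partial>std_normal_vec) = (\<Prod>i\<in>UNIV. (\<integral>x. f i x \<partial>std_normal_distribution))"
proof -
  have int: "integrable lborel (\<lambda>x. std_normal_density x *\<^sub>R f i x)" for i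
  proof (rule Bochner_Integration.integrable_bound)
    show "integrable lborel std_normal_density" by simp
    show "AE x in lborel. norm (std_normal_density x *\<^sub>R f i x) \<le> norm (std_normal_density x)"
      using b by (intro AE_I2) (simp add: mult_left_le)
  qed measurable
  have "(\<integral>x. (\<Prod>i\<in>UNIV. f i (x $ i)) \<partial>std_normal_vec)
    = (\<integral>x. (\<Prod>i\<in>UNIV. std_normal_density (x $ i)) *\<^sub>R (\<Prod>i\<in>UNIV. f i (x $ i)) \<partial>(lborel :: (real ^ 'n) measure))"
    unfolding std_normal_vec_def by (subst integral_density) (auto intro!: prod_nonneg)
  also have "\<dots> = (\<integral>x. (\<Prod>i\<in>UNIV. std_normal_density (x $ i) *\<^sub>R f i (x $ i)) \<partial>(lborel :: (real ^ 'n) measure))"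
    by (simp add: scaleR_conv_of_real prod.distrib)
  also have "\<dots> = (\<Prod>i\<in>UNIV. (\<integral>x. std_normal_density x *\<^sub>R f i x \<partial>lborel))"
    by (rule integral_lborel_vec_prod(2)[OF int])
  also have "\<dots> = (\<Prod>i\<in>UNIV. (\<integral>x. f i x \<partial>std_normal_distribution))"
    by (intro prod.cong refl, subst integral_density) auto
  finally show ?thesis .
qed

lemma prob_space_std_normal_vec: "prob_space (std_normal_vec :: (real ^ 'n::finite) measure)"
proof
  have "emeasure (std_normal_vec :: (real ^ 'n) measure) (space std_normal_vec)
    = (\<integral>\<^sup>+x. ennreal (\<Prod>i\<in>UNIV. std_normal_density ((x :: real ^ 'n) $ i)) \<partial>lborel)"
    unfolding std_normal_vec_def by (subst emeasure_density) auto
  also have "\<dots> = ennreal (\<integral>x. (\<Prod>i\<in>UNIV. std_normal_density ((x :: real ^ 'n) $ i)) \<partial>lborel)"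
    by (intro nn_integral_eq_integral integral_lborel_vec_prod(1)) (auto intro!: prod_nonneg)
  also have "\<dots> = 1"
    by (subst integral_lborel_vec_prod(2)) auto
  finally show "emeasure (std_normal_vec :: (real ^ 'n) measure) (space std_normal_vec) = 1" .
qed

lemma char_std_normal_vec:
  "(\<integral>z. iexp (t \<bullet> z) \<partial>std_normal_vec) = complex_of_real (exp (- (t \<bullet> t) / 2))"
  for t :: "real ^ 'n::finite"
proof -
  have "(\<integral>z. iexp (t \<bullet> z) \<partial>std_normal_vec) = (\<integral>z. (\<Prod>i\<in>UNIV. iexp (t $ i * z $ i)) \<partial>std_normal_vec)"
    by (simp add: inner_vec_def sum_distrib_left exp_sum)
  also have "\<dots> = (\<Prod>i\<in>UNIV. (\<integral>x. iexp (t $ i * x) \<partial>std_normal_distribution))"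
    by (rule integral_std_normal_vec_prod) auto
  also have "\<dots> = (\<Prod>i\<in>UNIV. complex_of_real (exp (- ((t $ i)^2) / 2)))"
    using char_std_normal_distribution by (simp add: char_def fun_eq_iff)
  also have "\<dots> = complex_of_real (exp (\<Sum>i\<in>UNIV. - ((t $ i)^2) / 2))"
    by (simp add: exp_sum)
  also have "(\<Sum>i\<in>UNIV. - ((t $ i)^2) / 2) = - (t \<bullet> t) / 2"
    by (simp add: inner_vec_def power2_eq_square sum_negf sum_divide_distrib)
  finally show ?thesis .
qed

lemma matrix_vector_mult_measurable [measurable]:
  fixes A :: "real ^ 'n::finite ^ 'n"
  shows "(*v) A \<in> borel_measurable borel"
  by (intro borel_measurable_continuous_onI linear_continuous_on matrix_vector_mul_bounded_linear)

lemma
  fixes S :: "real ^ 'n::finite ^ 'n"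
  shows prob_space_multivariate_normal: "prob_space (multivariate_normal 0 S)"
    and sets_multivariate_normal [simp, measurable_cong]: "sets (multivariate_normal 0 S) = sets borel"
proof -
  interpret prob_space "std_normal_vec :: (real ^ 'n) measure" by (rule prob_space_std_normal_vec)
  show "prob_space (multivariate_normal 0 S)"
    unfolding multivariate_normal_def
    by (intro prob_space_distr) measurable
  show "sets (multivariate_normal 0 S) = sets borel" by (simp add: multivariate_normal_def)
qed

text \<open>The choice of the matrix square root in \<open>multivariate_normal\<close> enters only through its product with its transpose.\<close>
lemma char_multivariate_normal:
  fixes S :: "real ^ 'n::finite ^ 'n"
  assumes "pos_semidefinite S"
  shows "(\<integral>x. iexp (v \<bullet> x) \<partial>multivariate_normal 0 S) = complex_of_real (exp (- (v \<bullet> (S *v v)) / 2))"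
proof -
  define A :: "real ^ 'n ^ 'n" where "A = (SOME A. A ** transpose A = S)"
  have A: "A ** transpose A = S"
    unfolding A_def by (rule someI_ex) (use psd_has_sqrt[OF assms] in blast)
  have m: "(\<lambda>z. 0 + A *v z) \<in> borel_measurable std_normal_vec"
    by measurable
  have "(\<integral>x. iexp (v \<bullet> x) \<partial>multivariate_normal 0 S) = (\<integral>z. iexp (v \<bullet> (A *v z)) \<partial>std_normal_vec)"
    unfolding multivariate_normal_def A_def[symmetric] by (subst integral_distr[OF m]) auto
  also have "\<dots> = (\<integral>z. iexp ((transpose A *v v) \<bullet> z) \<partial>std_normal_vec)"
    by (simp add: dot_lmul_matrix[symmetric] transpose_matrix_vector)
  also have "\<dots> = complex_of_real (exp (- ((transpose A *v v) \<bullet> (transpose A *v v)) / 2))"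
    by (rule char_std_normal_vec)
  also have "(transpose A *v v) \<bullet> (transpose A *v v) = v \<bullet> (S *v v)"
    unfolding A[symmetric] by (simp add: matrix_vector_mul_assoc[symmetric] dot_lmul_matrix transpose_matrix_vector)
  finally show ?thesis .
qed

section \<open>Convergence in distribution from characteristic functions\<close>

lemma abs_integral_le:
  fixes f g :: "'a \<Rightarrow> real"
  assumes "integrable M f" "integrable M g" "\<And>x. x \<in> space M \<Longrightarrow> \<bar>f x\<bar> \<le> g x"
  shows "\<bar>\<integral>x. f x \<partial>M\<bar> \<le> (\<integral>x. g x \<partial>M)"
proof -
  have "\<bar>\<integral>x. f x \<partial>M\<bar> \<le> (\<integral>x. \<bar>f x\<bar> \<partial>M)"
    using integral_norm_bound[of M f] by simp
  also have "\<dots> \<le> (\<integral>x. g x \<partial>M)"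
    using assms by (intro integral_mono) auto
  finally show ?thesis .
qed

lemma abs_diff_less_via:
  fixes a b c d :: real
  assumes "\<bar>a - c\<bar> \<le> r / 4" "\<bar>b - d\<bar> \<le> r / 4" "\<bar>a - b\<bar> < r / 4"
  shows "\<bar>c - d\<bar> < r"
  using assms by linarith

text \<open>An unnormalised Gaussian bump of width \<open>\<sigma>\<close> around \<open>a\<close>. Written this way it is the characteristic function of a standard
  normal vector at \<open>(1/\<sigma>) *\<^sub>R (x - a)\<close>.\<close>
definition gauss_bump :: "real \<Rightarrow> real ^ 'n::finite \<Rightarrow> real ^ 'n \<Rightarrow> real" where
  "gauss_bump \<sigma> a x = exp (- (((1/\<sigma>) *\<^sub>R (x - a)) \<bullet> ((1/\<sigma>) *\<^sub>R (x - a))) / 2)"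

lemma gauss_bump_measurable [measurable (raw)]:
  assumes [measurable]: "f \<in> borel_measurable N" "g \<in> borel_measurable N"
  shows "(\<lambda>x. gauss_bump \<sigma> (f x) (g x)) \<in> borel_measurable N"
  unfolding gauss_bump_def by measurable

lemma gauss_bump_bounds: "0 \<le> gauss_bump \<sigma> a x" "gauss_bump \<sigma> a x \<le> 1" "\<bar>gauss_bump \<sigma> a x\<bar> \<le> 1"
  by (auto simp: gauss_bump_def simp del: inner_scaleR_left inner_scaleR_right)

text \<open>The bump is an average of characters, so Fubini expresses its expectation by the characteristic function of \<open>Y\<close>.\<close>
lemma (in prob_space) expectation_gauss_bump:
  fixes Y :: "'a \<Rightarrow> real ^ 'n::finite"
  assumes [measurable]: "Y \<in> borel_measurable M"
  shows "complex_of_real (\<integral>\<omega>. gauss_bump \<sigma> a (Y \<omega>) \<partial>M)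
    = (\<integral>z. iexp (- (a \<bullet> ((1/\<sigma>) *\<^sub>R z))) * (\<integral>\<omega>. iexp (((1/\<sigma>) *\<^sub>R z) \<bullet> Y \<omega>) \<partial>M) \<partial>std_normal_vec)"
proof -
  interpret G: prob_space "std_normal_vec :: (real ^ 'n) measure" by (rule prob_space_std_normal_vec)
  interpret pair_prob_space M "std_normal_vec :: (real ^ 'n) measure" ..
  have int: "integrable (M \<Otimes>\<^sub>M std_normal_vec) (\<lambda>(\<omega>, z :: real ^ 'n). iexp (((1/\<sigma>) *\<^sub>R (Y \<omega> - a)) \<bullet> z))"
    by (rule P.integrable_const_bound[of _ 1]) auto
  have "complex_of_real (\<integral>\<omega>. gauss_bump \<sigma> a (Y \<omega>) \<partial>M) = (\<integral>\<omega>. complex_of_real (gauss_bump \<sigma> a (Y \<omega>)) \<partial>M)"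
    by simp
  also have "\<dots> = (\<integral>\<omega>. (\<integral>z. iexp (((1/\<sigma>) *\<^sub>R (Y \<omega> - a)) \<bullet> z) \<partial>std_normal_vec) \<partial>M)"
    unfolding char_std_normal_vec gauss_bump_def ..
  also have "\<dots> = (\<integral>z. (\<integral>\<omega>. iexp (((1/\<sigma>) *\<^sub>R (Y \<omega> - a)) \<bullet> z) \<partial>M) \<partial>std_normal_vec)"
    using Fubini_integral[OF int] by simp
  also have "\<dots> = (\<integral>z. (\<integral>\<omega>. iexp (- (a \<bullet> ((1/\<sigma>) *\<^sub>R z))) * iexp (((1/\<sigma>) *\<^sub>R z) \<bullet> Y \<omega>) \<partial>M) \<partial>std_normal_vec)"
    by (simp add: exp_add[symmetric] inner_diff_left diff_divide_distrib right_diff_distrib inner_commute algebra_simps)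
  finally show ?thesis by simp
qed

lemma tendsto_expectation_gauss_bump:
  fixes Y :: "nat \<Rightarrow> 'a \<Rightarrow> real ^ 'n::finite" and \<nu> :: "(real ^ 'n) measure"
  assumes M: "prob_space M" and Y: "\<And>N. Y N \<in> borel_measurable M"
    and \<nu>: "prob_space \<nu>" "sets \<nu> = sets borel"
    and char: "\<And>v. (\<lambda>N. \<integral>\<omega>. iexp (v \<bullet> Y N \<omega>) \<partial>M) \<longlonglongrightarrow> (\<integral>x. iexp (v \<bullet> x) \<partial>\<nu>)"
  shows "(\<lambda>N. \<integral>\<omega>. gauss_bump \<sigma> a (Y N \<omega>) \<partial>M) \<longlonglongrightarrow> (\<integral>x. gauss_bump \<sigma> a x \<partial>\<nu>)"
proof -
  interpret M: prob_space M by fact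
  interpret V: prob_space \<nu> by fact
  interpret G: prob_space "std_normal_vec :: (real ^ 'n) measure" by (rule prob_space_std_normal_vec)
  note [measurable] = Y and [measurable_cong] = \<nu>(2)
  have [measurable]: "(\<lambda>x. x) \<in> borel_measurable \<nu>" by measurable
  have cmod: "cmod (\<integral>\<omega>. iexp (v \<bullet> Y N \<omega>) \<partial>M) \<le> 1" for v N
  proof -
    have "cmod (\<integral>\<omega>. iexp (v \<bullet> Y N \<omega>) \<partial>M) \<le> (\<integral>\<omega>. cmod (iexp (v \<bullet> Y N \<omega>)) \<partial>M)"
      by (rule integral_norm_bound)
    then show ?thesis by (simp add: M.prob_space)
  qed
  have m1: "(\<lambda>z. \<integral>\<omega>. iexp (((1/\<sigma>) *\<^sub>R z) \<bullet> Y N \<omega>) \<partial>M) \<in> borel_measurable (std_normal_vec :: (real ^ 'n) measure)" for N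
    by (rule M.borel_measurable_lebesgue_integral) measurable
  have m2: "(\<lambda>z. \<integral>x. iexp (((1/\<sigma>) *\<^sub>R z) \<bullet> x) \<partial>\<nu>) \<in> borel_measurable (std_normal_vec :: (real ^ 'n) measure)"
    by (rule V.borel_measurable_lebesgue_integral) measurable
  have "(\<lambda>N. \<integral>z. iexp (- (a \<bullet> ((1/\<sigma>) *\<^sub>R z))) * (\<integral>\<omega>. iexp (((1/\<sigma>) *\<^sub>R z) \<bullet> Y N \<omega>) \<partial>M) \<partial>std_normal_vec)
    \<longlonglongrightarrow> (\<integral>z. iexp (- (a \<bullet> ((1/\<sigma>) *\<^sub>R z))) * (\<integral>x. iexp (((1/\<sigma>) *\<^sub>R z) \<bullet> x) \<partial>\<nu>) \<partial>std_normal_vec)"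
  proof (rule integral_dominated_convergence[where w="\<lambda>_. 1"])
    show "AE z in std_normal_vec. norm (iexp (- (a \<bullet> ((1/\<sigma>) *\<^sub>R z))) * (\<integral>\<omega>. iexp (((1/\<sigma>) *\<^sub>R z) \<bullet> Y N \<omega>) \<partial>M)) \<le> 1" for N
      using cmod by (intro AE_I2) (simp only: norm_mult norm_exp_i_times mult_1)
    show "AE z in std_normal_vec. (\<lambda>N. iexp (- (a \<bullet> ((1/\<sigma>) *\<^sub>R z))) * (\<integral>\<omega>. iexp (((1/\<sigma>) *\<^sub>R z) \<bullet> Y N \<omega>) \<partial>M))
      \<longlonglongrightarrow> iexp (- (a \<bullet> ((1/\<sigma>) *\<^sub>R z))) * (\<integral>x. iexp (((1/\<sigma>) *\<^sub>R z) \<bullet> x) \<partial>\<nu>)"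
      by (intro AE_I2 tendsto_mult_left char)
  qed (use m1 m2 in measurable)
  then show ?thesis
    unfolding M.expectation_gauss_bump[OF Y, symmetric]
      V.expectation_gauss_bump[OF \<open>(\<lambda>x. x) \<in> borel_measurable \<nu>\<close>, symmetric] tendsto_of_real_iff .
qed

text \<open>Convolution of \<open>f\<close> with the centred normal density of standard deviation \<open>\<sigma>\<close>.\<close>
definition gauss_smooth :: "real \<Rightarrow> (real ^ 'n::finite \<Rightarrow> real) \<Rightarrow> real ^ 'n \<Rightarrow> real" where
  "gauss_smooth \<sigma> f x = (\<integral>z. f (x + \<sigma> *\<^sub>R z) \<partial>std_normal_vec)"

lemma gauss_smooth_eq_bump_integral:
  fixes f :: "real ^ 'n::finite \<Rightarrow> real"
  assumes [measurable]: "f \<in> borel_measurable borel" and \<sigma>: "\<sigma> > 0"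
  shows "gauss_smooth \<sigma> f x = (1 / (sqrt (2 * pi) * \<sigma>) ^ CARD('n)) * (\<integral>a. f a * gauss_bump \<sigma> a x \<partial>lborel)"
proof -
  define c where "c = 1 / sqrt (2 * pi) ^ CARD('n)"
  have dens: "(\<Prod>i\<in>UNIV. std_normal_density (z $ i)) = c * exp (- (z \<bullet> z) / 2)" for z :: "real ^ 'n"
    by (simp add: std_normal_density_def prod.distrib exp_sum[symmetric] inner_vec_def power2_eq_square
        sum_negf[symmetric] sum_divide_distrib c_def power_one_over prod_dividef)
  have "gauss_smooth \<sigma> f x = (\<integral>z. c * exp (- (z \<bullet> z) / 2) * f (x + \<sigma> *\<^sub>R z) \<partial>lborel)"
    unfolding gauss_smooth_def std_normal_vec_def
    by (subst integral_density) (auto intro!: prod_nonneg AE_I2 simp: dens c_def)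
  also have "\<dots> = c * (\<integral>z. gauss_bump \<sigma> (x + \<sigma> *\<^sub>R z) x * f (x + \<sigma> *\<^sub>R z) \<partial>lborel)"
    using \<sigma> by (simp add: gauss_bump_def mult.assoc)
  also have "(\<integral>z. gauss_bump \<sigma> (x + \<sigma> *\<^sub>R z) x * f (x + \<sigma> *\<^sub>R z) \<partial>lborel)
    = (\<integral>a. gauss_bump \<sigma> a x * f a \<partial>distr lborel borel (\<lambda>z. x + \<sigma> *\<^sub>R z))"
    by (subst integral_distr) auto
  also have "\<dots> = (1 / \<sigma> ^ CARD('n)) * (\<integral>a. gauss_bump \<sigma> a x * f a \<partial>lborel)"
  proof -
    have "(\<integral>a. gauss_bump \<sigma> a x * f a \<partial>(lborel :: (real ^ 'n) measure))
      = (\<integral>a. gauss_bump \<sigma> a x * f a \<partial>density (distr lborel borel (\<lambda>z. x + \<sigma> *\<^sub>R z)) (\<lambda>_. ennreal (\<bar>\<sigma>\<bar> ^ DIM(real ^ 'n))))"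
      using \<sigma> by (subst lborel_affine[of \<sigma> x]) auto
    also have "\<dots> = \<sigma> ^ CARD('n) * (\<integral>a. gauss_bump \<sigma> a x * f a \<partial>distr lborel borel (\<lambda>z. x + \<sigma> *\<^sub>R z))"
      using \<sigma> by (subst integral_density) auto
    finally show ?thesis using \<sigma> by simp
  qed
  finally show ?thesis
    by (simp add: c_def power_mult_distrib mult.commute)
qed

lemma (in prob_space) expectation_gauss_smooth:
  fixes Y :: "'a \<Rightarrow> real ^ 'n::finite"
  assumes [measurable]: "Y \<in> borel_measurable M" and f: "integrable lborel f" and \<sigma>: "\<sigma> > 0"
  shows "(\<integral>\<omega>. gauss_smooth \<sigma> f (Y \<omega>) \<partial>M)
    = (1 / (sqrt (2 * pi) * \<sigma>) ^ CARD('n)) * (\<integral>a. f a * (\<integral>\<omega>. gauss_bump \<sigma> a (Y \<omega>) \<partial>M) \<partial>lborel)"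
proof -
  interpret PL: pair_sigma_finite M "lborel :: (real ^ 'n) measure" ..
  have [measurable]: "f \<in> borel_measurable borel" using borel_measurable_integrable[OF f] by simp
  have "integrable (M \<Otimes>\<^sub>M lborel) (\<lambda>(\<omega>, a). f a * gauss_bump \<sigma> a (Y \<omega>))"
  proof (rule Bochner_Integration.integrable_bound)
    show "integrable (M \<Otimes>\<^sub>M lborel) (\<lambda>(\<omega>, a). f a)"
      using f by (intro PL.Fubini_integrable) auto
    show "AE p in M \<Otimes>\<^sub>M lborel. norm (case p of (\<omega>, a) \<Rightarrow> f a * gauss_bump \<sigma> a (Y \<omega>)) \<le> norm (case p of (\<omega>, a) \<Rightarrow> f a)"
      by (intro AE_I2) (auto simp: abs_mult gauss_bump_bounds mult_left_le)
  qed measurable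
  from PL.Fubini_integral[OF this] show ?thesis
    by (simp add: gauss_smooth_eq_bump_integral[OF _ \<sigma>])
qed

text \<open>Near the centre uniform continuity applies, and the normal law gives little mass to the remaining region.\<close>
lemma gauss_smooth_uniform:
  fixes f :: "real ^ 'n::finite \<Rightarrow> real"
  assumes uc: "uniformly_continuous_on UNIV f" and B: "\<And>x. \<bar>f x\<bar> \<le> B" and "\<epsilon> > 0"
  obtains \<sigma> where "\<sigma> > 0" "\<And>x. \<bar>gauss_smooth \<sigma> f x - f x\<bar> \<le> \<epsilon>"
proof -
  interpret G: prob_space "std_normal_vec :: (real ^ 'n) measure" by (rule prob_space_std_normal_vec)
  have [measurable]: "f \<in> borel_measurable borel"
    by (intro borel_measurable_continuous_onI uniformly_continuous_imp_continuous uc)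
  have B0: "B \<ge> 0" using B[of 0] by linarith
  obtain d where d: "d > 0" "\<And>x y. dist x y < d \<Longrightarrow> \<bar>f x - f y\<bar> < \<epsilon> / 2"
    using uc \<open>\<epsilon> > 0\<close> unfolding uniformly_continuous_on_def dist_real_def
    by (metis UNIV_I dist_commute half_gt_zero)
  have "(\<lambda>k. G.prob {z. norm z \<ge> real k}) \<longlonglongrightarrow> G.prob (\<Inter>k. {z. norm z \<ge> real k})"
    by (rule G.finite_Lim_measure_decseq) (auto simp: decseq_def)
  also have "(\<Inter>k. {z :: real ^ 'n. norm z \<ge> real k}) = {}"
    using reals_Archimedean2 not_less by fastforce
  finally have "(\<lambda>k. G.prob {z. norm z \<ge> real k}) \<longlonglongrightarrow> 0" by simp
  then have "\<forall>\<^sub>F k in sequentially. G.prob {z. norm z \<ge> real k} < \<epsilon> / (4 * B + 1)"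
    using B0 \<open>\<epsilon> > 0\<close> by (intro order_tendstoD) auto
  then have "\<forall>\<^sub>F k in sequentially. k \<ge> 1 \<and> G.prob {z. norm z \<ge> real k} < \<epsilon> / (4 * B + 1)"
    using eventually_ge_at_top[of "1::nat"] by eventually_elim auto
  then obtain k where k: "k \<ge> 1" "G.prob {z. norm z \<ge> real k} < \<epsilon> / (4 * B + 1)"
    by (auto simp: eventually_sequentially)
  have "2 * B * G.prob {z. norm z \<ge> real k} \<le> 2 * B * (\<epsilon> / (4 * B + 1))"
    using k B0 by (intro mult_left_mono) auto
  also have "\<dots> \<le> \<epsilon> / 2" using B0 \<open>\<epsilon> > 0\<close> by (simp add: field_simps)
  finally have k2: "2 * B * G.prob {z. norm z \<ge> real k} \<le> \<epsilon> / 2" .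
  define \<sigma> where "\<sigma> = d / real k"
  have \<sigma>: "\<sigma> > 0" using d k by (simp add: \<sigma>_def)
  show ?thesis
  proof (rule that[OF \<sigma>])
    fix x
    have int: "integrable std_normal_vec (\<lambda>z. f (x + \<sigma> *\<^sub>R z))"
      by (rule G.integrable_const_bound[of _ B]) (use B in auto)
    have "gauss_smooth \<sigma> f x - f x = (\<integral>z. f (x + \<sigma> *\<^sub>R z) - f x \<partial>std_normal_vec)"
      unfolding gauss_smooth_def using int by (simp add: G.prob_space[simplified])
    also have "\<bar>\<dots>\<bar> \<le> (\<integral>z. \<bar>f (x + \<sigma> *\<^sub>R z) - f x\<bar> \<partial>std_normal_vec)"
      using integral_norm_bound[of std_normal_vec "\<lambda>z. f (x + \<sigma> *\<^sub>R z) - f x"] by simp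
    also have "\<dots> \<le> (\<integral>z. \<epsilon> / 2 + 2 * B * indicator {z. norm z \<ge> real k} z \<partial>(std_normal_vec :: (real ^ 'n) measure))"
    proof (rule integral_mono)
      show "integrable std_normal_vec (\<lambda>z. \<bar>f (x + \<sigma> *\<^sub>R z) - f x\<bar>)" using int by simp
      show "integrable std_normal_vec (\<lambda>z. \<epsilon> / 2 + 2 * B * indicator {z :: real ^ 'n. norm z \<ge> real k} z)"
        by (intro Bochner_Integration.integrable_add integrable_mult_right G.integrable_const) (auto simp: less_top[symmetric])
      fix z :: "real ^ 'n"
      show "\<bar>f (x + \<sigma> *\<^sub>R z) - f x\<bar> \<le> \<epsilon> / 2 + 2 * B * indicator {z. norm z \<ge> real k} z"
      proof (cases "norm z \<ge> real k")
        case True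
        have "\<bar>f (x + \<sigma> *\<^sub>R z) - f x\<bar> \<le> B + B" using B[of x] B[of "x + \<sigma> *\<^sub>R z"] by linarith
        then show ?thesis using True \<open>\<epsilon> > 0\<close> by simp
      next
        case False
        then have "dist (x + \<sigma> *\<^sub>R z) x < d"
          using d(1) k by (simp add: dist_norm \<sigma>_def field_simps)
        then show ?thesis using d(2)[of "x + \<sigma> *\<^sub>R z" x] False by simp
      qed
    qed
    also have "\<dots> = \<epsilon> / 2 + 2 * B * G.prob {z. norm z \<ge> real k}"
      by (subst Bochner_Integration.integral_add) (auto simp: G.prob_space[simplified] less_top[symmetric])
    finally show "\<bar>gauss_smooth \<sigma> f x - f x\<bar> \<le> \<epsilon>" using k2 by linarith
  qed
qed

text \<open>A smoothed integrable function is a mixture of Gaussian bumps, for which convergence is known; and the smoothing changes a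
  uniformly continuous function only by a small constant, uniformly in \<open>N\<close>.\<close>
lemma tendsto_expectation_compact_support:
  fixes Y :: "nat \<Rightarrow> 'a \<Rightarrow> real ^ 'n::finite" and \<nu> :: "(real ^ 'n) measure" and f :: "real ^ 'n \<Rightarrow> real"
  assumes M: "prob_space M" and Y: "\<And>N. Y N \<in> borel_measurable M"
    and \<nu>: "prob_space \<nu>" "sets \<nu> = sets borel"
    and char: "\<And>v. (\<lambda>N. \<integral>\<omega>. iexp (v \<bullet> Y N \<omega>) \<partial>M) \<longlonglongrightarrow> (\<integral>x. iexp (v \<bullet> x) \<partial>\<nu>)"
    and f: "continuous_on UNIV f" and supp: "\<And>x. norm x > R \<Longrightarrow> f x = 0"
  shows "(\<lambda>N. \<integral>\<omega>. f (Y N \<omega>) \<partial>M) \<longlonglongrightarrow> (\<integral>x. f x \<partial>\<nu>)"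
proof -
  interpret M: prob_space M by fact
  interpret V: prob_space \<nu> by fact
  note [measurable] = Y and [measurable_cong] = \<nu>(2)
  have [measurable]: "f \<in> borel_measurable borel" by (rule borel_measurable_continuous_onI[OF f])
  have id: "(\<lambda>x. x) \<in> borel_measurable \<nu>" by measurable
  have "bounded (f ` cball 0 R)"
    by (intro compact_imp_bounded compact_continuous_image continuous_on_subset[OF f]) auto
  then obtain B0 where "\<forall>y\<in>f ` cball 0 R. norm y \<le> B0"
    unfolding bounded_iff by blast
  then have B0: "norm (f x) \<le> B0" if "x \<in> cball 0 R" for x
    using that by blast
  define B where "B = max B0 0"
  have B: "\<bar>f x\<bar> \<le> B" for x
    using B0[of x] supp[of x] by (cases "norm x > R") (auto simp: B_def)
  have int: "integrable lborel f"
  proof (rule Bochner_Integration.integrable_bound)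
    show "integrable lborel (\<lambda>x. B * indicator (cball 0 R :: (real ^ 'n) set) x)"
      using emeasure_bounded_finite[OF bounded_cball, of 0 R]
      by (intro integrable_mult_right integrable_real_indicator) auto
    show "AE x in lborel. norm (f x) \<le> norm (B * indicator (cball 0 R) x)"
      using B supp by (intro AE_I2) (auto simp: indicator_def B_def not_le)
  qed simp
  have uc: "uniformly_continuous_on UNIV f"
    unfolding uniformly_continuous_on_def
  proof (intro allI impI)
    fix e :: real assume "e > 0"
    have "uniformly_continuous_on (cball 0 (R + 2)) f"
      by (intro compact_uniformly_continuous continuous_on_subset[OF f]) auto
    then obtain d where d: "d > 0" "\<And>x y. x \<in> cball 0 (R+2) \<Longrightarrow> y \<in> cball 0 (R+2) \<Longrightarrow> dist y x < d \<Longrightarrow> dist (f y) (f x) < e"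
      unfolding uniformly_continuous_on_def using \<open>e > 0\<close> by metis
    have "dist (f y) (f x) < e" if "dist y x < min d 1" for x y
    proof (cases "norm x \<le> R + 1 \<or> norm y \<le> R + 1")
      case True
      have "norm x \<le> norm y + dist y x" "norm y \<le> norm x + dist y x"
        using norm_triangle_ineq2[of x y] norm_triangle_ineq2[of y x] by (auto simp: dist_norm norm_minus_commute)
      then show ?thesis using True that by (intro d) auto
    next
      case False
      then show ?thesis using supp[of x] supp[of y] \<open>e > 0\<close> by simp
    qed
    then show "\<exists>d>0. \<forall>x\<in>UNIV. \<forall>x'\<in>UNIV. dist x' x < d \<longrightarrow> dist (f x') (f x) < e"
      using d(1) by (intro exI[of _ "min d 1"]) auto
  qed
  have smooth: "(\<lambda>N. \<integral>\<omega>. gauss_smooth \<sigma> f (Y N \<omega>) \<partial>M) \<longlonglongrightarrow> (\<integral>x. gauss_smooth \<sigma> f x \<partial>\<nu>)" if "\<sigma> > 0" for \<sigma>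
    unfolding M.expectation_gauss_smooth[OF Y int that] V.expectation_gauss_smooth[OF id int that]
  proof (intro tendsto_mult_left integral_dominated_convergence[where w="\<lambda>a. \<bar>f a\<bar>"])
    have "\<bar>\<integral>\<omega>. gauss_bump \<sigma> a (Y N \<omega>) \<partial>M\<bar> \<le> 1" for N a
    proof -
      have "\<bar>\<integral>\<omega>. gauss_bump \<sigma> a (Y N \<omega>) \<partial>M\<bar> \<le> (\<integral>\<omega>. 1 \<partial>M)"
        by (rule abs_integral_le) (auto simp: gauss_bump_bounds intro!: M.integrable_const_bound[of _ 1])
      then show ?thesis by (simp add: M.prob_space)
    qed
    then show "AE a in lborel. norm (f a * (\<integral>\<omega>. gauss_bump \<sigma> a (Y N \<omega>) \<partial>M)) \<le> \<bar>f a\<bar>" for N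
      by (intro AE_I2) (simp add: abs_mult mult_left_le)
    show "AE a in lborel. (\<lambda>N. f a * (\<integral>\<omega>. gauss_bump \<sigma> a (Y N \<omega>) \<partial>M)) \<longlonglongrightarrow> f a * (\<integral>x. gauss_bump \<sigma> a x \<partial>\<nu>)"
      by (intro AE_I2 tendsto_mult_left tendsto_expectation_gauss_bump M Y \<nu> char)
    show "(\<lambda>a. f a * (\<integral>x. gauss_bump \<sigma> a x \<partial>\<nu>)) \<in> borel_measurable lborel"
      by (intro borel_measurable_times V.borel_measurable_lebesgue_integral) measurable
    show "(\<lambda>a. f a * (\<integral>\<omega>. gauss_bump \<sigma> a (Y N \<omega>) \<partial>M)) \<in> borel_measurable lborel" for N
      by (intro borel_measurable_times M.borel_measurable_lebesgue_integral) measurable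
    show "integrable lborel (\<lambda>a. \<bar>f a\<bar>)" using int by simp
  qed
  show ?thesis
  proof (rule LIMSEQ_I)
    fix r :: real assume "r > 0"
    then obtain \<sigma> where \<sigma>: "\<sigma> > 0" "\<And>x. \<bar>gauss_smooth \<sigma> f x - f x\<bar> \<le> r / 4"
      using gauss_smooth_uniform[OF uc B, of "r/4"] by (metis zero_less_divide_iff zero_less_numeral)
    have [measurable]: "gauss_smooth \<sigma> f \<in> borel_measurable borel"
    proof -
      interpret G: prob_space "std_normal_vec :: (real ^ 'n) measure" by (rule prob_space_std_normal_vec)
      show ?thesis
        unfolding gauss_smooth_def[abs_def] by (intro G.borel_measurable_lebesgue_integral) measurable
    qed
    have gb: "\<bar>gauss_smooth \<sigma> f x\<bar> \<le> B + r / 4" for x using \<sigma>(2)[of x] B[of x] by linarith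
    have close: "\<bar>(\<integral>\<omega>. gauss_smooth \<sigma> f (Z \<omega>) \<partial>P) - (\<integral>\<omega>. f (Z \<omega>) \<partial>P)\<bar> \<le> r / 4"
      if "prob_space P" and [measurable]: "Z \<in> borel_measurable P" for P and Z :: "'c \<Rightarrow> real ^ 'n"
    proof -
      interpret P: prob_space P by fact
      have i: "integrable P (\<lambda>\<omega>. gauss_smooth \<sigma> f (Z \<omega>))" "integrable P (\<lambda>\<omega>. f (Z \<omega>))"
        by (rule P.integrable_const_bound[of _ "B + r/4"], simp add: gb, measurable)
          (rule P.integrable_const_bound[of _ B], simp add: B, measurable)
      have "\<bar>\<integral>\<omega>. gauss_smooth \<sigma> f (Z \<omega>) - f (Z \<omega>) \<partial>P\<bar> \<le> (\<integral>\<omega>. r / 4 \<partial>P)"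
        using i \<sigma>(2) by (intro abs_integral_le) auto
      then show ?thesis using i by (simp add: P.prob_space)
    qed
    obtain N0 where N0: "\<And>N. N \<ge> N0 \<Longrightarrow> norm ((\<integral>\<omega>. gauss_smooth \<sigma> f (Y N \<omega>) \<partial>M) - (\<integral>x. gauss_smooth \<sigma> f x \<partial>\<nu>)) < r / 4"
      using LIMSEQ_D[OF smooth[OF \<sigma>(1)], of "r/4"] \<open>r > 0\<close> by auto
    have "norm ((\<integral>\<omega>. f (Y N \<omega>) \<partial>M) - (\<integral>x. f x \<partial>\<nu>)) < r" if "N \<ge> N0" for N
      using N0[OF that] unfolding real_norm_def
      by (rule abs_diff_less_via[OF close[OF M Y] close[OF \<nu>(1) id]])
    then show "\<exists>no. \<forall>n\<ge>no. norm ((\<integral>\<omega>. f (Y n \<omega>) \<partial>M) - (\<integral>x. f x \<partial>\<nu>)) < r" by blast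
  qed
qed

text \<open>Levy's continuity theorem with a given limit law. Tightness is automatic: a continuous cutoff that captures most of \<open>\<nu>\<close> has
  compact support, so in the limit it captures as much of the laws of \<open>Y N\<close>.\<close>
theorem converges_in_distribution_if_char:
  fixes Y :: "nat \<Rightarrow> 'a \<Rightarrow> real ^ 'n::finite" and \<nu> :: "(real ^ 'n) measure"
  assumes M: "prob_space M" and Y: "\<And>N. Y N \<in> borel_measurable M"
    and \<nu>: "prob_space \<nu>" "sets \<nu> = sets borel"
    and char: "\<And>v. (\<lambda>N. \<integral>\<omega>. iexp (v \<bullet> Y N \<omega>) \<partial>M) \<longlonglongrightarrow> (\<integral>x. iexp (v \<bullet> x) \<partial>\<nu>)"
  shows "converges_in_distribution M Y \<nu>"
  unfolding converges_in_distribution_def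
proof (intro allI impI)
  fix f :: "real ^ 'n \<Rightarrow> real" assume f: "continuous_on UNIV f" and bdd: "bounded (range f)"
  interpret M: prob_space M by fact
  interpret V: prob_space \<nu> by fact
  note [measurable] = Y and [measurable_cong] = \<nu>(2)
  have [measurable]: "f \<in> borel_measurable borel" by (rule borel_measurable_continuous_onI[OF f])
  obtain B where B: "B > 0" "\<And>x. \<bar>f x\<bar> \<le> B"
    using bdd unfolding bounded_pos by auto
  (* continuous cutoffs, equal to 1 on the ball of radius k *)
  define \<kappa> :: "nat \<Rightarrow> real ^ 'n \<Rightarrow> real" where "\<kappa> k x = max 0 (min 1 (real k + 1 - norm x))" for k x
  have \<kappa>c: "continuous_on UNIV (\<kappa> k)" for k unfolding \<kappa>_def by (intro continuous_intros)
  then have [measurable]: "\<kappa> k \<in> borel_measurable borel" for k by (rule borel_measurable_continuous_onI)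
  have \<kappa>b: "0 \<le> \<kappa> k x" "\<kappa> k x \<le> 1" for k x by (auto simp: \<kappa>_def)
  note cs = tendsto_expectation_compact_support[OF M Y \<nu> char]
  have c1: "(\<lambda>N. \<integral>\<omega>. \<kappa> k (Y N \<omega>) \<partial>M) \<longlonglongrightarrow> (\<integral>x. \<kappa> k x \<partial>\<nu>)" for k
    by (rule cs[OF \<kappa>c, of "real k + 1"]) (auto simp: \<kappa>_def)
  have c2: "(\<lambda>N. \<integral>\<omega>. f (Y N \<omega>) * \<kappa> k (Y N \<omega>) \<partial>M) \<longlonglongrightarrow> (\<integral>x. f x * \<kappa> k x \<partial>\<nu>)" for k
    by (rule cs[of "\<lambda>x. f x * \<kappa> k x" "real k + 1"]) (auto simp: \<kappa>_def intro!: continuous_intros f)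
  have "(\<lambda>k. \<integral>x. \<kappa> k x \<partial>\<nu>) \<longlonglongrightarrow> (\<integral>x. 1 \<partial>\<nu>)"
  proof (rule integral_dominated_convergence[where w="\<lambda>_. 1"])
    show "AE x in \<nu>. (\<lambda>k. \<kappa> k x) \<longlonglongrightarrow> 1"
    proof (intro AE_I2)
      fix x :: "real ^ 'n"
      obtain k0 where "norm x < real k0" using reals_Archimedean2 by blast
      then have "\<forall>\<^sub>F k in sequentially. \<kappa> k x = 1"
        by (intro eventually_sequentiallyI[of k0]) (auto simp: \<kappa>_def)
      then show "(\<lambda>k. \<kappa> k x) \<longlonglongrightarrow> 1" by (rule tendsto_eventually)
    qed
  qed (use \<kappa>b in auto)
  then have \<kappa>1: "(\<lambda>k. \<integral>x. \<kappa> k x \<partial>\<nu>) \<longlonglongrightarrow> 1" by (simp add: V.prob_space)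
  have trunc: "\<bar>(\<integral>\<omega>. f (Z \<omega>) \<partial>P) - (\<integral>\<omega>. f (Z \<omega>) * \<kappa> k (Z \<omega>) \<partial>P)\<bar> \<le> B * (1 - (\<integral>\<omega>. \<kappa> k (Z \<omega>) \<partial>P))"
    if "prob_space P" and [measurable]: "Z \<in> borel_measurable P" for P k and Z :: "'c \<Rightarrow> real ^ 'n"
  proof -
    interpret P: prob_space P by fact
    have i1: "integrable P (\<lambda>\<omega>. f (Z \<omega>))"
      by (rule P.integrable_const_bound[of _ B]) (auto simp: B)
    have i2: "integrable P (\<lambda>\<omega>. \<kappa> k (Z \<omega>))"
      by (rule P.integrable_const_bound[of _ 1]) (auto simp: \<kappa>b)
    have i3: "integrable P (\<lambda>\<omega>. f (Z \<omega>) * \<kappa> k (Z \<omega>))"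
      by (rule P.integrable_const_bound[of _ B])
        (auto simp: B abs_mult \<kappa>b intro!: AE_I2 order_trans[OF mult_left_le B(2)])
    have "\<bar>\<integral>\<omega>. f (Z \<omega>) - f (Z \<omega>) * \<kappa> k (Z \<omega>) \<partial>P\<bar> \<le> (\<integral>\<omega>. B * (1 - \<kappa> k (Z \<omega>)) \<partial>P)"
    proof (rule abs_integral_le, goal_cases)
      case (3 \<omega>)
      have "\<bar>f (Z \<omega>) - f (Z \<omega>) * \<kappa> k (Z \<omega>)\<bar> = \<bar>f (Z \<omega>)\<bar> * (1 - \<kappa> k (Z \<omega>))"
      proof -
        have "f (Z \<omega>) - f (Z \<omega>) * \<kappa> k (Z \<omega>) = f (Z \<omega>) * (1 - \<kappa> k (Z \<omega>))"
          by (simp add: right_diff_distrib)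
        then show ?thesis using \<kappa>b[of k "Z \<omega>"] by (simp only: abs_mult abs_of_nonneg diff_ge_0_iff_ge)
      qed
      then show ?case
        using \<kappa>b B by (simp add: mult_right_mono)
    qed (use i1 i2 i3 in auto)
    then show ?thesis using i1 i2 i3 by (simp add: P.prob_space)
  qed
  show "(\<lambda>N. \<integral>\<omega>. f (Y N \<omega>) \<partial>M) \<longlonglongrightarrow> (\<integral>x. f x \<partial>\<nu>)"
  proof (rule LIMSEQ_I)
    fix r :: real assume "r > 0"
    then have "\<forall>\<^sub>F k in sequentially. 1 - r / (4 * B) < (\<integral>x. \<kappa> k x \<partial>\<nu>)"
      using B by (intro order_tendstoD[OF \<kappa>1]) auto
    then obtain k where k: "1 - r / (4 * B) < (\<integral>x. \<kappa> k x \<partial>\<nu>)"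
      by (auto simp: eventually_sequentially)
    have "\<forall>\<^sub>F N in sequentially. 1 - r / (4 * B) < (\<integral>\<omega>. \<kappa> k (Y N \<omega>) \<partial>M)"
      using order_tendstoD(1)[OF c1 k] .
    moreover have "\<forall>\<^sub>F N in sequentially. dist (\<integral>\<omega>. f (Y N \<omega>) * \<kappa> k (Y N \<omega>) \<partial>M) (\<integral>x. f x * \<kappa> k x \<partial>\<nu>) < r / 4"
      using tendstoD[OF c2[of k], of "r/4"] \<open>r > 0\<close> by simp
    ultimately have "\<forall>\<^sub>F N in sequentially. norm ((\<integral>\<omega>. f (Y N \<omega>) \<partial>M) - (\<integral>x. f x \<partial>\<nu>)) < r"
    proof eventually_elim
      case (elim N)
      have small: "B * (1 - t) \<le> r / 4" if "1 - r / (4 * B) < t" for t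
        using that B(1) by (simp add: field_simps)
      have id: "(\<lambda>x. x) \<in> borel_measurable \<nu>" by measurable
      have 1: "\<bar>(\<integral>\<omega>. f (Y N \<omega>) * \<kappa> k (Y N \<omega>) \<partial>M) - (\<integral>\<omega>. f (Y N \<omega>) \<partial>M)\<bar> \<le> r / 4"
        using order_trans[OF trunc[OF M Y, of N k] small[OF elim(1)]] by (subst abs_minus_commute)
      have 2: "\<bar>(\<integral>x. f x * \<kappa> k x \<partial>\<nu>) - (\<integral>x. f x \<partial>\<nu>)\<bar> \<le> r / 4"
        using order_trans[OF trunc[OF \<nu>(1) id, of k] small[OF k]] by (subst abs_minus_commute)
      show ?case
        using elim(2) unfolding real_norm_def dist_real_def by (rule abs_diff_less_via[OF 1 2])
    qed
    then show "\<exists>no. \<forall>n\<ge>no. norm ((\<integral>\<omega>. f (Y n \<omega>) \<partial>M) - (\<integral>x. f x \<partial>\<nu>)) < r"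
      by (simp add: eventually_sequentially)
  qed
qed

section \<open>Stationary fields and covariances with a distant past\<close>

locale stationary_field = prob_space M
  for M :: "'a measure" +
  fixes X :: "int ^ 'm::{finite,linorder} \<Rightarrow> 'a \<Rightarrow> real ^ 'n::finite"
  assumes X_measurable [measurable]: "X t \<in> borel_measurable M"
    and stationary: "strictly_stationary M X"
begin

lemma path_measurable [measurable]: "(\<lambda>\<omega> t. X (t + h) \<omega>) \<in> measurable M (Pi\<^sub>M UNIV (\<lambda>_. borel))"
  by (rule measurable_abs_UNIV) measurable

lemma path0_measurable [measurable]: "(\<lambda>\<omega> t. X t \<omega>) \<in> measurable M (Pi\<^sub>M UNIV (\<lambda>_. borel))"
  by (rule measurable_abs_UNIV) measurable

text \<open>Stationarity of the finite-dimensional laws carries over to the law on the path space, since cylinders generate its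
  sigma-algebra.\<close>
lemma law_shift:
  "distr M (Pi\<^sub>M UNIV (\<lambda>_. borel)) (\<lambda>\<omega> t. X (t + h) \<omega>) = distr M (Pi\<^sub>M UNIV (\<lambda>_. borel)) (\<lambda>\<omega> t. X t \<omega>)"
proof (rule measure_eqI_PiM_infinite)
  fix A :: "(int, 'm) vec \<Rightarrow> (real ^ 'n) set" and J
  assume J: "finite J" and A: "\<And>i. i \<in> J \<Longrightarrow> A i \<in> sets borel"
  have cyl: "emeasure (distr M (Pi\<^sub>M UNIV (\<lambda>_. borel)) (\<lambda>\<omega> t. X (t + h) \<omega>)) (prod_emb UNIV (\<lambda>_. borel) J (Pi\<^sub>E J A))
    = emeasure (distr M (Pi\<^sub>M J (\<lambda>_. borel)) (\<lambda>\<omega>. \<lambda>t\<in>J. X (t + h) \<omega>)) (Pi\<^sub>E J A)" for h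
  proof -
    have S: "prod_emb UNIV (\<lambda>_. borel) J (Pi\<^sub>E J A) \<in> sets (Pi\<^sub>M UNIV (\<lambda>_. borel :: (real ^ 'n) measure))"
      using J A by (intro sets_PiM_I) auto
    have T: "Pi\<^sub>E J A \<in> sets (Pi\<^sub>M J (\<lambda>_. borel :: (real ^ 'n) measure))"
      using J A by (intro sets_PiM_I_finite) auto
    show ?thesis
    proof -
      have m: "(\<lambda>\<omega>. \<lambda>t\<in>J. X (t + h) \<omega>) \<in> measurable M (Pi\<^sub>M J (\<lambda>_. borel))"
        by measurable
      show ?thesis
        unfolding emeasure_distr[OF path_measurable S] emeasure_distr[OF m T]
        by (intro arg_cong[where f="emeasure M"]) (auto simp: prod_emb_def PiE_def restrict_def)
    qed
  qed
  show "emeasure (distr M (Pi\<^sub>M UNIV (\<lambda>_. borel)) (\<lambda>\<omega> t. X (t + h) \<omega>)) (prod_emb UNIV (\<lambda>_. borel) J (Pi\<^sub>E J A))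
    = emeasure (distr M (Pi\<^sub>M UNIV (\<lambda>_. borel)) (\<lambda>\<omega> t. X t \<omega>)) (prod_emb UNIV (\<lambda>_. borel) J (Pi\<^sub>E J A))"
    using cyl[of h] cyl[of 0] stationary J unfolding strictly_stationary_def by simp
qed (auto intro!: finite_measure_distr)

lemma
  fixes f :: "((int, 'm) vec \<Rightarrow> real ^ 'n) \<Rightarrow> 'b::{banach,second_countable_topology}"
  assumes f: "f \<in> borel_measurable (Pi\<^sub>M UNIV (\<lambda>_. borel))"
  shows integral_shift: "(\<integral>\<omega>. f (\<lambda>t. X (t + h) \<omega>) \<partial>M) = (\<integral>\<omega>. f (\<lambda>t. X t \<omega>) \<partial>M)"
    and integrable_shift: "integrable M (\<lambda>\<omega>. f (\<lambda>t. X (t + h) \<omega>)) \<longleftrightarrow> integrable M (\<lambda>\<omega>. f (\<lambda>t. X t \<omega>))"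
proof -
  have "(\<integral>\<omega>. f (\<lambda>t. X (t + h) \<omega>) \<partial>M) = (\<integral>x. f x \<partial>distr M (Pi\<^sub>M UNIV (\<lambda>_. borel)) (\<lambda>\<omega> t. X (t + h) \<omega>))"
    by (rule integral_distr[OF path_measurable f, symmetric])
  also have "\<dots> = (\<integral>\<omega>. f (\<lambda>t. X t \<omega>) \<partial>M)"
    unfolding law_shift by (rule integral_distr[OF path0_measurable f])
  finally show "(\<integral>\<omega>. f (\<lambda>t. X (t + h) \<omega>) \<partial>M) = (\<integral>\<omega>. f (\<lambda>t. X t \<omega>) \<partial>M)" .
  have "integrable M (\<lambda>\<omega>. f (\<lambda>t. X (t + h) \<omega>)) \<longleftrightarrow> integrable (distr M (Pi\<^sub>M UNIV (\<lambda>_. borel)) (\<lambda>\<omega> t. X (t + h) \<omega>)) f"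
    by (rule integrable_distr_eq[OF path_measurable f, symmetric])
  also have "\<dots> \<longleftrightarrow> integrable M (\<lambda>\<omega>. f (\<lambda>t. X t \<omega>))"
    unfolding law_shift by (rule integrable_distr_eq[OF path0_measurable f])
  finally show "integrable M (\<lambda>\<omega>. f (\<lambda>t. X (t + h) \<omega>)) \<longleftrightarrow> integrable M (\<lambda>\<omega>. f (\<lambda>t. X t \<omega>))" .
qed

lemma integral_pair_shift:
  fixes f :: "real ^ 'n \<Rightarrow> real ^ 'n \<Rightarrow> real"
  assumes [measurable]: "(\<lambda>(x, y). f x y) \<in> borel_measurable (borel \<Otimes>\<^sub>M borel)"
  shows "(\<integral>\<omega>. f (X (s + h) \<omega>) (X (t + h) \<omega>) \<partial>M) = (\<integral>\<omega>. f (X s \<omega>) (X t \<omega>) \<partial>M)"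
  by (rule integral_shift[of "\<lambda>x. f (x s) (x t)"]) measurable

text \<open>The definition of the coefficients for functions indexed by the set \<open>\<Gamma>\<close> itself instead of an enumeration. The pairs with
  vanishing denominator, which are left out of the supremum, have covariance zero.\<close>
lemma covariance_le_theta:
  assumes \<theta>: "theta M X h \<le> ennreal c" and c: "c \<ge> 0"
    and \<Gamma>: "finite \<Gamma>" "\<Gamma> \<noteq> {}" "\<Gamma> \<subseteq> V_lex_dist j h"
    and f [measurable]: "f \<in> borel_measurable (Pi\<^sub>M \<Gamma> (\<lambda>_. borel))" and B: "\<And>x. \<bar>f x\<bar> \<le> B"
    and G: "L-lipschitz_on UNIV G" "bounded (range G)"
  shows "\<bar>covariance M (\<lambda>\<omega>. f (\<lambda>t\<in>\<Gamma>. X t \<omega>)) (\<lambda>\<omega>. G (X j \<omega>))\<bar> \<le> c * B * L"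
proof -
  define u where "u = card \<Gamma>"
  have u: "u \<ge> 1" using \<Gamma> by (simp add: u_def Suc_le_eq card_gt_0_iff)
  obtain i where i: "bij_betw i {1..u} \<Gamma>"
    unfolding u_def using ex_bij_betw_nat_finite_1[OF \<Gamma>(1)] by blast
  define F where "F x = f (\<lambda>t\<in>\<Gamma>. x (inv_into {1..u} i t))" for x
  have inv: "inv_into {1..u} i t \<in> {1..u}" "i (inv_into {1..u} i t) = t" if "t \<in> \<Gamma>" for t
    using i that by (auto simp: bij_betw_def inv_into_into f_inv_into_f) 
  have Fm: "F \<in> borel_measurable (Pi\<^sub>M {1..u} (\<lambda>_. borel))"
    unfolding F_def using inv by (intro measurable_compose[OF _ f] measurable_restrict measurable_component_singleton) auto
  have FB: "\<bar>F x\<bar> \<le> B" for x by (simp add: F_def B)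
  have Fb: "F \<in> bounded_borel u"
    using Fm FB by (auto simp: bounded_borel_def bounded_iff)
  have FX: "F (\<lambda>k\<in>{1..u}. X (i k) \<omega>) = f (\<lambda>t\<in>\<Gamma>. X t \<omega>)" for \<omega>
    unfolding F_def using inv by (intro arg_cong[where f=f] restrict_ext) simp
  have ne: "({1..u} \<rightarrow>\<^sub>E (UNIV :: (real ^ 'n) set)) \<noteq> {}" by (simp add: PiE_eq_empty_iff)
  have bdd: "bdd_above ((\<lambda>x. \<bar>F x\<bar>) ` ({1..u} \<rightarrow>\<^sub>E UNIV))" by (rule bdd_aboveI2[of _ _ B]) (rule FB)
  have s1: "sup_abs u F \<le> B" unfolding sup_abs_def by (rule cSUP_least[OF ne FB])
  have s2: "\<bar>F x\<bar> \<le> sup_abs u F" if "x \<in> {1..u} \<rightarrow>\<^sub>E UNIV" for x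
    unfolding sup_abs_def by (rule cSUP_upper[OF that bdd])
  have s0: "0 \<le> sup_abs u F" using s2 ne by (meson abs_ge_zero equals0I order_trans)
  have L0: "L \<ge> 0" using G(1) by (rule lipschitz_on_nonneg)
  let ?Q = "{\<bar>G x - G y\<bar> / norm (x - y) | x y. x \<noteq> y}"
  have Qle: "q \<le> L" if "q \<in> ?Q" for q
    using that lipschitz_onD[OF G(1)] by (auto simp: dist_norm divide_le_eq)
  have Qbdd: "bdd_above ?Q" using Qle by (rule bdd_aboveI)
  have "(0 :: real ^ 'n) \<noteq> 1" by simp
  then have Qne: "?Q \<noteq> {}" by blast
  have l1: "Lip G \<le> L" unfolding Lip_def by (rule cSup_least[OF Qne Qle])
  have l2: "\<bar>G x - G y\<bar> / norm (x - y) \<le> Lip G" if "x \<noteq> y" for x y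
    unfolding Lip_def by (rule cSup_upper[OF _ Qbdd]) (use that in blast)
  have l0: "0 \<le> Lip G" using l2[OF \<open>(0 :: real ^ 'n) \<noteq> 1\<close>] by (rule order_trans[rotated]) simp
  show ?thesis
  proof (cases "sup_abs u F * Lip G = 0")
    case False
    let ?cov = "covariance M (\<lambda>\<omega>. F (\<lambda>k\<in>{1..u}. X (i k) \<omega>)) (\<lambda>\<omega>. G (X j \<omega>))"
    have "ennreal (\<bar>?cov\<bar> / (sup_abs u F * Lip G)) \<le> theta_u M X u h"
      unfolding theta_u_def
      by (rule Sup_upper) (use False Fb G i \<Gamma> in \<open>auto simp: bounded_lipschitz_def bij_betw_def intro!: exI[of _ F] exI[of _ G] exI[of _ j] exI[of _ i]\<close>)
    also have "\<dots> \<le> theta M X h"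
      unfolding theta_def using u by (intro SUP_upper) auto
    finally have "ennreal (\<bar>?cov\<bar> / (sup_abs u F * Lip G)) \<le> ennreal c" using \<theta> by (rule order_trans)
    then have "\<bar>?cov\<bar> / (sup_abs u F * Lip G) \<le> c" using c by (simp add: ennreal_le_iff)
    then have "\<bar>?cov\<bar> \<le> c * (sup_abs u F * Lip G)"
      using False s0 l0 by (simp add: divide_le_eq mult_nonneg_nonneg order_less_le split: if_splits)
    also have "\<dots> \<le> c * (B * L)"
      using c s0 l0 s1 l1 by (intro mult_left_mono mult_mono) auto
    finally show ?thesis unfolding FX by (simp only: mult.assoc)
  next
    case True
    have "covariance M (\<lambda>\<omega>. f (\<lambda>t\<in>\<Gamma>. X t \<omega>)) (\<lambda>\<omega>. G (X j \<omega>)) = 0"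
    proof (cases "sup_abs u F = 0")
      case True
      then have "f (\<lambda>t\<in>\<Gamma>. X t \<omega>) = 0" for \<omega>
        using s2[of "\<lambda>k\<in>{1..u}. X (i k) \<omega>"] unfolding FX by simp
      then show ?thesis by (simp add: covariance_def)
    next
      case False
      then have "Lip G = 0" using True by simp
      then have "G x = G 0" for x using l2[of x 0] by (cases "x = 0") (auto simp: divide_le_eq)
      then have "(\<lambda>\<omega>. G (X j \<omega>)) = (\<lambda>\<omega>. G 0)" by auto
      then show ?thesis by (simp add: covariance_def prob_space)
    qed
    moreover have "0 \<le> c * B * L" using c L0 FB[of undefined] by (intro mult_nonneg_nonneg) auto
    ultimately show ?thesis by simp
  qed
qed

lemma covariance_eq:
  assumes "integrable M U" "integrable M V" "integrable M (\<lambda>\<omega>. U \<omega> * V \<omega>)"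
  shows "covariance M U V = expectation (\<lambda>\<omega>. U \<omega> * V \<omega>) - expectation U * expectation V"
  using assms unfolding covariance_def
  by (simp add: left_diff_distrib right_diff_distrib prob_space)

end

locale theta_field = stationary_field M X
  for M :: "'a measure" and X :: "int ^ 'm::{finite,linorder} \<Rightarrow> 'a \<Rightarrow> real ^ 'n::finite" +
  fixes \<delta> \<alpha> :: real
  assumes centered: "expectation (X t) = 0"
    and \<delta>_pos: "\<delta> > 0"
    and moment: "integrable M (\<lambda>\<omega>. norm (X t \<omega>) powr (2 + \<delta>))"
    and \<alpha>_large: "\<alpha> > real CARD('m) * (1 + 1 / \<delta>)"
    and theta_decay: "\<exists>C. \<forall>\<^sub>F h in sequentially. theta M X h \<le> ennreal (C * real h powr - \<alpha>)"
begin

text \<open>The decay rate of covariances that survives the truncation to bounded functions.\<close>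
definition \<beta> :: real where "\<beta> = \<alpha> * \<delta> / (1 + \<delta>)"

lemma \<beta>_large: "\<beta> > real CARD('m)"
  using \<alpha>_large \<delta>_pos by (simp add: \<beta>_def field_simps)

lemma square_le_moment: "z\<^sup>2 \<le> 1 + z powr (2 + \<delta>)" if "z \<ge> 0" for z :: real
proof (cases "z \<le> 1")
  case True
  then have "z\<^sup>2 \<le> 1" using that by (simp add: power_le_one)
  then show ?thesis using powr_ge_zero[of z "2 + \<delta>"] by linarith
next
  case False
  then have "z powr 2 \<le> z powr (2 + \<delta>)" using \<delta>_pos by (intro powr_mono) auto
  then show ?thesis using False by simp
qed

lemma square_integrable: "integrable M (\<lambda>\<omega>. (norm (X t \<omega>))\<^sup>2)"
proof (rule Bochner_Integration.integrable_bound)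
  show "integrable M (\<lambda>\<omega>. 1 + norm (X t \<omega>) powr (2 + \<delta>))" using moment by simp
  show "AE \<omega> in M. norm ((norm (X t \<omega>))\<^sup>2) \<le> norm (1 + norm (X t \<omega>) powr (2 + \<delta>))"
    using square_le_moment by (intro AE_I2) simp
qed measurable

lemma X_integrable: "integrable M (X t)"
proof (rule Bochner_Integration.integrable_bound)
  show "integrable M (\<lambda>\<omega>. 1 + (norm (X t \<omega>))\<^sup>2)" using square_integrable by simp
  show "AE \<omega> in M. norm (X t \<omega>) \<le> norm (1 + (norm (X t \<omega>))\<^sup>2)"
  proof (intro AE_I2)
    fix \<omega>
    show "norm (X t \<omega>) \<le> norm (1 + (norm (X t \<omega>))\<^sup>2)"
      using zero_le_power2[of "norm (X t \<omega>) - 1"] norm_ge_zero[of "X t \<omega>"]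
      by (simp add: power2_diff) (smt (verit) zero_le_power2)
  qed
qed measurable

lemma product_integrable: "integrable M (\<lambda>\<omega>. norm (X s \<omega>) * norm (X t \<omega>))"
proof (rule Bochner_Integration.integrable_bound)
  show "integrable M (\<lambda>\<omega>. (norm (X s \<omega>))\<^sup>2 + (norm (X t \<omega>))\<^sup>2)" using square_integrable by simp
  show "AE \<omega> in M. norm (norm (X s \<omega>) * norm (X t \<omega>)) \<le> norm ((norm (X s \<omega>))\<^sup>2 + (norm (X t \<omega>))\<^sup>2)"
  proof (intro AE_I2)
    fix \<omega>
    show "norm (norm (X s \<omega>) * norm (X t \<omega>)) \<le> norm ((norm (X s \<omega>))\<^sup>2 + (norm (X t \<omega>))\<^sup>2)"
      using sum_squares_bound[of "norm (X s \<omega>)" "norm (X t \<omega>)"]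
        mult_nonneg_nonneg[OF norm_ge_zero[of "X s \<omega>"] norm_ge_zero[of "X t \<omega>"]]
      unfolding real_norm_def by linarith
  qed
qed measurable

lemma moment_eq: "expectation (\<lambda>\<omega>. norm (X t \<omega>) powr (2 + \<delta>)) = expectation (\<lambda>\<omega>. norm (X 0 \<omega>) powr (2 + \<delta>))"
  using integral_shift[of "\<lambda>x. norm (x 0) powr (2 + \<delta>)" t] by simp

lemma second_moment_eq: "expectation (\<lambda>\<omega>. (norm (X t \<omega>))\<^sup>2) = expectation (\<lambda>\<omega>. (norm (X 0 \<omega>))\<^sup>2)"
  using integral_shift[of "\<lambda>x. (norm (x 0))\<^sup>2" t] by simp

lemma inner_integrable: "integrable M (\<lambda>\<omega>. v \<bullet> X t \<omega>)"
  by (intro integrable_inner_right X_integrable) 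

lemma inner_centered: "expectation (\<lambda>\<omega>. v \<bullet> X t \<omega>) = 0"
  using centered X_integrable by (simp add: integral_inner_right)

text \<open>Markov-type bounds: above the level \<open>A\<close> one may trade powers of \<open>z\<close> for negative powers of \<open>A\<close>.\<close>
lemma tail_moment_bounds:
  assumes "A > 0" "z \<ge> 0"
  shows "z > A \<Longrightarrow> z\<^sup>2 \<le> A powr - \<delta> * z powr (2 + \<delta>)"
    and "z > A \<Longrightarrow> A * z \<le> A powr - \<delta> * z powr (2 + \<delta>)"
proof -
  assume zA: "z > A"
  have "1 \<le> (z / A) powr \<delta>" using assms zA \<delta>_pos by (intro ge_one_powr_ge_zero) auto
  then have "z\<^sup>2 * 1 \<le> z\<^sup>2 * (z / A) powr \<delta>" by (intro mult_left_mono) auto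
  also have "\<dots> = A powr - \<delta> * z powr (2 + \<delta>)"
    using assms zA by (simp add: powr_divide powr_add powr_minus field_simps powr_numeral)
  finally show 1: "z\<^sup>2 \<le> A powr - \<delta> * z powr (2 + \<delta>)" by simp
  have "A * z \<le> z\<^sup>2" using assms zA by (simp add: power2_eq_square)
  then show "A * z \<le> A powr - \<delta> * z powr (2 + \<delta>)" using 1 by linarith
qed

text \<open>The theta coefficients apply after truncating \<open>f\<close> and \<open>v \<bullet> X j\<close> at the level \<open>A\<close>, which costs a factor \<open>A\<close>; the parts cut
  off contribute at most a multiple of \<open>A powr - \<delta>\<close> by the moment condition. The choice of \<open>A\<close> makes both contributions
  of the order \<open>h powr - \<beta>\<close>. For the finitely many \<open>h\<close> that the assumed decay does not cover, the Cauchy-Schwarz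
  bound is absorbed into the constant.\<close>
lemma far_covariance_bound:
  obtains K where "K \<ge> 0" and
    "\<And>h j \<Gamma> p f c. \<lbrakk>h \<ge> 1; finite \<Gamma>; \<Gamma> \<subseteq> V_lex_dist j h; p \<in> \<Gamma>; f \<in> borel_measurable (Pi\<^sub>M \<Gamma> (\<lambda>_. borel));
       c \<ge> 0; \<And>x. \<bar>f x\<bar> \<le> c * norm (x p)\<rbrakk>
     \<Longrightarrow> \<bar>expectation (\<lambda>\<omega>. f (\<lambda>t\<in>\<Gamma>. X t \<omega>) * (v \<bullet> X j \<omega>))\<bar> \<le> K * c * real h powr - \<beta>"
proof -
  obtain C0 where "\<forall>\<^sub>F h in sequentially. theta M X h \<le> ennreal (C0 * real h powr - \<alpha>)"
    using theta_decay by blast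
  then obtain H0 where H0: "\<And>h. h \<ge> H0 \<Longrightarrow> theta M X h \<le> ennreal (C0 * real h powr - \<alpha>)"
    by (auto simp: eventually_sequentially)
  define C where "C = max C0 0"
  have C: "C \<ge> 0" "\<And>h. h \<ge> H0 \<Longrightarrow> theta M X h \<le> ennreal (C * real h powr - \<alpha>)"
    by (auto simp: C_def intro!: order_trans[OF H0] ennreal_leI mult_right_mono)
  define H where "H = max H0 1"
  define w where "w = 1 + norm v"
  have w: "w \<ge> 1" "norm v \<le> w" by (auto simp: w_def)
  define Z where "Z t \<omega> = w * norm (X t \<omega>)" for t \<omega>
  have Z0: "Z t \<omega> \<ge> 0" for t \<omega> using w by (simp add: Z_def)
  have XZ: "norm (X t \<omega>) \<le> Z t \<omega>" for t \<omega>
    using w mult_right_mono[OF w(1) norm_ge_zero[of "X t \<omega>"]] by (simp add: Z_def)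
  have vZ: "\<bar>v \<bullet> X t \<omega>\<bar> \<le> Z t \<omega>" for t \<omega>
    using order_trans[OF Cauchy_Schwarz_ineq2 mult_right_mono[OF w(2) norm_ge_zero]] by (simp add: Z_def)
  define Q where "Q t \<omega> = Z t \<omega> powr (2 + \<delta>)" for t \<omega>
  have Q_eq: "Q t \<omega> = w powr (2 + \<delta>) * norm (X t \<omega>) powr (2 + \<delta>)" for t \<omega>
    using w by (simp add: Q_def Z_def powr_mult)
  have Qi [simp]: "integrable M (Q t)" for t
    unfolding Q_eq[abs_def] using moment by simp
  define K0 where "K0 = expectation (Q 0)"
  have QK: "expectation (Q t) = K0" for t
    unfolding K0_def Q_eq[abs_def] by (simp add: moment_eq[of t])
  have Q0: "Q t \<omega> \<ge> 0" for t \<omega> by (simp add: Q_def)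
  have K0: "K0 \<ge> 0" unfolding K0_def by (intro integral_nonneg_AE AE_I2) (simp add: Q0)
  define S where "S = expectation (\<lambda>\<omega>. (norm (X 0 \<omega>))\<^sup>2)"
  have S0: "S \<ge> 0" by (simp add: S_def)
  define K where "K = (4 * K0 + C * norm v) + norm v * (2 * S) * real H powr \<beta>"
  have \<beta>0: "\<beta> > 0" using \<beta>_large by (rule le_less_trans[rotated]) simp
  show ?thesis
  proof (rule that)
    show "K \<ge> 0" using K0 C S0 by (simp add: K_def)
    fix h :: nat and j :: "(int, 'm) vec" and \<Gamma> p and f :: "((int, 'm) vec \<Rightarrow> (real, 'n) vec) \<Rightarrow> real" and c :: real
    assume h: "h \<ge> 1" and \<Gamma>: "finite \<Gamma>" "\<Gamma> \<subseteq> V_lex_dist j h" "p \<in> \<Gamma>"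
      and f [measurable]: "f \<in> borel_measurable (Pi\<^sub>M \<Gamma> (\<lambda>_. borel))"
      and c: "c \<ge> 0" and fc: "\<And>x. \<bar>f x\<bar> \<le> c * norm (x p)"
    define U where "U \<omega> = f (\<lambda>t\<in>\<Gamma>. X t \<omega>)" for \<omega>
    define Y where "Y \<omega> = v \<bullet> X j \<omega>" for \<omega>
    have [measurable]: "U \<in> borel_measurable M" "Y \<in> borel_measurable M"
      unfolding U_def Y_def by measurable
    have UX: "\<bar>U \<omega>\<bar> \<le> c * norm (X p \<omega>)" for \<omega>
      using fc[of "\<lambda>t\<in>\<Gamma>. X t \<omega>"] \<Gamma> by (simp add: U_def)
    have UZ: "\<bar>U \<omega>\<bar> \<le> c * Z p \<omega>" for \<omega>
      using UX[of \<omega>] mult_left_mono[OF XZ c, of p \<omega>] by linarith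
    have YZ: "\<bar>Y \<omega>\<bar> \<le> Z j \<omega>" for \<omega> using vZ by (simp add: Y_def)
    have UYn: "\<bar>U \<omega> * Y \<omega>\<bar> \<le> c * norm v * (norm (X p \<omega>) * norm (X j \<omega>))" for \<omega>
    proof -
      have "\<bar>U \<omega> * Y \<omega>\<bar> \<le> (c * norm (X p \<omega>)) * (norm v * norm (X j \<omega>))"
        unfolding abs_mult Y_def using c by (intro mult_mono UX Cauchy_Schwarz_ineq2) auto
      then show ?thesis by (simp add: mult_ac)
    qed
    have UYi: "integrable M (\<lambda>\<omega>. U \<omega> * Y \<omega>)"
    proof (rule Bochner_Integration.integrable_bound)
      show "integrable M (\<lambda>\<omega>. c * norm v * (norm (X p \<omega>) * norm (X j \<omega>)))"
        using product_integrable by simp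
      show "AE \<omega> in M. norm (U \<omega> * Y \<omega>) \<le> norm (c * norm v * (norm (X p \<omega>) * norm (X j \<omega>)))"
        using order_trans[OF UYn abs_ge_self] by (intro AE_I2) simp
    qed measurable
    show "\<bar>expectation (\<lambda>\<omega>. f (\<lambda>t\<in>\<Gamma>. X t \<omega>) * (v \<bullet> X j \<omega>))\<bar> \<le> K * c * real h powr - \<beta>"
    proof (cases "h \<ge> H")
      case False
      have "\<bar>expectation (\<lambda>\<omega>. U \<omega> * Y \<omega>)\<bar> \<le> expectation (\<lambda>\<omega>. c * norm v * ((norm (X p \<omega>))\<^sup>2 + (norm (X j \<omega>))\<^sup>2))"
      proof (rule abs_integral_le[OF UYi])
        show "integrable M (\<lambda>\<omega>. c * norm v * ((norm (X p \<omega>))\<^sup>2 + (norm (X j \<omega>))\<^sup>2))"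
          using square_integrable by simp
        fix \<omega>
        have "norm (X p \<omega>) * norm (X j \<omega>) \<le> (norm (X p \<omega>))\<^sup>2 + (norm (X j \<omega>))\<^sup>2"
          using sum_squares_bound[of "norm (X p \<omega>)" "norm (X j \<omega>)"]
            mult_nonneg_nonneg[OF norm_ge_zero[of "X p \<omega>"] norm_ge_zero[of "X j \<omega>"]] by linarith
        then have "c * norm v * (norm (X p \<omega>) * norm (X j \<omega>)) \<le> c * norm v * ((norm (X p \<omega>))\<^sup>2 + (norm (X j \<omega>))\<^sup>2)"
          using c by (intro mult_left_mono) auto
        then show "\<bar>U \<omega> * Y \<omega>\<bar> \<le> c * norm v * ((norm (X p \<omega>))\<^sup>2 + (norm (X j \<omega>))\<^sup>2)"
          using UYn[of \<omega>] by linarith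
      qed
      also have "\<dots> = c * (norm v * (2 * S))"
        using square_integrable second_moment_eq[of p] second_moment_eq[of j] by (simp add: S_def)
      also have "\<dots> \<le> c * (norm v * (2 * S) * (real H powr \<beta> * real h powr - \<beta>))"
      proof -
        have "real h powr \<beta> \<le> real H powr \<beta>" using False \<beta>0 by (intro powr_mono2) auto
        then have "1 \<le> real H powr \<beta> * real h powr - \<beta>"
          using h by (simp add: powr_minus field_simps)
        then have "norm v * (2 * S) * 1 \<le> norm v * (2 * S) * (real H powr \<beta> * real h powr - \<beta>)"
          using S0 by (intro mult_left_mono) auto
        then show ?thesis using c by (intro mult_left_mono) auto
      qed
      also have "\<dots> = (norm v * (2 * S) * real H powr \<beta>) * (c * real h powr - \<beta>)" by (simp add: mult_ac)
      also have "\<dots> \<le> K * (c * real h powr - \<beta>)"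
        using c K0 C by (intro mult_right_mono) (auto simp: K_def)
      finally show ?thesis by (simp add: U_def Y_def mult.assoc)
    next
      case True
      (* This level solves A powr - delta = h powr - alpha * A. *)
      define A where "A = real h powr (\<alpha> / (1 + \<delta>))"
      have A: "A > 0" using h by (simp add: A_def)
      have A1: "A powr - \<delta> = real h powr - \<beta>"
        by (simp add: A_def powr_powr \<beta>_def)
      have A2: "real h powr - \<alpha> * A = real h powr - \<beta>"
      proof -
        have "\<alpha> / (1 + \<delta>) - \<alpha> = - \<beta>" using \<delta>_pos by (simp add: \<beta>_def field_simps)
        then show ?thesis by (simp add: A_def powr_add[symmetric] add.commute)
      qed
      define G where "G x = max (- A) (min A (v \<bullet> x))" for x :: "(real, 'n) vec"
      have GA: "\<bar>G x\<bar> \<le> A" for x using A by (auto simp: G_def)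
      have GL: "(norm v)-lipschitz_on UNIV G"
      proof (rule lipschitz_onI)
        fix x y
        have "dist (G x) (G y) \<le> \<bar>v \<bullet> x - v \<bullet> y\<bar>" by (auto simp: G_def dist_real_def)
        also have "\<dots> \<le> norm v * dist x y"
          unfolding inner_diff_right[symmetric] dist_norm by (rule Cauchy_Schwarz_ineq2)
        finally show "dist (G x) (G y) \<le> norm v * dist x y" .
      qed simp
      have Gb: "bounded (range G)" using GA by (auto simp: bounded_iff)
      have [measurable]: "G \<in> borel_measurable borel" unfolding G_def by measurable
      define f1 where "f1 x = (if w * norm (x p) \<le> A then f x else 0)" for x
      have f1m: "f1 \<in> borel_measurable (Pi\<^sub>M \<Gamma> (\<lambda>_. borel))"
        unfolding f1_def using \<Gamma>(3) by measurable
      have f1b: "\<bar>f1 x\<bar> \<le> c * A" for x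
      proof (cases "w * norm (x p) \<le> A")
        case True
        have "norm (x p) \<le> w * norm (x p)" using mult_right_mono[OF w(1) norm_ge_zero[of "x p"]] by simp
        then have "c * norm (x p) \<le> c * A" using True c by (intro mult_left_mono) auto
        then show ?thesis using fc[of x] True by (simp add: f1_def)
      next
        case False
        then show ?thesis using A c by (simp add: f1_def)
      qed
      define U1 where "U1 \<omega> = f1 (\<lambda>t\<in>\<Gamma>. X t \<omega>)" for \<omega>
      define g where "g \<omega> = G (X j \<omega>)" for \<omega>
      have [measurable]: "U1 \<in> borel_measurable M" "g \<in> borel_measurable M"
        unfolding U1_def g_def using f1m by measurable
      have U1: "U1 \<omega> = (if Z p \<omega> \<le> A then U \<omega> else 0)" for \<omega>
        using \<Gamma>(3) by (simp add: U1_def f1_def U_def Z_def)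
      have U1b: "\<bar>U1 \<omega>\<bar> \<le> c * A" for \<omega> using f1b by (simp add: U1_def)
      have gA: "\<bar>g \<omega>\<bar> \<le> A" for \<omega> using GA by (simp add: g_def)
      define r where "r \<omega> = Y \<omega> - g \<omega>" for \<omega>
      have [measurable]: "r \<in> borel_measurable M" unfolding r_def by measurable
      have rb: "A * \<bar>r \<omega>\<bar> \<le> A powr - \<delta> * Q j \<omega>" for \<omega>
      proof (cases "\<bar>Y \<omega>\<bar> \<le> A")
        case True
        then have "r \<omega> = 0" by (auto simp: r_def g_def G_def Y_def)
        then show ?thesis using Q0 by simp
      next
        case False
        then have "Z j \<omega> > A" using YZ[of \<omega>] by linarith
        moreover have "\<bar>r \<omega>\<bar> \<le> Z j \<omega>" using YZ[of \<omega>] False A by (auto simp: r_def g_def G_def Y_def)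
        then have "A * \<bar>r \<omega>\<bar> \<le> A * Z j \<omega>" using A by (intro mult_left_mono) auto
        ultimately show ?thesis using tail_moment_bounds(2)[OF A Z0, of j \<omega>] by (simp add: Q_def)
      qed
      have c1: "integrable M U1" by (rule integrable_const_bound[of _ "c * A"]) (use U1b in auto)
      have c2: "integrable M g" by (rule integrable_const_bound[of _ A]) (use gA in auto)
      have c3: "integrable M (\<lambda>\<omega>. U1 \<omega> * g \<omega>)"
        by (rule integrable_const_bound[of _ "c * A * A"])
          (use U1b gA c A in \<open>auto simp: abs_mult intro!: AE_I2 mult_mono\<close>)
      have Yi: "integrable M Y" unfolding Y_def by (rule inner_integrable)
      have c4: "integrable M r" unfolding r_def using Yi c2 by simp
      have c5: "integrable M (\<lambda>\<omega>. U1 \<omega> * r \<omega>)"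
      proof (rule Bochner_Integration.integrable_bound)
        show "integrable M (\<lambda>\<omega>. c * A * r \<omega>)" using c4 by simp
        show "AE \<omega> in M. norm (U1 \<omega> * r \<omega>) \<le> norm (c * A * r \<omega>)"
          using U1b c A by (intro AE_I2) (simp add: abs_mult mult_right_mono)
      qed measurable
      have "(\<lambda>\<omega>. U1 \<omega> * Y \<omega>) = (\<lambda>\<omega>. U1 \<omega> * g \<omega> + U1 \<omega> * r \<omega>)" by (simp add: r_def algebra_simps)
      then have c6: "integrable M (\<lambda>\<omega>. U1 \<omega> * Y \<omega>)" using c3 c5 by simp
      have cov: "\<bar>covariance M U1 g\<bar> \<le> C * real h powr - \<alpha> * (c * A) * norm v"
        unfolding U1_def g_def
      proof (rule covariance_le_theta[OF _ _ \<Gamma>(1) _ \<Gamma>(2) f1m f1b GL Gb])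
        show "theta M X h \<le> ennreal (C * real h powr - \<alpha>)" using C(2) True by (simp add: H_def)
        show "0 \<le> C * real h powr - \<alpha>" using C by simp
        show "\<Gamma> \<noteq> {}" using \<Gamma> by auto
      qed
      have "expectation (\<lambda>\<omega>. U \<omega> * Y \<omega>) = expectation (\<lambda>\<omega>. U \<omega> * Y \<omega> - U1 \<omega> * Y \<omega>) + expectation (\<lambda>\<omega>. U1 \<omega> * Y \<omega>)"
        using UYi c6 by simp
      also have "expectation (\<lambda>\<omega>. U1 \<omega> * Y \<omega>) = expectation (\<lambda>\<omega>. U1 \<omega> * g \<omega>) + expectation (\<lambda>\<omega>. U1 \<omega> * r \<omega>)"
        using c3 c5 by (simp add: \<open>(\<lambda>\<omega>. U1 \<omega> * Y \<omega>) = _\<close>)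
      also have "expectation (\<lambda>\<omega>. U1 \<omega> * g \<omega>) = covariance M U1 g - expectation U1 * expectation r"
      proof -
        (* The truncation g is not centred, but its mean is that of the small remainder. *)
        have "expectation g = - expectation r"
        proof -
          have "expectation r = expectation Y - expectation g"
            using Yi c2 by (simp add: r_def[abs_def])
          also have "expectation Y = 0"
            unfolding Y_def[abs_def] by (rule inner_centered)
          finally show ?thesis by simp
        qed
        then show ?thesis using covariance_eq[OF c1 c2 c3] by simp
      qed
      finally have split: "\<bar>expectation (\<lambda>\<omega>. U \<omega> * Y \<omega>)\<bar> \<le> \<bar>expectation (\<lambda>\<omega>. U \<omega> * Y \<omega> - U1 \<omega> * Y \<omega>)\<bar>
          + \<bar>covariance M U1 g\<bar> + \<bar>expectation U1 * expectation r\<bar> + \<bar>expectation (\<lambda>\<omega>. U1 \<omega> * r \<omega>)\<bar>"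
        by linarith
      have t1: "\<bar>expectation (\<lambda>\<omega>. U \<omega> * Y \<omega> - U1 \<omega> * Y \<omega>)\<bar> \<le> c * (A powr - \<delta> * (2 * K0))"
      proof -
        have "\<bar>expectation (\<lambda>\<omega>. U \<omega> * Y \<omega> - U1 \<omega> * Y \<omega>)\<bar> \<le> expectation (\<lambda>\<omega>. c * (A powr - \<delta> * (Q p \<omega> + Q j \<omega>)))"
        proof (rule abs_integral_le)
          fix \<omega>
          show "\<bar>U \<omega> * Y \<omega> - U1 \<omega> * Y \<omega>\<bar> \<le> c * (A powr - \<delta> * (Q p \<omega> + Q j \<omega>))"
          proof (cases "Z p \<omega> \<le> A")
            case True
            then show ?thesis using c Q0 by (simp add: U1)
          next
            case False
            let ?m = "max (Z p \<omega>) (Z j \<omega>)"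
            have "Z p \<omega> * Z j \<omega> \<le> ?m * ?m" using Z0[of p \<omega>] Z0[of j \<omega>] by (intro mult_mono) auto
            also have "\<dots> = ?m\<^sup>2" by (simp add: power2_eq_square)
            also have "\<dots> \<le> A powr - \<delta> * ?m powr (2 + \<delta>)"
              using False Z0 A by (intro tail_moment_bounds(1)) (auto simp: max_def)
            also have "\<dots> \<le> A powr - \<delta> * (Q p \<omega> + Q j \<omega>)"
              using Q0[of p \<omega>] Q0[of j \<omega>] by (intro mult_left_mono) (auto simp: max_def Q_def)
            finally have "c * (Z p \<omega> * Z j \<omega>) \<le> c * (A powr - \<delta> * (Q p \<omega> + Q j \<omega>))"
              using c by (intro mult_left_mono)
            moreover have "\<bar>U \<omega> * Y \<omega>\<bar> \<le> (c * Z p \<omega>) * Z j \<omega>"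
              unfolding abs_mult using c Z0 by (intro mult_mono UZ YZ) auto
            ultimately show ?thesis using False by (simp add: U1 mult.assoc)
          qed
        qed (use UYi c6 in auto)
        then show ?thesis by (simp add: QK)
      qed
      have r1: "A * expectation (\<lambda>\<omega>. \<bar>r \<omega>\<bar>) \<le> A powr - \<delta> * K0"
      proof -
        have "expectation (\<lambda>\<omega>. A * \<bar>r \<omega>\<bar>) \<le> expectation (\<lambda>\<omega>. A powr - \<delta> * Q j \<omega>)"
          using c4 rb by (intro integral_mono) auto
        then show ?thesis by (simp add: QK)
      qed
      have t2: "\<bar>expectation U1 * expectation r\<bar> \<le> c * (A powr - \<delta> * K0)"
      proof -
        have "\<bar>expectation U1\<bar> \<le> expectation (\<lambda>_. c * A)"
          using c1 U1b by (intro abs_integral_le) auto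
        then have "\<bar>expectation U1\<bar> \<le> c * A" by (simp add: prob_space)
        moreover have "\<bar>expectation r\<bar> \<le> expectation (\<lambda>\<omega>. \<bar>r \<omega>\<bar>)"
          using c4 by (intro abs_integral_le) auto
        ultimately have "\<bar>expectation U1 * expectation r\<bar> \<le> (c * A) * expectation (\<lambda>\<omega>. \<bar>r \<omega>\<bar>)"
          unfolding abs_mult using c A by (intro mult_mono) auto
        also have "\<dots> \<le> c * (A powr - \<delta> * K0)"
          using mult_left_mono[OF r1 c] by (simp add: mult.assoc)
        finally show ?thesis .
      qed
      have t3: "\<bar>expectation (\<lambda>\<omega>. U1 \<omega> * r \<omega>)\<bar> \<le> c * (A powr - \<delta> * K0)"
      proof -
        have "\<bar>expectation (\<lambda>\<omega>. U1 \<omega> * r \<omega>)\<bar> \<le> expectation (\<lambda>\<omega>. (c * A) * \<bar>r \<omega>\<bar>)"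
          using c5 c4 U1b by (intro abs_integral_le) (auto simp: abs_mult intro!: mult_right_mono)
        also have "\<dots> = c * (A * expectation (\<lambda>\<omega>. \<bar>r \<omega>\<bar>))" by simp
        also have "\<dots> \<le> c * (A powr - \<delta> * K0)" using r1 c by (rule mult_left_mono)
        finally show ?thesis .
      qed
      have t4: "C * real h powr - \<alpha> * (c * A) * norm v = c * (real h powr - \<beta> * (C * norm v))"
        unfolding A2[symmetric] by (simp add: mult_ac)
      have "\<bar>expectation (\<lambda>\<omega>. U \<omega> * Y \<omega>)\<bar> \<le> c * (A powr - \<delta> * (2 * K0)) + c * (real h powr - \<beta> * (C * norm v))
         + c * (A powr - \<delta> * K0) + c * (A powr - \<delta> * K0)"
        using split t1 t2 t3 cov unfolding t4 by linarith
      also have "\<dots> = (4 * K0 + C * norm v) * (c * real h powr - \<beta>)"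
        unfolding A1 by (simp add: algebra_simps)
      also have "\<dots> \<le> K * (c * real h powr - \<beta>)"
        using c S0 by (intro mult_right_mono) (auto simp: K_def)
      finally show ?thesis by (simp add: U_def Y_def mult.assoc)
    qed
  qed
qed

end

section \<open>Mean ergodic theorem for lattice shifts\<close>

text \<open>Dyadic convex combinations of shifts. They suffice for the mean ergodic theorem, and a property passes to all of them
  as soon as it holds for shifts and is inherited by midpoints.\<close>
inductive_set shift_averages ::
  "((int ^ 'm::finite \<Rightarrow> real ^ 'n::finite) \<Rightarrow> real) \<Rightarrow> ((int ^ 'm \<Rightarrow> real ^ 'n) \<Rightarrow> real) set"
  for U where
  shifted: "(\<lambda>x. U (shift l x)) \<in> shift_averages U"
| midpoint: "f \<in> shift_averages U \<Longrightarrow> g \<in> shift_averages U \<Longrightarrow> (\<lambda>x. (f x + g x) / 2) \<in> shift_averages U"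

lemma shift_shift: "shift l (shift h x) = shift (l + h) x"
  by (simp add: shift_def add.assoc)

lemma shift_measurable [measurable]:
  "shift h \<in> measurable (Pi\<^sub>M UNIV (\<lambda>_. borel)) (Pi\<^sub>M UNIV (\<lambda>_. borel))"
  unfolding shift_def by (rule measurable_abs_UNIV) measurable

lemma shift_averages_shift:
  "f \<in> shift_averages U \<Longrightarrow> (\<lambda>x. f (shift h x)) \<in> shift_averages U"
proof (induction rule: shift_averages.induct)
  case (shifted l)
  then show ?case using shift_averages.shifted[of U "l + h"] by (simp add: shift_shift)
next
  case (midpoint f g)
  then show ?case by (intro shift_averages.midpoint)
qed

lemma shift_averages_measurable:
  assumes [measurable]: "U \<in> borel_measurable (Pi\<^sub>M UNIV (\<lambda>_. borel))"
  shows "f \<in> shift_averages U \<Longrightarrow> f \<in> borel_measurable (Pi\<^sub>M UNIV (\<lambda>_. borel))"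
proof (induction rule: shift_averages.induct)
  case (midpoint f g)
  note [measurable] = midpoint.IH
  show ?case by measurable
qed measurable

lemma shift_averages_bounded:
  assumes "\<And>x. \<bar>U x\<bar> \<le> B"
  shows "f \<in> shift_averages U \<Longrightarrow> \<bar>f x\<bar> \<le> B"
proof (induction arbitrary: x rule: shift_averages.induct)
  case (midpoint f g)
  have "\<bar>f x + g x\<bar> \<le> B + B"
    using abs_triangle_ineq[of "f x" "g x"] midpoint.IH(1)[of x] midpoint.IH(2)[of x] by linarith
  then show ?case by simp
qed (rule assms)

context prob_space
begin

lemma L1_le_L2:
  assumes [measurable]: "g \<in> borel_measurable M" and "\<And>x. \<bar>g x :: real\<bar> \<le> C"
  shows "(\<integral>x. \<bar>g x\<bar> \<partial>M)\<^sup>2 \<le> (\<integral>x. (g x)\<^sup>2 \<partial>M)"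
proof -
  have C: "C \<ge> 0" using assms(2)[of undefined] by linarith
  have i1: "integrable M (\<lambda>x. \<bar>g x\<bar>)" by (rule integrable_const_bound[of _ C]) (use assms in auto)
  have "\<bar>g x\<bar>\<^sup>2 \<le> C\<^sup>2" for x using assms(2) by (intro power_mono) auto
  then have i2: "integrable M (\<lambda>x. \<bar>g x\<bar>\<^sup>2)" by (intro integrable_const_bound[of _ "C\<^sup>2"]) auto
  show ?thesis
    using variance_positive[of "\<lambda>x. \<bar>g x\<bar>"] variance_eq[OF i1 i2] by simp
qed

end

context stationary_field
begin

lemma prob_space_field_law: "prob_space (field_law M X)"
  unfolding field_law_def by (intro prob_space_distr) measurable

lemma sets_field_law [simp, measurable_cong]: "sets (field_law M X) = sets (Pi\<^sub>M UNIV (\<lambda>_. borel))"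
  by (simp add: field_law_def)

lemma distr_shift_field_law: "distr (field_law M X) (field_law M X) (shift h) = field_law M X"
proof -
  have "distr (field_law M X) (field_law M X) (shift h) = distr (field_law M X) (Pi\<^sub>M UNIV (\<lambda>_. borel)) (shift h)"
    by (rule distr_cong) auto
  also have "\<dots> = distr M (Pi\<^sub>M UNIV (\<lambda>_. borel)) (\<lambda>\<omega> t. X (t + h) \<omega>)"
    unfolding field_law_def by (subst distr_distr) (auto simp: comp_def shift_def)
  finally show ?thesis by (simp add: law_shift field_law_def)
qed

text \<open>Minimise the \<open>L\<^sup>2\<close> norm over the averages of shifts. By the parallelogram identity a minimising sequence is Cauchy, and by
  the same identity its shifts approach it, because they are minimising too. So the limit is invariant, hence almost
  surely constant by ergodicity, and the constant is the mean, which is zero.\<close>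
lemma ergodic_shift_average_small_bounded:
  assumes erg: "ergodic_field M X"
    and Z [measurable]: "Z \<in> borel_measurable (Pi\<^sub>M UNIV (\<lambda>_. borel))"
    and B: "\<And>x. \<bar>Z x\<bar> \<le> B" and mean: "(\<integral>x. Z x \<partial>field_law M X) = 0" and "\<epsilon> > 0"
  obtains f where "f \<in> shift_averages Z" "(\<integral>x. \<bar>f x\<bar> \<partial>field_law M X) < \<epsilon>"
proof -
  define P where "P = field_law M X"
  interpret P: prob_space P unfolding P_def by (rule prob_space_field_law)
  have setsP [simp, measurable_cong]: "sets P = sets (Pi\<^sub>M UNIV (\<lambda>_. borel))" by (simp add: P_def)
  have spP [simp]: "space P = UNIV" by (simp add: sets_eq_imp_space_eq[OF setsP] space_PiM)
  have inv: "(\<integral>x. g (shift h x) \<partial>P) = (\<integral>x. g x \<partial>P)" if "g \<in> borel_measurable (Pi\<^sub>M UNIV (\<lambda>_. borel))"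
    for h and g :: "((int, 'm) vec \<Rightarrow> (real, 'n) vec) \<Rightarrow> real"
  proof -
    have "(\<integral>x. g x \<partial>distr P P (shift h)) = (\<integral>x. g (shift h x) \<partial>P)"
      using that by (intro integral_distr) measurable
    then show ?thesis using distr_shift_field_law[of h] by (simp add: P_def)
  qed
  let ?H = "shift_averages Z"
  have m: "f \<in> borel_measurable (Pi\<^sub>M UNIV (\<lambda>_. borel))" if "f \<in> ?H" for f
    using that by (rule shift_averages_measurable[OF Z])
  have b: "\<bar>f x\<bar> \<le> B" if "f \<in> ?H" for f x
    using shift_averages_bounded[OF B that] .
  have B0: "B \<ge> 0" using B[of undefined] by linarith
  have int: "integrable P f" if "f \<in> ?H" for f
    by (rule P.integrable_const_bound[of _ B]) (use b m that in auto)
  have b2: "\<bar>f x * g x\<bar> \<le> B * B" if "f \<in> ?H" "g \<in> ?H" for f g x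
    unfolding abs_mult using b that B0 by (intro mult_mono) auto
  have int2: "integrable P (\<lambda>x. f x * g x)" if "f \<in> ?H" "g \<in> ?H" for f g
    by (rule P.integrable_const_bound[of _ "B * B"]) (use b2 m that in auto)
  have meanH: "(\<integral>x. f x \<partial>P) = 0" if "f \<in> ?H" for f
    using that
  proof (induction rule: shift_averages.induct)
    case (shifted l)
    then show ?case using inv[OF Z] mean by (simp add: P_def)
  next
    case (midpoint f g)
    then show ?case using int by simp
  qed
  define Nm where "Nm f = (\<integral>x. (f x)\<^sup>2 \<partial>P)" for f :: "((int, 'm) vec \<Rightarrow> (real, 'n) vec) \<Rightarrow> real"
  define d where "d = Inf (Nm ` ?H)"
  have bdd: "bdd_below (Nm ` ?H)" by (rule bdd_belowI2[of _ 0]) (simp add: Nm_def)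
  have ne: "Nm ` ?H \<noteq> {}" using shift_averages.shifted by blast
  have dle: "d \<le> Nm f" if "f \<in> ?H" for f
    unfolding d_def using that by (intro cInf_lower bdd) auto
  have par: "(\<integral>x. (f x - g x)\<^sup>2 \<partial>P) \<le> 2 * Nm f + 2 * Nm g - 4 * d" if fg: "f \<in> ?H" "g \<in> ?H" for f g
  proof -
    have "(\<integral>x. (f x - g x)\<^sup>2 \<partial>P) = (\<integral>x. 2 * (f x * f x) + 2 * (g x * g x) - 4 * ((f x + g x) / 2)\<^sup>2 \<partial>P)"
      by (intro Bochner_Integration.integral_cong refl) (simp add: power2_eq_square field_simps)
    also have "\<dots> = 2 * Nm f + 2 * Nm g - 4 * Nm (\<lambda>x. (f x + g x) / 2)"
    proof -
      define h where "h x = ((f x + g x) / 2)\<^sup>2" for x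
      have "integrable P h"
        unfolding h_def power2_eq_square using fg by (intro int2 shift_averages.midpoint)
      moreover have "Nm (\<lambda>x. (f x + g x) / 2) = (\<integral>x. h x \<partial>P)"
        by (simp add: Nm_def h_def)
      ultimately show ?thesis
        unfolding h_def[symmetric]
        using int2[OF fg(1) fg(1)] int2[OF fg(2) fg(2)] by (simp add: Nm_def power2_eq_square)
    qed
    also have "\<dots> \<le> 2 * Nm f + 2 * Nm g - 4 * d"
      using dle[OF shift_averages.midpoint[OF fg]] by simp
    finally show ?thesis .
  qed
  have "\<exists>f\<in>?H. Nm f < d + 1 / real (Suc k)" for k
    using cInf_lessD[OF ne, of "d + 1 / real (Suc k)"] by (auto simp: d_def)
  then obtain s where s: "\<And>k. s k \<in> ?H" "\<And>k. Nm (s k) < d + 1 / real (Suc k)" by metis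
  note [measurable] = m[OF s(1)]
  have L1: "(\<integral>x. \<bar>f x - g x\<bar> \<partial>P)\<^sup>2 \<le> 2 * Nm f + 2 * Nm g - 4 * d" if "f \<in> ?H" "g \<in> ?H" for f g
  proof -
    have "(\<integral>x. \<bar>f x - g x\<bar> \<partial>P)\<^sup>2 \<le> (\<integral>x. (f x - g x)\<^sup>2 \<partial>P)"
    proof (rule P.L1_le_L2)
      show "(\<lambda>x. f x - g x) \<in> borel_measurable P" using m that by measurable
      show "\<bar>f x - g x\<bar> \<le> 2 * B" for x using b[OF that(1), of x] b[OF that(2), of x] by linarith
    qed
    also note par[OF that]
    finally show ?thesis .
  qed
  have L1small: "(\<integral>x. \<bar>f x - g x\<bar> \<partial>P) < e"
    if "f \<in> ?H" "g \<in> ?H" "Nm f < d + e\<^sup>2 / 4" "Nm g < d + e\<^sup>2 / 4" "e > 0" for f g e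
  proof -
    have "(\<integral>x. \<bar>f x - g x\<bar> \<partial>P)\<^sup>2 < e\<^sup>2" using L1[OF that(1,2)] that(3,4) by linarith
    then show ?thesis using \<open>e > 0\<close> by (simp add: power_less_imp_less_base)
  qed
  have small: "\<exists>N. \<forall>k\<ge>N. Nm (s k) < d + e\<^sup>2 / 4" if "e > 0" for e
  proof -
    have "0 < e\<^sup>2 / 4" using \<open>e > 0\<close> by simp
    then obtain N where N: "inverse (real (Suc N)) < e\<^sup>2 / 4" using reals_Archimedean by blast
    have "Nm (s k) < d + e\<^sup>2 / 4" if "k \<ge> N" for k
    proof -
      have "1 / real (Suc k) \<le> 1 / real (Suc N)" using that by (intro divide_left_mono) auto
      then show ?thesis using s(2)[of k] N by (simp add: inverse_eq_divide)
    qed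
    then show ?thesis by blast
  qed
  have "\<exists>N. \<forall>i\<ge>N. \<forall>j\<ge>N. (\<integral>x. norm (s i x - s j x) \<partial>P) < e" if "0 < e" for e
  proof -
    obtain N where N: "\<And>k. k \<ge> N \<Longrightarrow> Nm (s k) < d + e\<^sup>2 / 4" using small[OF \<open>0 < e\<close>] by blast
    have "(\<integral>x. norm (s i x - s j x) \<partial>P) < e" if "i \<ge> N" "j \<ge> N" for i j
      unfolding real_norm_def by (rule L1small[OF s(1) s(1) N[OF that(1)] N[OF that(2)] \<open>0 < e\<close>])
    then show ?thesis by blast
  qed
  then obtain r where r: "strict_mono r" "AE x in P. Cauchy (\<lambda>i. s (r i) x)"
    using cauchy_L1_AE_cauchy_subseq[of P s, OF int[OF s(1)]] by blast
  define F where "F x = lim (\<lambda>i. s (r i) x)" for x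
  have Fm [measurable]: "F \<in> borel_measurable (Pi\<^sub>M UNIV (\<lambda>_. borel))"
    unfolding F_def by (rule borel_measurable_lim_metric) measurable
  have conv: "AE x in P. (\<lambda>i. s (r i) x) \<longlonglongrightarrow> F x"
    using r(2) by eventually_elim (auto simp: F_def convergent_LIMSEQ_iff[symmetric] Cauchy_convergent)
  have convh: "AE x in P. (\<lambda>i. s (r i) (shift h x)) \<longlonglongrightarrow> F (shift h x)" for h
  proof (rule AE_distrD[where f="shift h" and M'=P and P="\<lambda>x. (\<lambda>i. s (r i) x) \<longlonglongrightarrow> F x"])
    show "shift h \<in> measurable P P" by measurable
    show "AE x in distr P P (shift h). (\<lambda>i. s (r i) x) \<longlonglongrightarrow> F x"
      using conv unfolding distr_shift_field_law[of h, folded P_def] .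
  qed
  have Finv: "AE x in P. F (shift h x) = F x" for h
  proof -
    have "(\<lambda>i. \<integral>x. \<bar>s (r i) x - s (r i) (shift h x)\<bar> \<partial>P) \<longlonglongrightarrow> (\<integral>x. \<bar>F x - F (shift h x)\<bar> \<partial>P)"
    proof (rule integral_dominated_convergence[where w="\<lambda>_. 2 * B"])
      show "AE x in P. (\<lambda>i. \<bar>s (r i) x - s (r i) (shift h x)\<bar>) \<longlonglongrightarrow> \<bar>F x - F (shift h x)\<bar>"
        using conv convh[of h] by eventually_elim (intro tendsto_intros)
      show "AE x in P. norm \<bar>s (r i) x - s (r i) (shift h x)\<bar> \<le> 2 * B" for i
      proof (rule AE_I2)
        fix x show "norm \<bar>s (r i) x - s (r i) (shift h x)\<bar> \<le> 2 * B"
          using b[OF s(1), of "r i" x] b[OF s(1), of "r i" "shift h x"] by simp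
      qed
    qed measurable
    moreover have "(\<lambda>i. \<integral>x. \<bar>s (r i) x - s (r i) (shift h x)\<bar> \<partial>P) \<longlonglongrightarrow> 0"
    proof (rule LIMSEQ_I)
      fix e :: real assume e: "e > 0"
      obtain N where N: "\<And>k. k \<ge> N \<Longrightarrow> Nm (s k) < d + e\<^sup>2 / 4" using small[OF e] by blast
      have "(\<integral>x. \<bar>s (r i) x - s (r i) (shift h x)\<bar> \<partial>P) < e" if "i \<ge> N" for i
      proof (rule L1small[OF s(1) shift_averages_shift[OF s(1)] _ _ e])
        have "r i \<ge> N" using seq_suble[OF r(1), of i] that by linarith
        then show 1: "Nm (s (r i)) < d + e\<^sup>2 / 4" by (rule N)
        have "Nm (\<lambda>x. s (r i) (shift h x)) = Nm (s (r i))"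
          unfolding Nm_def by (rule inv[of "\<lambda>x. (s (r i) x)\<^sup>2"]) measurable
        then show "Nm (\<lambda>x. s (r i) (shift h x)) < d + e\<^sup>2 / 4" using 1 by simp
      qed
      then show "\<exists>no. \<forall>n\<ge>no. norm ((\<integral>x. \<bar>s (r n) x - s (r n) (shift h x)\<bar> \<partial>P) - 0) < e"
        by (intro exI[of _ N]) simp
    qed
    ultimately have z: "(\<integral>x. \<bar>F x - F (shift h x)\<bar> \<partial>P) = 0" by (rule LIMSEQ_unique)
    have FB: "AE x in P. \<bar>F x\<bar> \<le> B"
      using conv by eventually_elim (rule LIMSEQ_le_const2[OF tendsto_rabs], use b[OF s(1)] in auto)
    have FBh: "AE x in P. \<bar>F (shift h x)\<bar> \<le> B"
      using convh[of h] by eventually_elim (rule LIMSEQ_le_const2[OF tendsto_rabs], use b[OF s(1)] in auto)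
    have "integrable P (\<lambda>x. \<bar>F x - F (shift h x)\<bar>)"
      by (rule P.integrable_const_bound[of _ "2 * B"]) (use FB FBh in \<open>eventually_elim, auto\<close>, measurable)
    then have "AE x in P. \<bar>F x - F (shift h x)\<bar> = 0"
      using z by (subst integral_nonneg_eq_0_iff_AE[symmetric]) auto
    then show ?thesis by eventually_elim simp
  qed
  have FB: "AE x in P. \<bar>F x\<bar> \<le> B"
    using conv by eventually_elim (rule LIMSEQ_le_const2[OF tendsto_rabs], use b[OF s(1)] in auto)
  have Fi: "integrable P F" by (rule P.integrable_const_bound[of _ B]) (use FB in auto)
  have Fmean: "(\<integral>x. F x \<partial>P) = 0"
  proof -
    have "(\<lambda>i. \<integral>x. s (r i) x \<partial>P) \<longlonglongrightarrow> (\<integral>x. F x \<partial>P)"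
      by (rule integral_dominated_convergence[where w="\<lambda>_. B"]) (use conv b[OF s(1)] in auto)
    then show ?thesis using meanH[OF s(1)] by (simp add: LIMSEQ_const_iff)
  qed
  have allinv: "AE x in P. \<forall>h. F (shift h x) = F x" using Finv by (simp add: AE_all_countable)
  have neg: "AE x in P. \<not> F x \<le> q" if "q < 0" for q
  proof -
    (* F is invariant only almost surely; quantifying over all shifts gives a strictly invariant event. *)
    let ?A = "{x. \<forall>h. F (shift h x) \<le> q}"
    have Am: "?A \<in> sets (Pi\<^sub>M UNIV (\<lambda>_. borel))"
    proof -
      have "{x \<in> space (Pi\<^sub>M UNIV (\<lambda>_. borel)). \<forall>h. F (shift h x) \<le> q} \<in> sets (Pi\<^sub>M UNIV (\<lambda>_. borel))"
        by measurable
      then show ?thesis by (simp add: space_PiM)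
    qed
    have "shift h -` ?A = ?A" for h :: "(int, 'm) vec"
    proof (intro set_eqI iffI)
      fix x assume "x \<in> shift h -` ?A"
      then have "F (shift (l - h) (shift h x)) \<le> q" for l by blast
      then show "x \<in> ?A" by (simp add: shift_shift)
    qed (auto simp: shift_shift)
    then have "measure P ?A \<in> {0, 1}"
      using erg Am unfolding ergodic_field_def P_def by blast
    moreover have "measure P ?A \<noteq> 1"
    proof
      assume "measure P ?A = 1"
      then have "AE x in P. x \<in> ?A" using Am by (intro P.AE_prob_1) 
      then have "AE x in P. F x \<le> q" using allinv by eventually_elim auto
      then have "(\<integral>x. F x \<partial>P) \<le> (\<integral>x. q \<partial>P)" using Fi by (intro integral_mono_AE) auto
      then show False using Fmean \<open>q < 0\<close> by (simp add: P.prob_space[simplified])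
    qed
    ultimately have "measure P ?A = 0" by simp
    then have "AE x in P. x \<notin> ?A" using Am by (simp add: P.prob_eq_0)
    then show ?thesis using allinv by eventually_elim auto
  qed
  have "AE x in P. \<forall>k. \<not> F x \<le> - (1 / real (Suc k))"
    unfolding AE_all_countable by (intro allI neg) simp
  then have "AE x in P. 0 \<le> F x"
  proof eventually_elim
    case (elim x)
    show ?case
    proof (rule ccontr)
      assume "\<not> 0 \<le> F x"
      then obtain k where "inverse (real (Suc k)) < - F x" using reals_Archimedean[of "- F x"] by auto
      then show False using elim by (auto simp: inverse_eq_divide dest!: spec[of _ k])
    qed
  qed
  then have F0: "AE x in P. F x = 0"
    using Fmean integral_nonneg_eq_0_iff_AE[OF Fi] by simp
  have "(\<lambda>i. \<integral>x. \<bar>s (r i) x\<bar> \<partial>P) \<longlonglongrightarrow> (\<integral>x. 0 \<partial>P)"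
  proof (rule integral_dominated_convergence[where w="\<lambda>_. B"])
    show "AE x in P. (\<lambda>i. \<bar>s (r i) x\<bar>) \<longlonglongrightarrow> 0"
      using conv F0 by eventually_elim (auto intro: tendsto_rabs_zero)
  qed (use b[OF s(1)] in auto)
  then have "\<forall>\<^sub>F i in sequentially. (\<integral>x. \<bar>s (r i) x\<bar> \<partial>P) < \<epsilon>"
    using \<open>\<epsilon> > 0\<close> by (intro order_tendstoD) auto
  then obtain i where "(\<integral>x. \<bar>s (r i) x\<bar> \<partial>P) < \<epsilon>" by (auto simp: eventually_sequentially)
  then show ?thesis using that[OF s(1)] by (simp add: P_def)
qed

text \<open>The mean ergodic theorem in \<open>L\<^sup>1\<close>: shifts are isometries, so an integrable function may be replaced by a recentred
  truncation, and the averages of the truncation are close to the corresponding averages of the function.\<close>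
lemma ergodic_shift_average_small:
  assumes erg: "ergodic_field M X"
    and U [measurable]: "U \<in> borel_measurable (Pi\<^sub>M UNIV (\<lambda>_. borel))"
    and int: "integrable M (\<lambda>\<omega>. U (\<lambda>t. X t \<omega>))" and mean: "expectation (\<lambda>\<omega>. U (\<lambda>t. X t \<omega>)) = 0" and "\<epsilon> > 0"
  obtains f where "f \<in> shift_averages U" "integrable M (\<lambda>\<omega>. f (\<lambda>t. X t \<omega>))" "expectation (\<lambda>\<omega>. \<bar>f (\<lambda>t. X t \<omega>)\<bar>) < \<epsilon>"
proof -
  define P where "P = field_law M X"
  interpret P: prob_space P unfolding P_def by (rule prob_space_field_law)
  have setsP [simp, measurable_cong]: "sets P = sets (Pi\<^sub>M UNIV (\<lambda>_. borel))" by (simp add: P_def)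
  have tr: "(\<integral>x. g x \<partial>P) = expectation (\<lambda>\<omega>. g (\<lambda>t. X t \<omega>))"
    "integrable P g \<longleftrightarrow> integrable M (\<lambda>\<omega>. g (\<lambda>t. X t \<omega>))" if "g \<in> borel_measurable (Pi\<^sub>M UNIV (\<lambda>_. borel))" 
    for g :: "((int, 'm) vec \<Rightarrow> (real, 'n) vec) \<Rightarrow> real"
    unfolding P_def field_law_def by (rule integral_distr integrable_distr_eq; use that in measurable)+
  have inv: "(\<integral>x. g (shift h x) \<partial>P) = (\<integral>x. g x \<partial>P)" "integrable P (\<lambda>x. g (shift h x)) \<longleftrightarrow> integrable P g"
    if [measurable]: "g \<in> borel_measurable (Pi\<^sub>M UNIV (\<lambda>_. borel))"
    for h and g :: "((int, 'm) vec \<Rightarrow> (real, 'n) vec) \<Rightarrow> real"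
  proof -
    have [measurable]: "(\<lambda>x. g (shift h x)) \<in> borel_measurable (Pi\<^sub>M UNIV (\<lambda>_. borel))" by measurable
    show "(\<integral>x. g (shift h x) \<partial>P) = (\<integral>x. g x \<partial>P)" "integrable P (\<lambda>x. g (shift h x)) \<longleftrightarrow> integrable P g"
      unfolding tr[OF that] tr[OF \<open>(\<lambda>x. g (shift h x)) \<in> _\<close>] unfolding shift_def
      by (rule integral_shift[OF that], rule integrable_shift[OF that])
  qed
  have Ui: "integrable P U" using int tr by simp
  have U0: "(\<integral>x. U x \<partial>P) = 0" using mean tr by simp
  define c where "c k x = max (- real k) (min (real k) (U x))" for k :: nat and x
  have [measurable]: "c k \<in> borel_measurable (Pi\<^sub>M UNIV (\<lambda>_. borel))" for k unfolding c_def by measurable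
  have ci: "integrable P (c k)" for k
    by (rule P.integrable_const_bound[of _ "real k"]) (auto simp: c_def)
  have "(\<lambda>k. \<integral>x. \<bar>U x - c k x\<bar> \<partial>P) \<longlonglongrightarrow> (\<integral>x. 0 \<partial>P)"
  proof (rule integral_dominated_convergence[where w="\<lambda>x. \<bar>U x\<bar>"])
    show "AE x in P. (\<lambda>k. \<bar>U x - c k x\<bar>) \<longlonglongrightarrow> 0"
    proof (rule AE_I2)
      fix x
      obtain k0 where "\<bar>U x\<bar> < real k0" using reals_Archimedean2 by blast
      then have "\<forall>\<^sub>F k in sequentially. \<bar>U x - c k x\<bar> = 0"
        by (intro eventually_sequentiallyI[of k0]) (auto simp: c_def)
      then show "(\<lambda>k. \<bar>U x - c k x\<bar>) \<longlonglongrightarrow> 0" by (rule tendsto_eventually)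
    qed
    show "AE x in P. norm \<bar>U x - c k x\<bar> \<le> \<bar>U x\<bar>" for k by (rule AE_I2) (auto simp: c_def)
  qed (use Ui in auto)
  then have "\<forall>\<^sub>F k in sequentially. (\<integral>x. \<bar>U x - c k x\<bar> \<partial>P) < \<epsilon> / 4"
    using \<open>\<epsilon> > 0\<close> by (intro order_tendstoD) auto
  then obtain k where k: "(\<integral>x. \<bar>U x - c k x\<bar> \<partial>P) < \<epsilon> / 4" by (auto simp: eventually_sequentially)
  define e where "e = (\<integral>x. c k x \<partial>P)"
  define Z where "Z x = c k x - e" for x
  have [measurable]: "Z \<in> borel_measurable (Pi\<^sub>M UNIV (\<lambda>_. borel))" unfolding Z_def by measurable
  have Zi: "integrable P Z" unfolding Z_def using ci by simp
  have e: "\<bar>e\<bar> \<le> (\<integral>x. \<bar>U x - c k x\<bar> \<partial>P)"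
  proof -
    have "e = - (\<integral>x. U x - c k x \<partial>P)" using Ui ci U0 by (simp add: e_def)
    then have "\<bar>e\<bar> = \<bar>\<integral>x. U x - c k x \<partial>P\<bar>" by simp
    also have "\<dots> \<le> (\<integral>x. \<bar>U x - c k x\<bar> \<partial>P)" using Ui ci by (intro abs_integral_le) auto
    finally show ?thesis .
  qed
  have UZ: "(\<integral>x. \<bar>U x - Z x\<bar> \<partial>P) \<le> \<epsilon> / 2"
  proof -
    have "(\<integral>x. \<bar>U x - Z x\<bar> \<partial>P) \<le> (\<integral>x. \<bar>U x - c k x\<bar> + \<bar>e\<bar> \<partial>P)"
      using Ui ci Zi by (intro integral_mono) (auto simp: Z_def)
    also have "\<dots> = (\<integral>x. \<bar>U x - c k x\<bar> \<partial>P) + \<bar>e\<bar>" using Ui ci by (simp add: P.prob_space)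
    finally show ?thesis using e k by linarith
  qed
  have close: "\<exists>g\<in>shift_averages U. integrable P f \<and> integrable P g \<and> (\<integral>x. \<bar>g x - f x\<bar> \<partial>P) \<le> \<epsilon> / 2"
    if "f \<in> shift_averages Z" for f
    using that
  proof (induction rule: shift_averages.induct)
    case (shifted l)
    have "(\<integral>x. \<bar>U (shift l x) - Z (shift l x)\<bar> \<partial>P) = (\<integral>x. \<bar>U x - Z x\<bar> \<partial>P)"
      by (rule inv(1)[of "\<lambda>x. \<bar>U x - Z x\<bar>"]) measurable
    then show ?case
      using UZ Ui Zi inv(2)[of U l] inv(2)[of Z l] shift_averages.shifted[of U l]
      by (intro bexI[of _ "\<lambda>x. U (shift l x)"]) auto
  next
    case (midpoint f1 f2)
    then obtain g1 g2 where g: "g1 \<in> shift_averages U" "g2 \<in> shift_averages U"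
      and i: "integrable P f1" "integrable P g1" "integrable P f2" "integrable P g2"
      and l: "(\<integral>x. \<bar>g1 x - f1 x\<bar> \<partial>P) \<le> \<epsilon> / 2" "(\<integral>x. \<bar>g2 x - f2 x\<bar> \<partial>P) \<le> \<epsilon> / 2" by blast
    have "(\<integral>x. \<bar>(g1 x + g2 x) / 2 - (f1 x + f2 x) / 2\<bar> \<partial>P) \<le> (\<integral>x. \<bar>g1 x - f1 x\<bar> / 2 + \<bar>g2 x - f2 x\<bar> / 2 \<partial>P)"
    proof (rule integral_mono)
      fix x
      show "\<bar>(g1 x + g2 x) / 2 - (f1 x + f2 x) / 2\<bar> \<le> \<bar>g1 x - f1 x\<bar> / 2 + \<bar>g2 x - f2 x\<bar> / 2"
        by (simp add: abs_if field_simps)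
    qed (use i in simp_all)
    also have "\<dots> = (\<integral>x. \<bar>g1 x - f1 x\<bar> \<partial>P) / 2 + (\<integral>x. \<bar>g2 x - f2 x\<bar> \<partial>P) / 2"
      using i by simp
    finally have "(\<integral>x. \<bar>(g1 x + g2 x) / 2 - (f1 x + f2 x) / 2\<bar> \<partial>P) \<le> \<epsilon> / 2" using l by linarith
    then show ?case using i shift_averages.midpoint[OF g]
      by (intro bexI[of _ "\<lambda>x. (g1 x + g2 x) / 2"]) auto
  qed
  have ZB: "\<bar>Z x\<bar> \<le> real k + \<bar>e\<bar>" for x by (auto simp: Z_def c_def)
  have Z0: "(\<integral>x. Z x \<partial>field_law M X) = 0"
    using ci unfolding P_def[symmetric] Z_def by (simp add: e_def P.prob_space)
  obtain f where f: "f \<in> shift_averages Z" "(\<integral>x. \<bar>f x\<bar> \<partial>field_law M X) < \<epsilon> / 2"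
    using ergodic_shift_average_small_bounded[OF erg _ ZB Z0, of "\<epsilon>/2"] \<open>\<epsilon> > 0\<close> by auto
  obtain g where g: "g \<in> shift_averages U" "integrable P f" "integrable P g" "(\<integral>x. \<bar>g x - f x\<bar> \<partial>P) \<le> \<epsilon> / 2"
    using close[OF f(1)] by blast
  have [measurable]: "g \<in> borel_measurable (Pi\<^sub>M UNIV (\<lambda>_. borel))" using shift_averages_measurable[OF U g(1)] .
  have "(\<integral>x. \<bar>g x\<bar> \<partial>P) \<le> (\<integral>x. \<bar>g x - f x\<bar> + \<bar>f x\<bar> \<partial>P)"
    using g by (intro integral_mono) auto
  also have "\<dots> = (\<integral>x. \<bar>g x - f x\<bar> \<partial>P) + (\<integral>x. \<bar>f x\<bar> \<partial>P)" using g by simp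
  finally have "(\<integral>x. \<bar>g x\<bar> \<partial>P) < \<epsilon>" using g(4) f(2) unfolding P_def by linarith
  then show ?thesis
    using that[OF g(1)] g(3) tr(1)[of "\<lambda>x. \<bar>g x\<bar>"] tr(2)[of g] by simp
qed

end

section \<open>Summable autocovariances\<close>

context theta_field
begin

text \<open>The bound on covariances at lag \<open>k\<close>, up to a constant; the maximum only guards the value at lag zero.\<close>
definition decay_weight :: "(int, 'm) vec \<Rightarrow> real" where
  "decay_weight k = max 1 (real_of_int (supnorm k)) powr - \<beta>"

lemma decay_weight_nonneg: "decay_weight k \<ge> 0" by (simp add: decay_weight_def)

lemma decay_weight_summable: "decay_weight summable_on UNIV"
  unfolding decay_weight_def[abs_def] by (rule summable_on_lattice_powr[OF \<beta>_large])

lemma inner_product_integrable: "integrable M (\<lambda>\<omega>. (u \<bullet> X s \<omega>) * (v \<bullet> X t \<omega>))"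
proof (rule Bochner_Integration.integrable_bound)
  show "integrable M (\<lambda>\<omega>. (norm u * norm v) * (norm (X s \<omega>) * norm (X t \<omega>)))"
    using product_integrable by simp
  show "AE \<omega> in M. norm ((u \<bullet> X s \<omega>) * (v \<bullet> X t \<omega>)) \<le> norm ((norm u * norm v) * (norm (X s \<omega>) * norm (X t \<omega>)))"
  proof (rule AE_I2)
    fix \<omega>
    have "\<bar>u \<bullet> X s \<omega>\<bar> * \<bar>v \<bullet> X t \<omega>\<bar> \<le> (norm u * norm (X s \<omega>)) * (norm v * norm (X t \<omega>))"
      by (intro mult_mono Cauchy_Schwarz_ineq2) auto
    then show "norm ((u \<bullet> X s \<omega>) * (v \<bullet> X t \<omega>)) \<le> norm ((norm u * norm v) * (norm (X s \<omega>) * norm (X t \<omega>)))"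
      by (simp add: abs_mult mult_ac)
  qed
qed measurable

text \<open>The lexicographically smaller of the two sites plays the role of the past.\<close>
lemma covariance_decay:
  obtains K where "K \<ge> 0" "\<And>k. \<bar>expectation (\<lambda>\<omega>. (u \<bullet> X 0 \<omega>) * (v \<bullet> X k \<omega>))\<bar> \<le> K * decay_weight k"
proof -
  obtain K1 where K1: "K1 \<ge> 0"
    "\<And>h j \<Gamma> p f c. \<lbrakk>h \<ge> 1; finite \<Gamma>; \<Gamma> \<subseteq> V_lex_dist j h; p \<in> \<Gamma>; f \<in> borel_measurable (Pi\<^sub>M \<Gamma> (\<lambda>_. borel));
       c \<ge> 0; \<And>x. \<bar>f x\<bar> \<le> c * norm (x p)\<rbrakk>
     \<Longrightarrow> \<bar>expectation (\<lambda>\<omega>. f (\<lambda>t\<in>\<Gamma>. X t \<omega>) * (v \<bullet> X j \<omega>))\<bar> \<le> K1 * c * real h powr - \<beta>"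
    by (rule far_covariance_bound[of v]) blast
  obtain K2 where K2: "K2 \<ge> 0"
    "\<And>h j \<Gamma> p f c. \<lbrakk>h \<ge> 1; finite \<Gamma>; \<Gamma> \<subseteq> V_lex_dist j h; p \<in> \<Gamma>; f \<in> borel_measurable (Pi\<^sub>M \<Gamma> (\<lambda>_. borel));
       c \<ge> 0; \<And>x. \<bar>f x\<bar> \<le> c * norm (x p)\<rbrakk>
     \<Longrightarrow> \<bar>expectation (\<lambda>\<omega>. f (\<lambda>t\<in>\<Gamma>. X t \<omega>) * (u \<bullet> X j \<omega>))\<bar> \<le> K2 * c * real h powr - \<beta>"
    by (rule far_covariance_bound[of u]) blast
  define K3 where "K3 = \<bar>expectation (\<lambda>\<omega>. (u \<bullet> X 0 \<omega>) * (v \<bullet> X 0 \<omega>))\<bar>"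
  define K where "K = K1 * norm u + K2 * norm v + K3"
  have nn: "K1 * norm u \<ge> 0" "K2 * norm v \<ge> 0" "K3 \<ge> 0" using K1(1) K2(1) by (auto simp: K3_def)
  show ?thesis
  proof (rule that)
    show "K \<ge> 0" using nn by (simp add: K_def)
    fix k :: "(int, 'm) vec"
    define h where "h = nat (supnorm k)"
    have h: "int h = supnorm k" using supnorm_nonneg[of k] by (simp add: h_def)
    have wth: "decay_weight k = real h powr - \<beta>" if "h \<ge> 1"
    proof -
      have "real_of_int (supnorm k) = real h" unfolding h[symmetric] by simp
      then show ?thesis using that by (simp add: decay_weight_def)
    qed
    have up: "c * decay_weight k \<le> K * decay_weight k" if "c \<le> K" for c
      using that decay_weight_nonneg by (rule mult_right_mono)
    consider "k = 0" | "lex_less 0 k" | "lex_less k 0" using lex_less_linear by blast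
    then show "\<bar>expectation (\<lambda>\<omega>. (u \<bullet> X 0 \<omega>) * (v \<bullet> X k \<omega>))\<bar> \<le> K * decay_weight k"
    proof cases
      case 1
      have sz: "supnorm (0 :: (int, 'm) vec) = 0" by (rule supnorm_eq_0_iff[THEN iffD2, OF refl])
      have "decay_weight k = 1" unfolding decay_weight_def \<open>k = 0\<close> sz by simp
      moreover have "K3 \<le> K" using nn by (simp add: K_def)
      ultimately show ?thesis using \<open>k = 0\<close> by (simp add: K3_def)
    next
      case 2
      then have "k \<noteq> 0" by auto
      then have h1: "h \<ge> 1" using h supnorm_eq_0_iff[of k] by (cases h) auto
      have "\<bar>expectation (\<lambda>\<omega>. (\<lambda>x. u \<bullet> x 0) (\<lambda>t\<in>{0}. X t \<omega>) * (v \<bullet> X k \<omega>))\<bar> \<le> K1 * norm u * real h powr - \<beta>"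
      proof (rule K1(2)[of h "{0}" k 0 "\<lambda>x. u \<bullet> x 0" "norm u", OF h1])
        show "{0} \<subseteq> V_lex_dist k h" using 2 h by (simp add: V_lex_dist_def V_lex_def)
        show "(\<lambda>x. u \<bullet> x 0) \<in> borel_measurable (Pi\<^sub>M {0 :: (int, 'm) vec} (\<lambda>_. borel))" by measurable
      qed (auto intro: Cauchy_Schwarz_ineq2)
      also have "\<dots> \<le> K * decay_weight k" unfolding wth[OF h1, symmetric] using nn by (intro up) (simp add: K_def)
      finally show ?thesis by simp
    next
      case 3
      then have "k \<noteq> 0" by auto
      then have h1: "h \<ge> 1" using h supnorm_eq_0_iff[of k] by (cases h) auto
      have "\<bar>expectation (\<lambda>\<omega>. (\<lambda>x. v \<bullet> x k) (\<lambda>t\<in>{k}. X t \<omega>) * (u \<bullet> X 0 \<omega>))\<bar> \<le> K2 * norm v * real h powr - \<beta>"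
      proof (rule K2(2)[of h "{k}" 0 k "\<lambda>x. v \<bullet> x k" "norm v", OF h1])
        show "{k} \<subseteq> V_lex_dist 0 h" using 3 h by (simp add: V_lex_dist_def V_lex_def)
        show "(\<lambda>x. v \<bullet> x k) \<in> borel_measurable (Pi\<^sub>M {k} (\<lambda>_. borel))" by measurable
      qed (auto intro: Cauchy_Schwarz_ineq2)
      also have "\<dots> \<le> K * decay_weight k" unfolding wth[OF h1, symmetric] using nn by (intro up) (simp add: K_def)
      finally show ?thesis by (simp add: mult.commute)
    qed
  qed
qed

text \<open>Autocovariance function of the scalar field \<open>v \<bullet> X\<close>.\<close>
definition \<gamma> :: "(real, 'n) vec \<Rightarrow> (int, 'm) vec \<Rightarrow> real" where
  "\<gamma> v k = expectation (\<lambda>\<omega>. (v \<bullet> X 0 \<omega>) * (v \<bullet> X k \<omega>))"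

lemma \<gamma>_abs_summable: "(\<lambda>k. \<bar>\<gamma> v k\<bar>) summable_on UNIV"
proof -
  obtain K where K: "K \<ge> 0" "\<And>k. \<bar>\<gamma> v k\<bar> \<le> K * decay_weight k"
    unfolding \<gamma>_def by (rule covariance_decay[of v v]) blast
  show ?thesis
    by (rule summable_on_comparison_test[where f="\<lambda>k. K * decay_weight k"])
      (use K decay_weight_summable in \<open>auto intro: summable_on_cmult_right\<close>)
qed

lemma \<gamma>_summable: "\<gamma> v summable_on UNIV"
  by (rule abs_summable_summable) (simp add: \<gamma>_abs_summable)

lemma expectation_product_eq_\<gamma>:
  "expectation (\<lambda>\<omega>. (v \<bullet> X j \<omega>) * (v \<bullet> X k \<omega>)) = \<gamma> v (k - j)"
proof -
  have "expectation (\<lambda>\<omega>. (v \<bullet> X (0 + j) \<omega>) * (v \<bullet> X ((k - j) + j) \<omega>)) = \<gamma> v (k - j)"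
    unfolding \<gamma>_def by (rule integral_pair_shift[of "\<lambda>x y. (v \<bullet> x) * (v \<bullet> y)"]) measurable
  then show ?thesis by simp
qed

lemma \<gamma>_minus: "\<gamma> v (- k) = \<gamma> v k"
proof -
  have "\<gamma> v (0 - k) = expectation (\<lambda>\<omega>. (v \<bullet> X k \<omega>) * (v \<bullet> X 0 \<omega>))"
    by (rule expectation_product_eq_\<gamma>[symmetric])
  also have "\<dots> = \<gamma> v k" unfolding \<gamma>_def by (subst mult.commute) (rule refl)
  finally show ?thesis by simp
qed

definition proj_sum :: "(real, 'n) vec \<Rightarrow> (int, 'm) vec set \<Rightarrow> 'a \<Rightarrow> real" where
  "proj_sum v A \<omega> = (\<Sum>j\<in>A. v \<bullet> X j \<omega>)"

lemma proj_sum_measurable [measurable]: "proj_sum v A \<in> borel_measurable M"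
  unfolding proj_sum_def[abs_def] by measurable

lemma proj_sum_union: "finite A \<Longrightarrow> finite B \<Longrightarrow> A \<inter> B = {} \<Longrightarrow> proj_sum v (A \<union> B) \<omega> = proj_sum v A \<omega> + proj_sum v B \<omega>"
  by (simp add: proj_sum_def sum.union_disjoint)

definition \<gamma>_total :: "(real, 'n) vec \<Rightarrow> real" where
  "\<gamma>_total v = infsum (\<lambda>k. \<bar>\<gamma> v k\<bar>) UNIV"

lemma \<gamma>_total_nonneg: "\<gamma>_total v \<ge> 0"
  unfolding \<gamma>_total_def by (rule infsum_nonneg) simp

text \<open>Each of the \<open>card A\<close> rows of the covariance matrix of the summands has absolute sum at most \<open>\<gamma>_total v\<close>.\<close>
lemma proj_sum_square:
  assumes "finite A"
  shows "integrable M (\<lambda>\<omega>. (proj_sum v A \<omega>)\<^sup>2)" "expectation (\<lambda>\<omega>. (proj_sum v A \<omega>)\<^sup>2) \<le> \<gamma>_total v * card A"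
proof -
  have eq: "(proj_sum v A \<omega>)\<^sup>2 = (\<Sum>j\<in>A. \<Sum>k\<in>A. (v \<bullet> X j \<omega>) * (v \<bullet> X k \<omega>))" for \<omega>
    by (simp add: proj_sum_def power2_eq_square sum_product)
  show "integrable M (\<lambda>\<omega>. (proj_sum v A \<omega>)\<^sup>2)"
    unfolding eq by (intro Bochner_Integration.integrable_sum inner_product_integrable)
  have "expectation (\<lambda>\<omega>. (proj_sum v A \<omega>)\<^sup>2) = (\<Sum>j\<in>A. \<Sum>k\<in>A. \<gamma> v (k - j))"
    unfolding eq
    by (subst Bochner_Integration.integral_sum, intro Bochner_Integration.integrable_sum inner_product_integrable)
      (subst Bochner_Integration.integral_sum, intro inner_product_integrable, simp add: expectation_product_eq_\<gamma>)
  also have "\<dots> \<le> (\<Sum>j\<in>A. \<gamma>_total v)"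
  proof (rule sum_mono)
    fix j assume "j \<in> A"
    have "(\<Sum>k\<in>A. \<gamma> v (k - j)) \<le> (\<Sum>k\<in>A. \<bar>\<gamma> v (k - j)\<bar>)" by (rule sum_mono) simp
    also have "\<dots> = (\<Sum>l\<in>(\<lambda>k. k - j) ` A. \<bar>\<gamma> v l\<bar>)"
      by (subst sum.reindex) (auto simp: inj_on_def)
    also have "\<dots> \<le> \<gamma>_total v"
      unfolding \<gamma>_total_def using assms \<gamma>_abs_summable by (intro finite_sum_le_infsum) auto
    finally show "(\<Sum>k\<in>A. \<gamma> v (k - j)) \<le> \<gamma>_total v" .
  qed
  also have "\<dots> = \<gamma>_total v * card A" by simp
  finally show "expectation (\<lambda>\<omega>. (proj_sum v A \<omega>)\<^sup>2) \<le> \<gamma>_total v * card A" .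
qed

lemma proj_sum_abs:
  assumes "finite A"
  shows "integrable M (\<lambda>\<omega>. \<bar>proj_sum v A \<omega>\<bar>)" "expectation (\<lambda>\<omega>. \<bar>proj_sum v A \<omega>\<bar>) \<le> sqrt (\<gamma>_total v * card A)"
proof -
  show i: "integrable M (\<lambda>\<omega>. \<bar>proj_sum v A \<omega>\<bar>)"
    unfolding proj_sum_def by (intro integrable_abs Bochner_Integration.integrable_sum inner_integrable)
  have "(expectation (\<lambda>\<omega>. \<bar>proj_sum v A \<omega>\<bar>))\<^sup>2 \<le> expectation (\<lambda>\<omega>. (proj_sum v A \<omega>)\<^sup>2)"
    using variance_positive[of "\<lambda>\<omega>. \<bar>proj_sum v A \<omega>\<bar>"] variance_eq[OF i] proj_sum_square(1)[OF assms, of v] by simp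
  also note proj_sum_square(2)[OF assms, of v]
  finally show "expectation (\<lambda>\<omega>. \<bar>proj_sum v A \<omega>\<bar>) \<le> sqrt (\<gamma>_total v * card A)"
    by (rule real_le_rsqrt)
qed

lemma cmod_iexp_diff_le: "cmod (iexp x - iexp y) \<le> \<bar>x - y\<bar>"
proof -
  have "iexp x - iexp y = iexp y * (iexp (x - y) - 1)"
    by (simp add: right_diff_distrib exp_add[symmetric] algebra_simps)
  then have "cmod (iexp x - iexp y) = cmod (iexp (x - y) - 1)" by (simp add: norm_mult)
  also have "\<dots> \<le> \<bar>x - y\<bar>" using iexp_approx1[of "x - y" 0] by simp
  finally show ?thesis .
qed

text \<open>Remove the sites of \<open>F\<close> one after the other, always the one nearest to \<open>k\<close>, down to the empty set, where the centred
  variable has expectation zero. When \<open>p\<close> is removed, the phase changes by a function of sites at distance at least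
  \<open>supnorm (k - p)\<close> that is dominated by a multiple of \<open>norm (X p)\<close>, so \<open>far_covariance_bound\<close> applies to its real and
  imaginary parts.\<close>
lemma past_expectation_bound:
  obtains K where "K \<ge> 0"
    "\<And>s F k. finite F \<Longrightarrow> (\<And>p. p \<in> F \<Longrightarrow> lex_less p k) \<Longrightarrow>
      cmod (\<integral>\<omega>. iexp (s * proj_sum v F \<omega>) * complex_of_real (v \<bullet> X k \<omega>) \<partial>M) \<le> \<bar>s\<bar> * K * (\<Sum>p\<in>F. decay_weight (p - k))"
proof -
  obtain K1 where K1: "K1 \<ge> 0"
    "\<And>h j \<Gamma> p f c. \<lbrakk>h \<ge> 1; finite \<Gamma>; \<Gamma> \<subseteq> V_lex_dist j h; p \<in> \<Gamma>; f \<in> borel_measurable (Pi\<^sub>M \<Gamma> (\<lambda>_. borel));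
       c \<ge> 0; \<And>x. \<bar>f x\<bar> \<le> c * norm (x p)\<rbrakk>
     \<Longrightarrow> \<bar>expectation (\<lambda>\<omega>. f (\<lambda>t\<in>\<Gamma>. X t \<omega>) * (v \<bullet> X j \<omega>))\<bar> \<le> K1 * c * real h powr - \<beta>"
    by (rule far_covariance_bound[of v]) blast
  define K where "K = 2 * K1 * norm v"
  have int: "integrable M (\<lambda>\<omega>. iexp (s * proj_sum v F \<omega>) * complex_of_real (v \<bullet> X k \<omega>))" for s F k
  proof (rule Bochner_Integration.integrable_bound[OF inner_integrable[of v k]])
    show "AE \<omega> in M. norm (iexp (s * proj_sum v F \<omega>) * complex_of_real (v \<bullet> X k \<omega>)) \<le> norm (v \<bullet> X k \<omega>)"
      by (rule AE_I2) (simp add: norm_mult)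
  qed measurable
  show ?thesis
  proof (rule that)
    show "K \<ge> 0" using K1 by (simp add: K_def)
    fix s :: real and F and k :: "(int, 'm) vec"
    assume "finite F" "\<And>p. p \<in> F \<Longrightarrow> lex_less p k"
    then show "cmod (\<integral>\<omega>. iexp (s * proj_sum v F \<omega>) * complex_of_real (v \<bullet> X k \<omega>) \<partial>M) \<le> \<bar>s\<bar> * K * (\<Sum>p\<in>F. decay_weight (p - k))"
    proof (induction "card F" arbitrary: F)
      case 0
      then have "F = {}" by simp
      then show ?case using inner_centered[of v k] by (simp add: proj_sum_def)
    next
      case (Suc n)
      then have ne: "F \<noteq> {}" by auto
      obtain p where p: "p \<in> F" "\<And>t. t \<in> F \<Longrightarrow> supnorm (k - p) \<le> supnorm (k - t)"
        using arg_min_if_finite[OF \<open>finite F\<close> ne, of "\<lambda>t. supnorm (k - t)"] by (metis not_le)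
      let ?F = "F - {p}"
      let ?I = "\<lambda>F. \<integral>\<omega>. iexp (s * proj_sum v F \<omega>) * complex_of_real (v \<bullet> X k \<omega>) \<partial>M"
      have IH: "cmod (?I ?F) \<le> \<bar>s\<bar> * K * (\<Sum>p\<in>?F. decay_weight (p - k))"
        using Suc p by (intro Suc(1)) auto
      define h where "h = nat (supnorm (k - p))"
      have h: "int h = supnorm (k - p)" using supnorm_nonneg[of "k - p"] by (simp add: h_def)
      have "lex_less p k" using Suc.prems(2) p by blast
      then have "k - p \<noteq> 0" by auto
      then have h1: "h \<ge> 1" using h supnorm_eq_0_iff[of "k - p"] by (cases h) auto
      have wth: "decay_weight (p - k) = real h powr - \<beta>"
      proof -
        have "real_of_int (supnorm (p - k)) = real h"
          unfolding supnorm_diff_commute[of p k] h[symmetric] by simp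
        then show ?thesis using h1 by (simp add: decay_weight_def)
      qed
      define \<Psi> where "\<Psi> x = iexp (s * (\<Sum>t\<in>?F. v \<bullet> x t)) * (iexp (s * (v \<bullet> x p)) - 1)" for x :: "(int, 'm) vec \<Rightarrow> (real, 'n) vec"
      have \<Psi>m [measurable]: "\<Psi> \<in> borel_measurable (Pi\<^sub>M F (\<lambda>_. borel))"
        unfolding \<Psi>_def using p(1) by measurable
      have \<Psi>b: "cmod (\<Psi> x) \<le> (\<bar>s\<bar> * norm v) * norm (x p)" for x
      proof -
        have "cmod (\<Psi> x) = cmod (iexp (s * (v \<bullet> x p)) - iexp 0)" by (simp add: \<Psi>_def norm_mult)
        also have "\<dots> \<le> \<bar>s * (v \<bullet> x p) - 0\<bar>" by (rule cmod_iexp_diff_le)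
        also have "\<dots> \<le> \<bar>s\<bar> * (norm v * norm (x p))"
          unfolding diff_zero abs_mult by (intro mult_left_mono Cauchy_Schwarz_ineq2) auto
        finally show ?thesis by (simp add: mult.assoc)
      qed
      define \<Phi> where "\<Phi> \<omega> = \<Psi> (\<lambda>t\<in>F. X t \<omega>)" for \<omega>
      have [measurable]: "\<Phi> \<in> borel_measurable M" unfolding \<Phi>_def by measurable
      have sub: "F \<subseteq> V_lex_dist k h"
        using Suc.prems(2) p(2) by (auto simp: V_lex_dist_def V_lex_def h)
      have re: "\<bar>expectation (\<lambda>\<omega>. Re (\<Phi> \<omega>) * (v \<bullet> X k \<omega>))\<bar> \<le> K1 * (\<bar>s\<bar> * norm v) * real h powr - \<beta>"
        unfolding \<Phi>_def
        by (rule K1(2)[OF h1 \<open>finite F\<close> sub p(1), of "\<lambda>x. Re (\<Psi> x)"])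
          (use order_trans[OF abs_Re_le_cmod \<Psi>b] in auto)
      have im: "\<bar>expectation (\<lambda>\<omega>. Im (\<Phi> \<omega>) * (v \<bullet> X k \<omega>))\<bar> \<le> K1 * (\<bar>s\<bar> * norm v) * real h powr - \<beta>"
        unfolding \<Phi>_def
        by (rule K1(2)[OF h1 \<open>finite F\<close> sub p(1), of "\<lambda>x. Im (\<Psi> x)"])
          (use order_trans[OF abs_Im_le_cmod \<Psi>b] in auto)
      have sp: "proj_sum v F \<omega> = proj_sum v ?F \<omega> + v \<bullet> X p \<omega>" for \<omega>
        using p(1) \<open>finite F\<close> by (simp add: proj_sum_def sum.remove[of F p])
      have \<Phi>_eq: "\<Phi> \<omega> = iexp (s * proj_sum v F \<omega>) - iexp (s * proj_sum v ?F \<omega>)" for \<omega>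
      proof -
        have "(\<Sum>t\<in>?F. v \<bullet> (\<lambda>t\<in>F. X t \<omega>) t) = proj_sum v ?F \<omega>"
          unfolding proj_sum_def by (intro sum.cong) auto
        then show ?thesis
          unfolding \<Phi>_def \<Psi>_def sp using p(1)
          by (simp add: right_diff_distrib exp_add[symmetric] distrib_left)
      qed
      have ci: "integrable M (\<lambda>\<omega>. \<Phi> \<omega> * complex_of_real (v \<bullet> X k \<omega>))"
        unfolding \<Phi>_eq left_diff_distrib using int by (intro Bochner_Integration.integrable_diff)
      have diff: "?I F - ?I ?F = (\<integral>\<omega>. \<Phi> \<omega> * complex_of_real (v \<bullet> X k \<omega>) \<partial>M)"
        unfolding \<Phi>_eq left_diff_distrib using int by (subst Bochner_Integration.integral_diff) auto
      have "cmod (?I F - ?I ?F) \<le> \<bar>Re (?I F - ?I ?F)\<bar> + \<bar>Im (?I F - ?I ?F)\<bar>" by (rule cmod_le)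
      also have "Re (?I F - ?I ?F) = expectation (\<lambda>\<omega>. Re (\<Phi> \<omega>) * (v \<bullet> X k \<omega>))"
        unfolding diff integral_Re[OF ci, symmetric] by simp
      also have "Im (?I F - ?I ?F) = expectation (\<lambda>\<omega>. Im (\<Phi> \<omega>) * (v \<bullet> X k \<omega>))"
        unfolding diff integral_Im[OF ci, symmetric] by simp
      finally have "cmod (?I F - ?I ?F) \<le> \<bar>s\<bar> * K * decay_weight (p - k)"
        using re im unfolding wth K_def by (simp add: algebra_simps)
      then have "cmod (?I F) \<le> \<bar>s\<bar> * K * decay_weight (p - k) + \<bar>s\<bar> * K * (\<Sum>p\<in>?F. decay_weight (p - k))"
        using IH norm_triangle_sub[of "?I F" "?I ?F"] by linarith
      also have "\<dots> = \<bar>s\<bar> * K * (\<Sum>p\<in>F. decay_weight (p - k))"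
        using p(1) \<open>finite F\<close> by (simp add: sum.remove[of F p] distrib_left)
      finally show ?case .
    qed
  qed
qed

end

section \<open>Ergodic averages with slowly varying weights\<close>

context stationary_field
begin

text \<open>Since the weights vary slowly and few sites leave \<open>D N\<close> under a translation, replacing \<open>U\<close> by a shift of \<open>U\<close> does not change
  the limit, and neither does replacing it by an average of shifts. By the mean ergodic theorem some such average is
  small in \<open>L\<^sup>1\<close>.\<close>
lemma ergodic_weighted_average:
  fixes D :: "nat \<Rightarrow> (int, 'm) vec set" and \<theta> :: "nat \<Rightarrow> (int, 'm) vec \<Rightarrow> 'a \<Rightarrow> complex"
    and U :: "((int, 'm) vec \<Rightarrow> (real, 'n) vec) \<Rightarrow> real"
  assumes erg: "ergodic_field M X"
    and U [measurable]: "U \<in> borel_measurable (Pi\<^sub>M UNIV (\<lambda>_. borel))"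
    and Ui: "integrable M (\<lambda>\<omega>. U (\<lambda>t. X t \<omega>))" and mean: "expectation (\<lambda>\<omega>. U (\<lambda>t. X t \<omega>)) = 0"
    and fin: "\<And>N. finite (D N)"
    and bd: "(\<lambda>N. real (card (boundary (D N))) / real (card (D N))) \<longlonglongrightarrow> 0"
    and \<theta>m [measurable]: "\<And>N k. \<theta> N k \<in> borel_measurable M"
    and \<theta>b: "\<And>N k \<omega>. cmod (\<theta> N k \<omega>) \<le> C"
    and slow: "\<And>l \<epsilon>. \<epsilon> > 0 \<Longrightarrow> \<forall>\<^sub>F N in sequentially. \<forall>k. expectation (\<lambda>\<omega>. cmod (\<theta> N (k + l) \<omega> - \<theta> N k \<omega>)) \<le> \<epsilon>"
  shows "(\<lambda>N. (\<Sum>k\<in>D N. \<integral>\<omega>. \<theta> N k \<omega> * complex_of_real (U (\<lambda>t. X (t + k) \<omega>)) \<partial>M) / of_nat (card (D N))) \<longlonglongrightarrow> 0"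
proof -
  have C0: "C \<ge> 0" using order_trans[OF norm_ge_zero \<theta>b[of undefined undefined undefined]] .
  define I where "I f N k = (\<integral>\<omega>. \<theta> N k \<omega> * complex_of_real (f (\<lambda>t. X (t + k) \<omega>)) \<partial>M)"
    for f :: "((int, 'm) vec \<Rightarrow> (real, 'n) vec) \<Rightarrow> real" and N k
  define avg where "avg f N = (\<Sum>k\<in>D N. I f N k) / of_nat (card (D N))" for f N
  have Ii: "integrable M (\<lambda>\<omega>. \<theta> N k \<omega> * complex_of_real (f (\<lambda>t. X (t + j) \<omega>)))"
    if [measurable]: "f \<in> borel_measurable (Pi\<^sub>M UNIV (\<lambda>_. borel))" and i: "integrable M (\<lambda>\<omega>. f (\<lambda>t. X t \<omega>))" for f N k j
  proof (rule Bochner_Integration.integrable_bound)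
    show "integrable M (\<lambda>\<omega>. C * f (\<lambda>t. X (t + j) \<omega>))" using i integrable_shift[OF that(1)] by simp
    show "AE \<omega> in M. norm (\<theta> N k \<omega> * complex_of_real (f (\<lambda>t. X (t + j) \<omega>))) \<le> norm (C * f (\<lambda>t. X (t + j) \<omega>))"
      using \<theta>b C0 by (intro AE_I2) (simp add: norm_mult abs_mult mult_right_mono)
  qed measurable
  have Ib: "cmod (\<integral>\<omega>. \<theta> N k \<omega> * complex_of_real (f (\<lambda>t. X (t + j) \<omega>)) \<partial>M) \<le> C * expectation (\<lambda>\<omega>. \<bar>f (\<lambda>t. X t \<omega>)\<bar>)"
    if [measurable]: "f \<in> borel_measurable (Pi\<^sub>M UNIV (\<lambda>_. borel))" and i: "integrable M (\<lambda>\<omega>. f (\<lambda>t. X t \<omega>))" for f N k j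
  proof -
    have "cmod (\<integral>\<omega>. \<theta> N k \<omega> * complex_of_real (f (\<lambda>t. X (t + j) \<omega>)) \<partial>M)
      \<le> (\<integral>\<omega>. cmod (\<theta> N k \<omega> * complex_of_real (f (\<lambda>t. X (t + j) \<omega>))) \<partial>M)"
      by (rule integral_norm_bound)
    also have "\<dots> \<le> (\<integral>\<omega>. C * \<bar>f (\<lambda>t. X (t + j) \<omega>)\<bar> \<partial>M)"
    proof (rule integral_mono)
      show "integrable M (\<lambda>\<omega>. cmod (\<theta> N k \<omega> * complex_of_real (f (\<lambda>t. X (t + j) \<omega>))))"
        by (rule integrable_norm[OF Ii[OF that]])
      show "integrable M (\<lambda>\<omega>. C * \<bar>f (\<lambda>t. X (t + j) \<omega>)\<bar>)"
        using i integrable_shift[OF that(1)] by simp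
    qed (use \<theta>b in \<open>simp add: norm_mult mult_right_mono\<close>)
    also have "\<dots> = C * expectation (\<lambda>\<omega>. \<bar>f (\<lambda>t. X t \<omega>)\<bar>)"
      using integral_shift[of "\<lambda>x. \<bar>f x\<bar>" j] by simp
    finally show ?thesis .
  qed
  define u where "u j \<omega> = U (\<lambda>t. X (t + j) \<omega>)" for j \<omega>
  have [measurable]: "u j \<in> borel_measurable M" for j unfolding u_def by measurable
  have ui: "integrable M (u j)" for j unfolding u_def using Ui integrable_shift[OF U] by simp
  define m where "m = expectation (\<lambda>\<omega>. \<bar>u 0 \<omega>\<bar>)"
  have m0: "m \<ge> 0" by (simp add: m_def)
  define J where "J N k j = (\<integral>\<omega>. \<theta> N k \<omega> * complex_of_real (u j \<omega>) \<partial>M)" for N k j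
  have Jb: "cmod (J N k j) \<le> C * m" for N k j
    using Ib[OF U Ui, of N k j] by (simp add: J_def u_def m_def)
  (* The functions u j are uniformly integrable, having all the same law. *)
  define tl where "tl B = expectation (\<lambda>\<omega>. \<bar>u 0 \<omega>\<bar> * indicator {x. \<bar>x\<bar> > real B} (u 0 \<omega>))" for B :: nat
  have tl: "tl \<longlonglongrightarrow> 0"
  proof -
    have "tl \<longlonglongrightarrow> expectation (\<lambda>\<omega>. 0)"
      unfolding tl_def
    proof (rule integral_dominated_convergence[where w="\<lambda>\<omega>. \<bar>u 0 \<omega>\<bar>"])
      show "AE \<omega> in M. (\<lambda>B. \<bar>u 0 \<omega>\<bar> * indicator {x. \<bar>x\<bar> > real B} (u 0 \<omega>)) \<longlonglongrightarrow> 0"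
      proof (rule AE_I2)
        fix \<omega>
        obtain B0 where "\<bar>u 0 \<omega>\<bar> < real B0" using reals_Archimedean2 by blast
        then have "\<forall>\<^sub>F B in sequentially. \<bar>u 0 \<omega>\<bar> * indicator {x. \<bar>x\<bar> > real B} (u 0 \<omega>) = 0"
          by (intro eventually_sequentiallyI[of B0]) (auto simp: indicator_def)
        then show "(\<lambda>B. \<bar>u 0 \<omega>\<bar> * indicator {x. \<bar>x\<bar> > real B} (u 0 \<omega>)) \<longlonglongrightarrow> 0" by (rule tendsto_eventually)
      qed
      show "AE \<omega> in M. norm (\<bar>u 0 \<omega>\<bar> * indicator {x. \<bar>x\<bar> > real B} (u 0 \<omega>)) \<le> \<bar>u 0 \<omega>\<bar>" for B
        by (rule AE_I2) (simp add: indicator_def)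
    qed (use ui in auto)
    then show ?thesis by simp
  qed
  have tlj: "expectation (\<lambda>\<omega>. \<bar>u j \<omega>\<bar> * indicator {x. \<bar>x\<bar> > real B} (u j \<omega>)) = tl B" for j B
    unfolding tl_def u_def
    using integral_shift[of "\<lambda>x. \<bar>U x\<bar> * indicator {x. \<bar>x\<bar> > real B} (U x)" j] by simp
  have base: "(\<lambda>N. avg U N - avg (\<lambda>x. U (shift l x)) N) \<longlonglongrightarrow> 0" for l
  proof (rule LIMSEQ_I)
    fix r :: real assume r: "r > 0"
    have "\<forall>\<^sub>F B in sequentially. tl B < r / (6 * (C + 1))"
      using r C0 by (intro order_tendstoD[OF tl]) auto
    then obtain B where B: "tl B < r / (6 * (C + 1))" by (auto simp: eventually_sequentially)
    have "2 * C * tl B \<le> 2 * C * (r / (6 * (C + 1)))" using B C0 by (intro mult_left_mono) auto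
    also have "\<dots> \<le> r / 3" using r C0 by (simp add: field_simps)
    finally have B': "2 * C * tl B \<le> r / 3" .
    define e where "e = r / (6 * (real B + 1))"
    have e: "e > 0" using r by (simp add: e_def)
    have Be: "real B * e \<le> r / 6" using r by (simp add: e_def field_simps)
    define h where "h = nat (supnorm l)"
    have hl: "supnorm l \<le> int h" "supnorm (- l) \<le> int h" by (auto simp: h_def)
    define q where "q = r / (6 * (real h * C * m + 1))"
    have hCm: "real h * C * m \<ge> 0" using C0 m0 by simp
    have q: "q > 0" using r hCm by (simp add: q_def)
    have "q * (real h * C * m) \<le> r / 6"
      using r hCm by (simp add: q_def field_simps)
    then have hq: "2 * (real h * C * m) * q \<le> r / 3" by (simp add: mult.commute)
    have "\<forall>\<^sub>F N in sequentially. norm (avg U N - avg (\<lambda>x. U (shift l x)) N) < r"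
      using slow[OF e, of l] order_tendstoD(2)[OF bd q]
    proof eventually_elim
      case (elim N)
      let ?n = "real (card (D N))" and ?b = "real (card (boundary (D N)))"
      let ?D1 = "{k\<in>D N. k + l \<in> D N}" and ?E1 = "{k\<in>D N. k + l \<notin> D N}"
      let ?D2 = "{k\<in>D N. k + - l \<in> D N}" and ?E2 = "{k\<in>D N. k + - l \<notin> D N}"
      show ?case
      proof (cases "card (D N) = 0")
        case True
        then show ?thesis using r by (simp add: avg_def)
      next
        case False
        then have n: "?n > 0" by simp
        have I1: "I U N k = J N k k" for k by (simp add: I_def J_def u_def)
        have I2: "I (\<lambda>x. U (shift l x)) N k = J N k (k + l)" for k
          by (simp add: I_def J_def u_def shift_def add_ac)
        have split1: "(\<Sum>k\<in>D N. J N k k) = (\<Sum>k\<in>?D2. J N k k) + (\<Sum>k\<in>?E2. J N k k)"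
          using fin by (subst sum.union_disjoint[symmetric]) (auto intro!: sum.cong)
        have split2: "(\<Sum>k\<in>D N. J N k (k + l)) = (\<Sum>k\<in>?D1. J N k (k + l)) + (\<Sum>k\<in>?E1. J N k (k + l))"
          using fin by (subst sum.union_disjoint[symmetric]) (auto intro!: sum.cong)
        have im: "?D2 = (\<lambda>k. k + l) ` ?D1"
        proof (intro set_eqI iffI)
          fix k assume "k \<in> ?D2"
          then show "k \<in> (\<lambda>k. k + l) ` ?D1" by (intro image_eqI[of _ _ "k + - l"]) auto
        qed auto
        have re: "(\<Sum>k\<in>?D2. J N k k) = (\<Sum>k\<in>?D1. J N (k + l) (k + l))"
          unfolding im by (subst sum.reindex) (auto simp: inj_on_def)
        (* Summation by parts: on sites that stay in D N only the increment of the weights remains. *)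
        have diff: "(\<Sum>k\<in>D N. I U N k) - (\<Sum>k\<in>D N. I (\<lambda>x. U (shift l x)) N k)
          = (\<Sum>k\<in>?D1. J N (k + l) (k + l) - J N k (k + l)) + (\<Sum>k\<in>?E2. J N k k) - (\<Sum>k\<in>?E1. J N k (k + l))"
          unfolding I1 I2 split1 split2 re by (simp add: sum_subtractf)
        have Jd: "cmod (J N (k + l) (k + l) - J N k (k + l)) \<le> r / 2" for k
        proof -
          let ?d = "\<lambda>\<omega>. \<theta> N (k + l) \<omega> - \<theta> N k \<omega>"
          let ?ind = "\<lambda>\<omega>. indicator {x. \<bar>x\<bar> > real B} (u (k + l) \<omega>) :: real"
          have d2: "cmod (?d \<omega>) \<le> 2 * C" for \<omega>
            using norm_triangle_ineq4[of "\<theta> N (k + l) \<omega>" "\<theta> N k \<omega>"] \<theta>b[of N "k + l" \<omega>] \<theta>b[of N k \<omega>] by linarith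
          have i1: "integrable M (\<lambda>\<omega>. \<theta> N j \<omega> * complex_of_real (u (k + l) \<omega>))" for j
            using Ii[OF U Ui] by (simp add: u_def)
          have "J N (k + l) (k + l) - J N k (k + l) = (\<integral>\<omega>. ?d \<omega> * complex_of_real (u (k + l) \<omega>) \<partial>M)"
            unfolding J_def left_diff_distrib using i1 by (subst Bochner_Integration.integral_diff) auto
          also have "cmod \<dots> \<le> (\<integral>\<omega>. cmod (?d \<omega> * complex_of_real (u (k + l) \<omega>)) \<partial>M)"
            by (rule integral_norm_bound)
          also have "\<dots> \<le> (\<integral>\<omega>. real B * cmod (?d \<omega>) + 2 * C * (\<bar>u (k + l) \<omega>\<bar> * ?ind \<omega>) \<partial>M)"
          proof (rule integral_mono)
            show "integrable M (\<lambda>\<omega>. cmod (?d \<omega> * complex_of_real (u (k + l) \<omega>)))"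
              unfolding left_diff_distrib using i1 by (intro integrable_norm Bochner_Integration.integrable_diff)
            have "integrable M (\<lambda>\<omega>. cmod (?d \<omega>))"
              by (rule integrable_const_bound[of _ "2 * C"]) (use d2 in auto)
            moreover have "integrable M (\<lambda>\<omega>. \<bar>u (k + l) \<omega>\<bar> * ?ind \<omega>)"
              by (rule Bochner_Integration.integrable_bound[OF ui[of "k + l"]]) (auto simp: indicator_def)
            ultimately show "integrable M (\<lambda>\<omega>. real B * cmod (?d \<omega>) + 2 * C * (\<bar>u (k + l) \<omega>\<bar> * ?ind \<omega>))" by simp
            fix \<omega>
            show "cmod (?d \<omega> * complex_of_real (u (k + l) \<omega>)) \<le> real B * cmod (?d \<omega>) + 2 * C * (\<bar>u (k + l) \<omega>\<bar> * ?ind \<omega>)"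
            proof (cases "\<bar>u (k + l) \<omega>\<bar> > real B")
              case True
              have "cmod (?d \<omega>) * \<bar>u (k + l) \<omega>\<bar> \<le> 2 * C * \<bar>u (k + l) \<omega>\<bar>"
                using d2 by (intro mult_right_mono) auto
              moreover have "0 \<le> real B * cmod (?d \<omega>)" by simp
              ultimately show ?thesis using True by (simp add: norm_mult add_increasing)
            next
              case False
              then have "cmod (?d \<omega>) * \<bar>u (k + l) \<omega>\<bar> \<le> cmod (?d \<omega>) * real B"
                by (intro mult_left_mono) auto
              then show ?thesis using False by (simp add: norm_mult mult.commute)
            qed
          qed
          also have "\<dots> = real B * expectation (\<lambda>\<omega>. cmod (?d \<omega>)) + 2 * C * tl B"
          proof -
            have "integrable M (\<lambda>\<omega>. cmod (?d \<omega>))"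
              by (rule integrable_const_bound[of _ "2 * C"]) (use d2 in auto)
            moreover have "integrable M (\<lambda>\<omega>. \<bar>u (k + l) \<omega>\<bar> * ?ind \<omega>)"
              by (rule Bochner_Integration.integrable_bound[OF ui[of "k + l"]]) (auto simp: indicator_def)
            ultimately show ?thesis by (simp add: tlj)
          qed
          also have "\<dots> \<le> real B * e + 2 * C * tl B"
            using elim(1) by (intro add_right_mono mult_left_mono) auto
          finally show ?thesis using Be B' by linarith
        qed
        have c1: "cmod (\<Sum>k\<in>?D1. J N (k + l) (k + l) - J N k (k + l)) \<le> ?n * (r / 2)"
        proof -
          have "cmod (\<Sum>k\<in>?D1. J N (k + l) (k + l) - J N k (k + l)) \<le> real (card ?D1) * (r / 2)"
            by (rule sum_norm_bound) (rule Jd)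
          also have "\<dots> \<le> ?n * (r / 2)"
            using r fin by (intro mult_right_mono) (auto intro!: card_mono)
          finally show ?thesis .
        qed
        have c2: "cmod (\<Sum>k\<in>{k\<in>D N. k + w \<notin> D N}. J N k (f k)) \<le> real h * C * m * ?b"
          if "supnorm w \<le> int h" for w f
        proof -
          have "cmod (\<Sum>k\<in>{k\<in>D N. k + w \<notin> D N}. J N k (f k)) \<le> real (card {k\<in>D N. k + w \<notin> D N}) * (C * m)"
            by (rule sum_norm_bound) (rule Jb)
          also have "\<dots> \<le> real (h * card (boundary (D N))) * (C * m)"
            using card_exit_le[OF fin that] C0 m0 by (intro mult_right_mono) (simp_all only: of_nat_le_iff mult_nonneg_nonneg)
          finally show ?thesis by (simp add: mult_ac)
        qed
        have "cmod ((\<Sum>k\<in>D N. I U N k) - (\<Sum>k\<in>D N. I (\<lambda>x. U (shift l x)) N k)) \<le> ?n * (r / 2) + real h * C * m * ?b + real h * C * m * ?b"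
          unfolding diff using c1 c2[OF hl(2), of "\<lambda>k. k"] c2[OF hl(1), of "\<lambda>k. k + l"]
          by (intro order_trans[OF norm_triangle_ineq4] add_mono order_trans[OF norm_triangle_ineq]) auto
        then have "cmod ((\<Sum>k\<in>D N. I U N k) - (\<Sum>k\<in>D N. I (\<lambda>x. U (shift l x)) N k)) / ?n \<le> (?n * (r / 2) + real h * C * m * ?b + real h * C * m * ?b) / ?n"
          using n by (intro divide_right_mono) simp_all
        also have "\<dots> = r / 2 + 2 * (real h * C * m) * (?b / ?n)" using n by (simp add: add_divide_distrib)
        also have "\<dots> \<le> r / 2 + 2 * (real h * C * m) * q"
          using elim(2) hCm by (intro add_left_mono mult_left_mono) auto
        also have "\<dots> < r" using hq r by linarith
        finally show ?thesis
          by (simp add: avg_def diff_divide_distrib[symmetric] norm_divide)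
      qed
    qed
    then show "\<exists>no. \<forall>N\<ge>no. norm (avg U N - avg (\<lambda>x. U (shift l x)) N - 0) < r"
      by (simp add: eventually_sequentially)
  qed
  have hull: "integrable M (\<lambda>\<omega>. f (\<lambda>t. X t \<omega>)) \<and> (\<lambda>N. avg U N - avg f N) \<longlonglongrightarrow> 0" if "f \<in> shift_averages U" for f
    using that
  proof (induction rule: shift_averages.induct)
    case (shifted l)
    then show ?case using base[of l] integrable_shift[OF U, of l] Ui by (simp add: shift_def)
  next
    case (midpoint f g)
    note fm = shift_averages_measurable[OF U midpoint.hyps(1)] and gm = shift_averages_measurable[OF U midpoint.hyps(2)]
    have fi: "integrable M (\<lambda>\<omega>. f (\<lambda>t. X t \<omega>))" and gi: "integrable M (\<lambda>\<omega>. g (\<lambda>t. X t \<omega>))" using midpoint.IH by auto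
    have "I (\<lambda>x. (f x + g x) / 2) N k = (I f N k + I g N k) / 2" for N k
    proof -
      have "I (\<lambda>x. (f x + g x) / 2) N k = (\<integral>\<omega>. (\<theta> N k \<omega> * complex_of_real (f (\<lambda>t. X (t + k) \<omega>))
          + \<theta> N k \<omega> * complex_of_real (g (\<lambda>t. X (t + k) \<omega>))) / 2 \<partial>M)"
        unfolding I_def by (simp add: distrib_left)
      then show ?thesis unfolding I_def using Ii[OF fm fi] Ii[OF gm gi] by simp
    qed
    then have "avg (\<lambda>x. (f x + g x) / 2) N = (avg f N + avg g N) / 2" for N
      by (simp add: avg_def sum_divide_distrib[symmetric] sum.distrib add_divide_distrib mult.commute)
    then have eq: "avg U N - avg (\<lambda>x. (f x + g x) / 2) N = ((avg U N - avg f N) + (avg U N - avg g N)) / 2" for N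
      by (simp add: field_simps)
    have "(\<lambda>N. ((avg U N - avg f N) + (avg U N - avg g N)) / 2) \<longlonglongrightarrow> (0 + 0) / 2"
      using midpoint.IH by (intro tendsto_intros) auto
    then have "(\<lambda>N. avg U N - avg (\<lambda>x. (f x + g x) / 2) N) \<longlonglongrightarrow> 0"
      unfolding eq by simp
    then show ?case using fi gi by (intro conjI) simp_all
  qed
  have "avg U \<longlonglongrightarrow> 0"
  proof (rule LIMSEQ_I)
    fix r :: real assume r: "r > 0"
    obtain f where f: "f \<in> shift_averages U" "integrable M (\<lambda>\<omega>. f (\<lambda>t. X t \<omega>))"
      "expectation (\<lambda>\<omega>. \<bar>f (\<lambda>t. X t \<omega>)\<bar>) < r / (2 * (C + 1))"
      using ergodic_shift_average_small[OF erg U Ui mean, of "r / (2 * (C + 1))"] r C0 by auto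
    note fm = shift_averages_measurable[OF U f(1)]
    have "C * expectation (\<lambda>\<omega>. \<bar>f (\<lambda>t. X t \<omega>)\<bar>) \<le> C * (r / (2 * (C + 1)))"
      using f(3) C0 by (intro mult_left_mono) auto
    also have "\<dots> \<le> r / 2" using r C0 by (simp add: field_simps)
    finally have Cf: "C * expectation (\<lambda>\<omega>. \<bar>f (\<lambda>t. X t \<omega>)\<bar>) \<le> r / 2" .
    have avgf: "cmod (avg f N) \<le> r / 2" for N
    proof (cases "card (D N) = 0")
      case False
      have "cmod (\<Sum>k\<in>D N. I f N k) \<le> real (card (D N)) * (r / 2)"
        by (rule sum_norm_bound) (use order_trans[OF Ib[OF fm f(2)] Cf] in \<open>simp add: I_def\<close>)
      then show ?thesis using False by (simp add: avg_def norm_divide field_simps)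
    qed (use r in \<open>simp add: avg_def\<close>)
    obtain N0 where N0: "\<And>N. N \<ge> N0 \<Longrightarrow> norm (avg U N - avg f N - 0) < r / 2"
      using LIMSEQ_D[OF conjunct2[OF hull[OF f(1)]], of "r/2"] r by auto
    have "norm (avg U N - 0) < r" if "N \<ge> N0" for N
      using N0[OF that] avgf[of N] norm_triangle_sub[of "avg U N" "avg f N"] by simp
    then show "\<exists>no. \<forall>N\<ge>no. norm (avg U N - 0) < r" by blast
  qed
  then show ?thesis unfolding avg_def[abs_def] I_def .
qed

end

section \<open>Second-order expansion at a single site\<close>

lemma abs_exp_minus_bound:
  fixes a :: real
  assumes "\<bar>a\<bar> \<le> 1"
  shows "\<bar>exp (- a) - (1 - a)\<bar> \<le> a\<^sup>2"
proof -
  have lower: "1 - a \<le> exp (- a)" using exp_ge_add_one_self[of "- a"] by simp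
  have upper: "exp (- a) \<le> 1 - a + a\<^sup>2"
  proof (cases "a \<le> 0")
    case True
    then show ?thesis using exp_bound[of "- a"] assms by simp
  next
    case False
    then have "1 + a + a\<^sup>2 / 2 \<le> exp a" by (intro exp_lower_Taylor_quadratic) simp
    moreover have p: "1 - a + a\<^sup>2 \<ge> 0"
      using assms False by (simp add: add_nonneg_nonneg)
    ultimately have "(1 - a + a\<^sup>2) * (1 + a + a\<^sup>2 / 2) \<le> (1 - a + a\<^sup>2) * exp a" by (rule mult_left_mono)
    moreover have "(1 - a + a\<^sup>2) * (1 + a + a\<^sup>2 / 2) = 1 + a\<^sup>2 / 2 + a ^ 3 / 2 + a ^ 4 / 2"
      by (simp add: field_simps power2_eq_square power3_eq_cube power4_eq_xxxx)
    moreover have "a\<^sup>2 / 2 + a ^ 3 / 2 + a ^ 4 / 2 \<ge> 0" using False by simp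
    ultimately have "1 \<le> (1 - a + a\<^sup>2) * exp a" by linarith
    then have "exp (- a) * 1 \<le> exp (- a) * ((1 - a + a\<^sup>2) * exp a)" by (intro mult_left_mono) auto
    also have "\<dots> = 1 - a + a\<^sup>2" by (simp add: mult_ac exp_minus)
    finally show ?thesis by simp
  qed
  show ?thesis using lower upper by linarith
qed

lemma abs_exp_diff_le:
  fixes x y c :: real
  assumes "\<bar>x\<bar> \<le> c" "\<bar>y\<bar> \<le> c"
  shows "\<bar>exp x - exp y\<bar> \<le> exp c * \<bar>x - y\<bar>"
proof -
  have *: "exp v - exp u \<le> exp c * (v - u)" if "u \<le> v" "v \<le> c" for u v :: real
  proof -
    have "exp v - exp u = exp v * (1 - exp (- (v - u)))"
      by (simp add: right_diff_distrib exp_add[symmetric])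
    also have "\<dots> \<le> exp v * (v - u)"
      using exp_ge_add_one_self[of "u - v"] by (intro mult_left_mono) (simp_all add: algebra_simps)
    also have "\<dots> \<le> exp c * (v - u)" using that by (intro mult_right_mono) auto
    finally show ?thesis .
  qed
  show ?thesis
  proof (cases "x \<le> y")
    case True
    then show ?thesis using *[of x y] assms by simp
  next
    case False
    then show ?thesis using *[of y x] assms by simp
  qed
qed

lemma iexp_taylor1:
  assumes "\<bar>x\<bar> \<le> q"
  shows "cmod (iexp x - (1 + \<i> * x)) \<le> 2 * q * min 1 q"
proof -
  have q: "q \<ge> 0" using assms by linarith
  have "iexp x - (\<Sum>k \<le> 1. (\<i> * x)^k / fact k) = iexp x - (1 + \<i> * x)" by simp
  then have "cmod (iexp x - (1 + \<i> * x)) \<le> \<bar>x\<bar>^2 / 2" "cmod (iexp x - (1 + \<i> * x)) \<le> 2 * \<bar>x\<bar>"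
    using iexp_approx1[of x 1] iexp_approx2[of x 1] by (simp_all add: numeral_2_eq_2)
  moreover have "\<bar>x\<bar>^2 \<le> q^2" using assms by (intro power_mono) auto
  moreover have "q^2 / 2 \<le> 2 * q * q" using q by (simp add: power2_eq_square)
  ultimately show ?thesis using assms by (auto simp: min_def)
qed

lemma iexp_taylor2:
  assumes "\<bar>x\<bar> \<le> q"
  shows "cmod (iexp x - (1 + \<i> * x - x\<^sup>2 / 2)) \<le> q\<^sup>2 * min 1 q"
proof -
  have q: "q \<ge> 0" using assms by linarith
  have "(\<Sum>k \<le> 2. (\<i> * complex_of_real x)^k / fact k) = 1 + \<i> * x - x\<^sup>2 / 2"
    by (simp add: numeral_2_eq_2 mult_ac)
  then have "cmod (iexp x - (1 + \<i> * x - x\<^sup>2 / 2)) \<le> \<bar>x\<bar>^3 / fact 3" "cmod (iexp x - (1 + \<i> * x - x\<^sup>2 / 2)) \<le> 2 * \<bar>x\<bar>^2 / fact 2"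
    using iexp_approx1[of x 2] iexp_approx2[of x 2] by (simp_all add: numeral_3_eq_3)
  moreover have "\<bar>x\<bar>^2 \<le> q^2" "\<bar>x\<bar>^3 \<le> q^3" by (rule power_mono[OF assms abs_ge_zero])+
  moreover have "\<bar>x\<bar>^3 / fact 3 \<le> \<bar>x\<bar>^3" by (simp add: fact_numeral)
  moreover have "q^3 = q\<^sup>2 * q" by (simp add: power3_eq_cube power2_eq_square)
  moreover have "2 * \<bar>x\<bar>^2 / fact 2 = \<bar>x\<bar>^2" by simp
  ultimately show ?thesis by (auto simp: min_def)
qed

text \<open>Think of \<open>y\<close> as the summand at the current site, of \<open>b\<close> as the sum over its near past and of \<open>zF\<close> as the phase of its far past.
  In the first-order term the phase of the whole past is expanded around that of the far past; this produces the mixed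
  term \<open>2 * y * b\<close>. All second-order terms keep the phase of the whole past.\<close>
lemma lindeberg_step:
  fixes y b T s a \<tau> :: real and zF :: complex
  assumes y: "\<bar>y\<bar> \<le> T" and b: "\<bar>b\<bar> \<le> T" and s: "s \<ge> 0" and a: "a = s\<^sup>2 * \<tau> / 2" "\<bar>a\<bar> \<le> 1" and zF: "cmod zF = 1"
  shows "cmod (zF * iexp (s * b) * (iexp (s * y) - complex_of_real (exp (- a)))
      - (\<i> * s * (zF * y) - (s\<^sup>2 / 2) * (zF * iexp (s * b) * (y\<^sup>2 + 2 * y * b - \<tau>))))
    \<le> 3 * (s\<^sup>2 * (T\<^sup>2 * min 1 (s * T))) + a\<^sup>2"
proof -
  define z where "z = zF * iexp (s * b)"
  have z1: "cmod z = 1" by (simp add: z_def zF norm_mult)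
  (* The far phase is expanded around the whole phase, so that z multiplies every other term. *)
  have zF_eq: "zF = z * iexp (- (s * b))"
    by (simp add: z_def mult.assoc exp_add[symmetric])
  define q where "q = s * T"
  define R1 where "R1 = iexp (s * y) - (1 + \<i> * (s * y) - (s * y)\<^sup>2 / 2)"
  define R2 where "R2 = iexp (- (s * b)) - (1 + \<i> * (- (s * b)))"
  define R3 where "R3 = exp (- a) - (1 - a)"
  have sy: "\<bar>s * y\<bar> \<le> q" and sb: "\<bar>- (s * b)\<bar> \<le> q"
    using y b s by (auto simp: q_def abs_mult mult_left_mono)
  have q0: "q \<ge> 0" using sy by linarith
  have r1: "cmod R1 \<le> q\<^sup>2 * min 1 q" unfolding R1_def by (rule iexp_taylor2[OF sy])
  have r2: "cmod R2 \<le> 2 * q * min 1 q" unfolding R2_def by (rule iexp_taylor1[OF sb])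
  have r3: "\<bar>R3\<bar> \<le> a\<^sup>2" unfolding R3_def by (rule abs_exp_minus_bound[OF a(2)])
  have e1: "iexp (s * y) = 1 + \<i> * (s * y) - (s * y)\<^sup>2 / 2 + R1" by (simp add: R1_def)
  have e2: "iexp (- (s * b)) = 1 + \<i> * (- (s * b)) + R2" by (simp add: R2_def)
  have e3: "complex_of_real (exp (- a)) = 1 - a + R3" by (simp add: R3_def)
  have ii: "\<i> * (\<i> * w) = - w" for w by (simp add: mult.assoc[symmetric])
  have "z * (iexp (s * y) - complex_of_real (exp (- a))) - (\<i> * s * (zF * y) - (s\<^sup>2 / 2) * (z * (y\<^sup>2 + 2 * y * b - \<tau>)))
    = z * R1 - z * R3 - \<i> * (s * y) * (z * R2)"
    unfolding zF_eq e1 e2 e3 unfolding a(1)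
    by (simp add: algebra_simps power2_eq_square ii)
  also have "cmod \<dots> \<le> cmod (z * R1) + cmod (z * R3) + cmod (\<i> * (s * y) * (z * R2))"
    using norm_triangle_ineq4[of "z * R1 - z * R3" "\<i> * (s * y) * (z * R2)"] norm_triangle_ineq4[of "z * R1" "z * R3"] by linarith
  also have "\<dots> = cmod R1 + \<bar>R3\<bar> + \<bar>s * y\<bar> * cmod R2"
    by (simp add: norm_mult z1 abs_mult)
  also have "\<dots> \<le> q\<^sup>2 * min 1 q + a\<^sup>2 + q * (2 * q * min 1 q)"
    using r1 r2 r3 sy q0 by (intro add_mono mult_mono) auto
  also have "\<dots> = 3 * (q\<^sup>2 * min 1 q) + a\<^sup>2" by (simp add: power2_eq_square)
  also have "q\<^sup>2 * min 1 q = s\<^sup>2 * (T\<^sup>2 * min 1 (s * T))" by (simp add: q_def power_mult_distrib)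
  finally show ?thesis by (simp add: z_def)
qed

context theta_field
begin

definition sup_ball :: "nat \<Rightarrow> (int, 'm) vec set" where "sup_ball R = {l. supnorm l < int R}"

lemma finite_sup_ball [simp]: "finite (sup_ball R)" by (simp add: sup_ball_def finite_supnorm_less)

definition \<sigma>2 :: "(real, 'n) vec \<Rightarrow> real" where "\<sigma>2 v = infsum (\<gamma> v) UNIV"

definition \<sigma>2_box :: "(real, 'n) vec \<Rightarrow> nat \<Rightarrow> real" where "\<sigma>2_box v R = (\<Sum>l\<in>sup_ball R. \<gamma> v l)"

lemma \<sigma>2_box_tendsto: "\<sigma>2_box v \<longlonglongrightarrow> \<sigma>2 v"
proof -
  have "(sum (\<gamma> v) \<longlongrightarrow> \<sigma>2 v) (finite_subsets_at_top UNIV)"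
    unfolding \<sigma>2_def using has_sum_infsum[OF \<gamma>_summable[of v]] by (simp add: has_sum_def)
  then show ?thesis
    unfolding \<sigma>2_box_def[abs_def] sup_ball_def by (rule filterlim_compose[OF _ filterlim_supnorm_less])
qed

definition abs_ball_sum :: "(real, 'n) vec \<Rightarrow> nat \<Rightarrow> ((int, 'm) vec \<Rightarrow> (real, 'n) vec) \<Rightarrow> real" where
  "abs_ball_sum v R x = (\<Sum>l\<in>sup_ball R. \<bar>v \<bullet> x l\<bar>)"

text \<open>The square of the summand at the origin together with its products with the near past, each counted twice because the
  later site of each pair is the one at which the pair is collected.\<close>
definition local_square :: "(real, 'n) vec \<Rightarrow> nat \<Rightarrow> ((int, 'm) vec \<Rightarrow> (real, 'n) vec) \<Rightarrow> real" where
  "local_square v R x = (v \<bullet> x 0)\<^sup>2 + 2 * (v \<bullet> x 0) * (\<Sum>l\<in>{l\<in>sup_ball R. lex_less l 0}. v \<bullet> x l)"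

lemma abs_ball_sum_measurable [measurable]: "abs_ball_sum v R \<in> borel_measurable (Pi\<^sub>M UNIV (\<lambda>_. borel))"
  unfolding abs_ball_sum_def[abs_def] by measurable

lemma local_square_measurable [measurable]: "local_square v R \<in> borel_measurable (Pi\<^sub>M UNIV (\<lambda>_. borel))"
  unfolding local_square_def[abs_def] by measurable

lemma abs_ball_sum_nonneg: "abs_ball_sum v R x \<ge> 0"
  unfolding abs_ball_sum_def by (rule sum_nonneg) simp

lemma abs_ball_sum_square_integrable: "integrable M (\<lambda>\<omega>. (abs_ball_sum v R (\<lambda>t. X t \<omega>))\<^sup>2)"
proof -
  have eq: "(abs_ball_sum v R (\<lambda>t. X t \<omega>))\<^sup>2 = (\<Sum>j\<in>sup_ball R. \<Sum>k\<in>sup_ball R. \<bar>(v \<bullet> X j \<omega>) * (v \<bullet> X k \<omega>)\<bar>)" for \<omega>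
    by (simp add: abs_ball_sum_def power2_eq_square sum_product abs_mult)
  show ?thesis
    unfolding eq by (intro Bochner_Integration.integrable_sum integrable_abs inner_product_integrable)
qed

lemma local_square_eq_sum:
  "local_square v R x = (v \<bullet> x 0) * (v \<bullet> x 0) + 2 * (\<Sum>l\<in>{l\<in>sup_ball R. lex_less l 0}. (v \<bullet> x 0) * (v \<bullet> x l))"
  by (simp add: local_square_def power2_eq_square sum_distrib_left mult.assoc)

lemma local_square_integrable: "integrable M (\<lambda>\<omega>. local_square v R (\<lambda>t. X t \<omega>))"
  unfolding local_square_eq_sum
  by (intro Bochner_Integration.integrable_add integrable_mult_right Bochner_Integration.integrable_sum inner_product_integrable)

lemma expectation_local_square:
  assumes "R \<ge> 1"
  shows "expectation (\<lambda>\<omega>. local_square v R (\<lambda>t. X t \<omega>)) = \<sigma>2_box v R"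
proof -
  let ?N = "{l\<in>sup_ball R. lex_less l 0}" and ?P = "{l\<in>sup_ball R. lex_less 0 l}"
  have "expectation (\<lambda>\<omega>. local_square v R (\<lambda>t. X t \<omega>)) = \<gamma> v 0 + 2 * (\<Sum>l\<in>?N. \<gamma> v l)"
    unfolding local_square_eq_sum \<gamma>_def
    by (simp add: inner_product_integrable Bochner_Integration.integrable_sum Bochner_Integration.integral_sum)
  moreover have "(\<Sum>l\<in>?P. \<gamma> v l) = (\<Sum>l\<in>?N. \<gamma> v l)"
  proof (rule sum.reindex_bij_witness[of _ uminus uminus])
    fix l :: "(int, 'm) vec"
    have m: "lex_less (- l) 0 \<longleftrightarrow> lex_less 0 l" "lex_less 0 (- l) \<longleftrightarrow> lex_less l 0" by (auto simp: lex_less_def)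
    show "l \<in> ?P \<Longrightarrow> - l \<in> ?N" "l \<in> ?N \<Longrightarrow> - l \<in> ?P" using m by (auto simp: sup_ball_def)
  qed (auto simp: \<gamma>_minus)
  moreover have "sup_ball R = insert 0 (?N \<union> ?P)"
  proof -
    have "supnorm (0 :: (int, 'm) vec) = 0" by (rule supnorm_eq_0_iff[THEN iffD2, OF refl])
    then have "0 \<in> sup_ball R" using assms unfolding sup_ball_def mem_Collect_eq by linarith
    then show ?thesis using lex_less_linear[of _ "0 :: (int, 'm) vec"] by blast
  qed
  then have "\<sigma>2_box v R = (\<Sum>l\<in>insert 0 (?N \<union> ?P). \<gamma> v l)" by (simp add: \<sigma>2_box_def)
  moreover have "\<dots> = \<gamma> v 0 + ((\<Sum>l\<in>?N. \<gamma> v l) + (\<Sum>l\<in>?P. \<gamma> v l))"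
  proof -
    have "?N \<inter> ?P = {}" using lex_less_trans lex_less_irrefl by blast
    then show ?thesis by (subst sum.insert, simp, simp) (subst sum.union_disjoint, auto)
  qed
  ultimately show ?thesis by simp
qed

text \<open>By stationarity this one expectation bounds, up to a factor, the Taylor remainder at every site.\<close>
definition lindeberg_rest :: "(real, 'n) vec \<Rightarrow> nat \<Rightarrow> real \<Rightarrow> real" where
  "lindeberg_rest v R s = expectation (\<lambda>\<omega>. (abs_ball_sum v R (\<lambda>t. X t \<omega>))\<^sup>2 * min 1 (s * abs_ball_sum v R (\<lambda>t. X t \<omega>)))"

lemma lindeberg_rest_integrable:
  "s \<ge> 0 \<Longrightarrow> integrable M (\<lambda>\<omega>. (abs_ball_sum v R (\<lambda>t. X t \<omega>))\<^sup>2 * min 1 (s * abs_ball_sum v R (\<lambda>t. X t \<omega>)))"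
  by (rule Bochner_Integration.integrable_bound[OF abs_ball_sum_square_integrable[of v R]])
    (auto simp: abs_mult abs_ball_sum_nonneg intro!: AE_I2 mult_left_le)

lemma lindeberg_rest_tendsto:
  assumes "s \<longlonglongrightarrow> 0" "\<And>N. s N \<ge> 0"
  shows "(\<lambda>N. lindeberg_rest v R (s N)) \<longlonglongrightarrow> 0"
proof -
  have "(\<lambda>N. lindeberg_rest v R (s N)) \<longlonglongrightarrow> expectation (\<lambda>\<omega>. 0)"
    unfolding lindeberg_rest_def
  proof (rule integral_dominated_convergence[where w="\<lambda>\<omega>. (abs_ball_sum v R (\<lambda>t. X t \<omega>))\<^sup>2"])
    show "AE \<omega> in M. (\<lambda>N. (abs_ball_sum v R (\<lambda>t. X t \<omega>))\<^sup>2 * min 1 (s N * abs_ball_sum v R (\<lambda>t. X t \<omega>))) \<longlonglongrightarrow> 0"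
    proof (rule AE_I2)
      fix \<omega>
      have "(\<lambda>N. (abs_ball_sum v R (\<lambda>t. X t \<omega>))\<^sup>2 * min 1 (s N * abs_ball_sum v R (\<lambda>t. X t \<omega>)))
        \<longlonglongrightarrow> (abs_ball_sum v R (\<lambda>t. X t \<omega>))\<^sup>2 * min 1 (0 * abs_ball_sum v R (\<lambda>t. X t \<omega>))"
        by (intro tendsto_intros assms)
      then show "(\<lambda>N. (abs_ball_sum v R (\<lambda>t. X t \<omega>))\<^sup>2 * min 1 (s N * abs_ball_sum v R (\<lambda>t. X t \<omega>))) \<longlonglongrightarrow> 0" by simp
    qed
    show "AE \<omega> in M. norm ((abs_ball_sum v R (\<lambda>t. X t \<omega>))\<^sup>2 * min 1 (s N * abs_ball_sum v R (\<lambda>t. X t \<omega>))) \<le> (abs_ball_sum v R (\<lambda>t. X t \<omega>))\<^sup>2" for N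
      using assms(2) by (intro AE_I2) (auto simp: abs_mult abs_ball_sum_nonneg intro!: mult_left_le)
  qed (use abs_ball_sum_square_integrable in auto)
  then show ?thesis by simp
qed

text \<open>Three errors arise when one site is added: the covariance with the phase of the far past, the Taylor remainders, and the
  replacement of the near past inside \<open>D\<close> by the whole near past, which matters only for sites close to the boundary.\<close>
lemma single_site_estimate:
  fixes D :: "(int, 'm) vec set" and k :: "(int, 'm) vec"
  assumes K: "\<And>s F k. finite F \<Longrightarrow> (\<And>p. p \<in> F \<Longrightarrow> lex_less p k) \<Longrightarrow>
      cmod (\<integral>\<omega>. iexp (s * proj_sum v F \<omega>) * complex_of_real (v \<bullet> X k \<omega>) \<partial>M) \<le> \<bar>s\<bar> * K * (\<Sum>p\<in>F. decay_weight (p - k))"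
    and K0: "K \<ge> 0"
    and tail: "\<And>F. finite F \<Longrightarrow> (\<And>t. t \<in> F \<Longrightarrow> int R \<le> supnorm t) \<Longrightarrow> sum decay_weight F \<le> \<tau>"
    and D: "finite D" and R: "R \<ge> 1" and s: "s \<ge> 0" and a: "a = s\<^sup>2 * \<sigma>2 v / 2" "\<bar>a\<bar> \<le> 1"
  defines "P \<equiv> {j\<in>D. lex_less j k}"
  defines "z \<equiv> \<lambda>\<omega>. iexp (s * proj_sum v P \<omega>)"
  shows "cmod ((\<integral>\<omega>. z \<omega> * (iexp (s * (v \<bullet> X k \<omega>)) - complex_of_real (exp (- a))) \<partial>M)
      + (s\<^sup>2 / 2) * (\<integral>\<omega>. z \<omega> * complex_of_real (local_square v R (\<lambda>t. X (t + k) \<omega>) - \<sigma>2_box v R) \<partial>M))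
    \<le> s\<^sup>2 * (K * \<tau>) + 3 * (s\<^sup>2 * lindeberg_rest v R s) + a\<^sup>2
      + (s\<^sup>2 / 2) * (\<bar>\<sigma>2_box v R - \<sigma>2 v\<bar>
          + 4 * expectation (\<lambda>\<omega>. (abs_ball_sum v R (\<lambda>t. X t \<omega>))\<^sup>2) * (if \<exists>l\<in>sup_ball R. k + l \<notin> D then 1 else 0))"
proof -
  define F where "F = {j\<in>P. supnorm (j - k) \<ge> int R}"
  define Q where "Q = {j\<in>P. supnorm (j - k) < int R}"
  have fin: "finite P" "finite F" "finite Q" using D by (auto simp: P_def F_def Q_def)
  have PFQ: "P = F \<union> Q" "F \<inter> Q = {}" by (auto simp: F_def Q_def)
  define y where "y \<omega> = v \<bullet> X k \<omega>" for \<omega>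
  define b where "b \<omega> = proj_sum v Q \<omega>" for \<omega>
  define zF where "zF \<omega> = iexp (s * proj_sum v F \<omega>)" for \<omega>
  define T where "T \<omega> = abs_ball_sum v R (\<lambda>t. X (t + k) \<omega>)" for \<omega>
  define W where "W \<omega> = local_square v R (\<lambda>t. X (t + k) \<omega>)" for \<omega>
  define c where "c \<omega> = (\<Sum>l\<in>{l\<in>sup_ball R. lex_less l 0}. v \<bullet> X (l + k) \<omega>)" for \<omega>
  have [measurable]: "y \<in> borel_measurable M" "b \<in> borel_measurable M" "zF \<in> borel_measurable M"
      "T \<in> borel_measurable M" "W \<in> borel_measurable M" "c \<in> borel_measurable M" "z \<in> borel_measurable M"
    unfolding y_def b_def[abs_def] zF_def T_def W_def c_def z_def by measurable
  have z_eq: "z \<omega> = zF \<omega> * iexp (s * b \<omega>)" for \<omega>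
    unfolding z_def zF_def b_def using fin PFQ by (simp add: proj_sum_union exp_add[symmetric] distrib_left)
  have zFn: "cmod (zF \<omega>) = 1" and zn: "cmod (z \<omega>) = 1" for \<omega> by (simp_all add: zF_def z_def)
  have zero_box: "0 \<in> sup_ball R"
  proof -
    have "supnorm (0 :: (int, 'm) vec) = 0" by (rule supnorm_eq_0_iff[THEN iffD2, OF refl])
    then show ?thesis using R unfolding sup_ball_def mem_Collect_eq by linarith
  qed
  have T0: "T \<omega> \<ge> 0" for \<omega> by (simp add: T_def abs_ball_sum_nonneg)
  have sub_T: "\<bar>\<Sum>l\<in>L. v \<bullet> X (l + k) \<omega>\<bar> \<le> T \<omega>" if "L \<subseteq> sup_ball R" for L \<omega>
  proof -
    have "\<bar>\<Sum>l\<in>L. v \<bullet> X (l + k) \<omega>\<bar> \<le> (\<Sum>l\<in>L. \<bar>v \<bullet> X (l + k) \<omega>\<bar>)" by (rule sum_abs)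
    also have "\<dots> \<le> (\<Sum>l\<in>sup_ball R. \<bar>v \<bullet> X (l + k) \<omega>\<bar>)" using that by (intro sum_mono2) auto
    finally show ?thesis by (simp add: T_def abs_ball_sum_def)
  qed
  have yT: "\<bar>y \<omega>\<bar> \<le> T \<omega>" for \<omega> using sub_T[of "{0}" \<omega>] zero_box by (simp add: y_def)
  have Q_im: "b \<omega> = (\<Sum>l\<in>(\<lambda>j. j - k) ` Q. v \<bullet> X (l + k) \<omega>)" for \<omega>
    unfolding b_def proj_sum_def by (subst sum.reindex) (auto simp: inj_on_def)
  have bT: "\<bar>b \<omega>\<bar> \<le> T \<omega>" for \<omega>
    unfolding Q_im by (rule sub_T) (auto simp: Q_def sup_ball_def)
  have cT: "\<bar>c \<omega>\<bar> \<le> T \<omega>" for \<omega>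
    unfolding c_def by (rule sub_T) auto
  have W_eq: "W \<omega> = (y \<omega>)\<^sup>2 + 2 * y \<omega> * c \<omega>" for \<omega>
    by (simp add: W_def local_square_def y_def c_def)
  have T2i: "integrable M (\<lambda>\<omega>. (T \<omega>)\<^sup>2)"
    unfolding T_def using integrable_shift[of "\<lambda>x. (abs_ball_sum v R x)\<^sup>2" k] abs_ball_sum_square_integrable by simp
  have T2e: "expectation (\<lambda>\<omega>. (T \<omega>)\<^sup>2) = expectation (\<lambda>\<omega>. (abs_ball_sum v R (\<lambda>t. X t \<omega>))\<^sup>2)"
    unfolding T_def using integral_shift[of "\<lambda>x. (abs_ball_sum v R x)\<^sup>2" k] by simp
  have Li: "integrable M (\<lambda>\<omega>. (T \<omega>)\<^sup>2 * min 1 (s * T \<omega>))"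
    unfolding T_def using integrable_shift[of "\<lambda>x. (abs_ball_sum v R x)\<^sup>2 * min 1 (s * abs_ball_sum v R x)" k] lindeberg_rest_integrable[OF s] by simp
  have Le: "expectation (\<lambda>\<omega>. (T \<omega>)\<^sup>2 * min 1 (s * T \<omega>)) = lindeberg_rest v R s"
    unfolding T_def lindeberg_rest_def using integral_shift[of "\<lambda>x. (abs_ball_sum v R x)\<^sup>2 * min 1 (s * abs_ball_sum v R x)" k] by simp
  have prodT: "\<bar>u * w\<bar> \<le> (T \<omega>)\<^sup>2" if "\<bar>u\<bar> \<le> T \<omega>" "\<bar>w\<bar> \<le> T \<omega>" for u w \<omega>
    unfolding abs_mult power2_eq_square using that T0 by (intro mult_mono) auto
  have i_prod: "integrable M (\<lambda>\<omega>. z \<omega> * complex_of_real (g \<omega>))"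
    if [measurable]: "g \<in> borel_measurable M" and gb: "\<And>\<omega>. \<bar>g \<omega>\<bar> \<le> B * (T \<omega>)\<^sup>2 + B'" for g B B'
  proof (rule Bochner_Integration.integrable_bound)
    show "integrable M (\<lambda>\<omega>. B * (T \<omega>)\<^sup>2 + B')" using T2i by simp
    show "AE \<omega> in M. norm (z \<omega> * complex_of_real (g \<omega>)) \<le> norm (B * (T \<omega>)\<^sup>2 + B')"
      using gb by (intro AE_I2) (simp add: norm_mult zn order_trans[OF gb abs_ge_self])
  qed measurable
  define WD where "WD \<omega> = (y \<omega>)\<^sup>2 + 2 * y \<omega> * b \<omega> - \<sigma>2 v" for \<omega>
  have WDb: "\<bar>WD \<omega>\<bar> \<le> 3 * (T \<omega>)\<^sup>2 + \<bar>\<sigma>2 v\<bar>" for \<omega>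
    using prodT[OF yT yT, of \<omega>] prodT[OF yT bT, of \<omega>] unfolding WD_def power2_eq_square by linarith
  have Wb: "\<bar>W \<omega> - \<sigma>2_box v R\<bar> \<le> 3 * (T \<omega>)\<^sup>2 + \<bar>\<sigma>2_box v R\<bar>" for \<omega>
    using prodT[OF yT yT, of \<omega>] prodT[OF yT cT, of \<omega>] unfolding W_eq power2_eq_square by linarith
  have [measurable]: "WD \<in> borel_measurable M" unfolding WD_def by measurable
  have iWD: "integrable M (\<lambda>\<omega>. z \<omega> * complex_of_real (WD \<omega>))" by (rule i_prod[OF _ WDb]) measurable
  have iW: "integrable M (\<lambda>\<omega>. z \<omega> * complex_of_real (W \<omega> - \<sigma>2_box v R))" by (rule i_prod[OF _ Wb]) measurable
  have iF: "integrable M (\<lambda>\<omega>. zF \<omega> * complex_of_real (y \<omega>))"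
  proof (rule Bochner_Integration.integrable_bound[OF inner_integrable[of v k]])
    show "AE \<omega> in M. norm (zF \<omega> * complex_of_real (y \<omega>)) \<le> norm (v \<bullet> X k \<omega>)"
      by (intro AE_I2) (simp add: norm_mult zFn y_def)
  qed measurable
  let ?A = "\<lambda>\<omega>. z \<omega> * (iexp (s * y \<omega>) - complex_of_real (exp (- a)))"
  have iA: "integrable M ?A"
  proof (rule integrable_const_bound[of _ "1 + exp (- a)"])
    show "AE \<omega> in M. norm (?A \<omega>) \<le> 1 + exp (- a)"
    proof (rule AE_I2)
      fix \<omega>
      have "norm (?A \<omega>) = cmod (iexp (s * y \<omega>) - complex_of_real (exp (- a)))" by (simp add: norm_mult zn)
      also have "\<dots> \<le> cmod (iexp (s * y \<omega>)) + cmod (complex_of_real (exp (- a)))" by (rule norm_triangle_ineq4)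
      also have "\<dots> = 1 + exp (- a)" by (simp only: norm_exp_i_times norm_of_real abs_exp_cancel)
      finally show "norm (?A \<omega>) \<le> 1 + exp (- a)" .
    qed
  qed measurable
  let ?E = "\<lambda>\<omega>. ?A \<omega> - (\<i> * s * (zF \<omega> * y \<omega>) - (s\<^sup>2 / 2) * (z \<omega> * WD \<omega>))"
  have E1: "cmod (\<integral>\<omega>. ?E \<omega> \<partial>M) \<le> 3 * (s\<^sup>2 * lindeberg_rest v R s) + a\<^sup>2"
  proof -
    have "cmod (\<integral>\<omega>. ?E \<omega> \<partial>M) \<le> (\<integral>\<omega>. cmod (?E \<omega>) \<partial>M)" by (rule integral_norm_bound)
    also have "\<dots> \<le> (\<integral>\<omega>. 3 * (s\<^sup>2 * ((T \<omega>)\<^sup>2 * min 1 (s * T \<omega>))) + a\<^sup>2 \<partial>M)"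
    proof (rule integral_mono)
      show "integrable M (\<lambda>\<omega>. cmod (?E \<omega>))"
        using iA iF iWD by (intro integrable_norm Bochner_Integration.integrable_diff integrable_mult_right) auto
      show "integrable M (\<lambda>\<omega>. 3 * (s\<^sup>2 * ((T \<omega>)\<^sup>2 * min 1 (s * T \<omega>))) + a\<^sup>2)" using Li by simp
      show "cmod (?E \<omega>) \<le> 3 * (s\<^sup>2 * ((T \<omega>)\<^sup>2 * min 1 (s * T \<omega>))) + a\<^sup>2" for \<omega>
        unfolding z_eq WD_def by (rule lindeberg_step[OF yT bT s a zFn])
    qed
    also have "\<dots> = 3 * (s\<^sup>2 * lindeberg_rest v R s) + a\<^sup>2" using Li Le by (simp add: prob_space)
    finally show ?thesis .
  qed
  have E2: "(\<integral>\<omega>. ?E \<omega> \<partial>M) = (\<integral>\<omega>. ?A \<omega> \<partial>M) - (\<i> * s * (\<integral>\<omega>. zF \<omega> * y \<omega> \<partial>M) - (s\<^sup>2 / 2) * (\<integral>\<omega>. z \<omega> * WD \<omega> \<partial>M))"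
    using iA iF iWD by simp
  have E3: "cmod (\<i> * s * (\<integral>\<omega>. zF \<omega> * y \<omega> \<partial>M)) \<le> s\<^sup>2 * (K * \<tau>)"
  proof -
    have "cmod (\<integral>\<omega>. zF \<omega> * y \<omega> \<partial>M) \<le> \<bar>s\<bar> * K * (\<Sum>p\<in>F. decay_weight (p - k))"
      unfolding zF_def y_def using fin by (intro K) (auto simp: F_def P_def)
    also have "(\<Sum>p\<in>F. decay_weight (p - k)) = sum decay_weight ((\<lambda>p. p - k) ` F)"
      by (subst sum.reindex) (auto simp: inj_on_def)
    also have "\<bar>s\<bar> * K * \<dots> \<le> \<bar>s\<bar> * K * \<tau>"
      using K0 fin by (intro mult_left_mono tail) (auto simp: F_def)
    finally have "s * cmod (\<integral>\<omega>. zF \<omega> * y \<omega> \<partial>M) \<le> s * (\<bar>s\<bar> * K * \<tau>)" using s by (intro mult_left_mono) auto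
    then show ?thesis using s by (simp add: norm_mult power2_eq_square mult.assoc)
  qed
  let ?ni = "if \<exists>l\<in>sup_ball R. k + l \<notin> D then 1 else 0 :: real"
  have E4: "cmod ((\<integral>\<omega>. z \<omega> * complex_of_real (W \<omega> - \<sigma>2_box v R) \<partial>M) - (\<integral>\<omega>. z \<omega> * WD \<omega> \<partial>M))
    \<le> \<bar>\<sigma>2_box v R - \<sigma>2 v\<bar> + 4 * expectation (\<lambda>\<omega>. (T \<omega>)\<^sup>2) * ?ni"
  proof -
    have pt: "\<bar>(W \<omega> - \<sigma>2_box v R) - WD \<omega>\<bar> \<le> \<bar>\<sigma>2_box v R - \<sigma>2 v\<bar> + 4 * (T \<omega>)\<^sup>2 * ?ni" for \<omega>
    proof (cases "\<exists>l\<in>sup_ball R. k + l \<notin> D")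
      case True
      have "\<bar>(W \<omega> - \<sigma>2_box v R) - WD \<omega>\<bar> = \<bar>2 * (y \<omega> * c \<omega>) - 2 * (y \<omega> * b \<omega>) + (\<sigma>2 v - \<sigma>2_box v R)\<bar>"
        by (simp add: W_eq WD_def)
      also have "\<dots> \<le> \<bar>\<sigma>2_box v R - \<sigma>2 v\<bar> + 4 * (T \<omega>)\<^sup>2"
        using prodT[OF yT cT, of \<omega>] prodT[OF yT bT, of \<omega>] by linarith
      finally show ?thesis using True by simp
    next
      case False
      have "(\<lambda>j. j - k) ` Q = {l\<in>sup_ball R. lex_less l 0}"
      proof (intro set_eqI iffI)
        fix l assume "l \<in> (\<lambda>j. j - k) ` Q"
        then show "l \<in> {l\<in>sup_ball R. lex_less l 0}"
          by (auto simp: Q_def P_def sup_ball_def lex_less_zero_diff)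
      next
        fix l assume l: "l \<in> {l\<in>sup_ball R. lex_less l 0}"
        then have "k + l \<in> D" using False by auto
        moreover have "lex_less (k + l) k" using l lex_less_translate[of l k 0] by (simp add: add.commute)
        ultimately have "k + l \<in> Q" using l by (auto simp: Q_def P_def sup_ball_def)
        then show "l \<in> (\<lambda>j. j - k) ` Q" by (intro image_eqI[of _ _ "k + l"]) auto
      qed
      then have "b \<omega> = c \<omega>" unfolding Q_im c_def by simp
      then show ?thesis using False by (simp add: W_eq WD_def)
    qed
    have "(\<integral>\<omega>. z \<omega> * complex_of_real (W \<omega> - \<sigma>2_box v R) \<partial>M) - (\<integral>\<omega>. z \<omega> * WD \<omega> \<partial>M)
      = (\<integral>\<omega>. z \<omega> * complex_of_real (W \<omega> - \<sigma>2_box v R) - z \<omega> * WD \<omega> \<partial>M)"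
      by (rule Bochner_Integration.integral_diff[OF iW iWD, symmetric])
    also have "cmod \<dots> \<le> (\<integral>\<omega>. cmod (z \<omega> * complex_of_real (W \<omega> - \<sigma>2_box v R) - z \<omega> * WD \<omega>) \<partial>M)"
      by (rule integral_norm_bound)
    also have "\<dots> \<le> (\<integral>\<omega>. \<bar>\<sigma>2_box v R - \<sigma>2 v\<bar> + 4 * (T \<omega>)\<^sup>2 * ?ni \<partial>M)"
    proof (rule integral_mono)
      show "integrable M (\<lambda>\<omega>. cmod (z \<omega> * complex_of_real (W \<omega> - \<sigma>2_box v R) - z \<omega> * WD \<omega>))"
        by (intro integrable_norm Bochner_Integration.integrable_diff iW iWD)
      show "integrable M (\<lambda>\<omega>. \<bar>\<sigma>2_box v R - \<sigma>2 v\<bar> + 4 * (T \<omega>)\<^sup>2 * ?ni)" using T2i by simp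
      fix \<omega>
      have "z \<omega> * complex_of_real (W \<omega> - \<sigma>2_box v R) - z \<omega> * WD \<omega> = z \<omega> * complex_of_real ((W \<omega> - \<sigma>2_box v R) - WD \<omega>)"
        by (simp add: algebra_simps)
      then show "cmod (z \<omega> * complex_of_real (W \<omega> - \<sigma>2_box v R) - z \<omega> * WD \<omega>) \<le> \<bar>\<sigma>2_box v R - \<sigma>2 v\<bar> + 4 * (T \<omega>)\<^sup>2 * ?ni"
        using pt[of \<omega>] by (simp only: norm_mult zn norm_of_real mult_1)
    qed
    also have "\<dots> = \<bar>\<sigma>2_box v R - \<sigma>2 v\<bar> + 4 * expectation (\<lambda>\<omega>. (T \<omega>)\<^sup>2) * ?ni" using T2i by (simp add: prob_space)
    finally show ?thesis .
  qed
  define IA where "IA = (\<integral>\<omega>. ?A \<omega> \<partial>M)"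
  define IF where "IF = \<i> * s * (\<integral>\<omega>. zF \<omega> * y \<omega> \<partial>M)"
  define IW where "IW = (\<integral>\<omega>. z \<omega> * complex_of_real (W \<omega> - \<sigma>2_box v R) \<partial>M)"
  define ID where "ID = (\<integral>\<omega>. z \<omega> * WD \<omega> \<partial>M)"
  have "IA + c * IW = (IA - (IF - c * ID)) + IF + c * (IW - ID)" for c
    by (simp add: algebra_simps)
  then have "IA + (s\<^sup>2 / 2) * IW = (IA - (IF - (s\<^sup>2 / 2) * ID)) + IF + (s\<^sup>2 / 2) * (IW - ID)" .
  also have "cmod \<dots> \<le> cmod (IA - (IF - (s\<^sup>2 / 2) * ID)) + cmod IF + cmod ((s\<^sup>2 / 2) * (IW - ID))"
    by (intro order_trans[OF norm_triangle_ineq] add_mono norm_triangle_ineq order_refl)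
  also have "cmod ((s\<^sup>2 / 2) * (IW - ID)) = (s\<^sup>2 / 2) * cmod (IW - ID)"
    by (simp add: norm_mult norm_power norm_divide)
  also have "cmod (IA - (IF - (s\<^sup>2 / 2) * ID)) + cmod IF + (s\<^sup>2 / 2) * cmod (IW - ID)
    \<le> (3 * (s\<^sup>2 * lindeberg_rest v R s) + a\<^sup>2) + s\<^sup>2 * (K * \<tau>) + (s\<^sup>2 / 2) * (\<bar>\<sigma>2_box v R - \<sigma>2 v\<bar> + 4 * expectation (\<lambda>\<omega>. (T \<omega>)\<^sup>2) * ?ni)"
    using E1 E2 E3 E4 by (intro add_mono mult_left_mono) (simp_all add: IA_def IF_def IW_def ID_def)
  finally show ?thesis
    unfolding IA_def IW_def W_def y_def T2e by (simp add: add_ac split del: if_split)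
qed

end

section \<open>Convergence of the characteristic functions\<close>

context theta_field
begin

definition past :: "(int, 'm) vec set \<Rightarrow> (int, 'm) vec \<Rightarrow> (int, 'm) vec set" where
  "past D k = {j\<in>D. lex_less j k}"

text \<open>The phase of the past of \<open>k\<close> in \<open>D\<close> with the deterministic factor by which the increment at \<open>k\<close> enters the telescoping sum.\<close>
definition weight :: "(real, 'n) vec \<Rightarrow> (int, 'm) vec set \<Rightarrow> (int, 'm) vec \<Rightarrow> 'a \<Rightarrow> complex" where
  "weight v D k \<omega> = complex_of_real (exp (\<sigma>2 v / (2 * card D) * (real (card (past D k)) + 1)))
     * iexp (1 / sqrt (card D) * proj_sum v (past D k) \<omega>)"

lemma weight_measurable [measurable]: "weight v D k \<in> borel_measurable M"
  unfolding weight_def[abs_def] by measurable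

lemma weight_exponent_bound:
  assumes "finite D"
  shows "\<bar>\<sigma>2 v / (2 * card D) * (real (card (past D k)) + 1)\<bar> \<le> \<bar>\<sigma>2 v\<bar>"
proof (cases "card D = 0")
  case False
  have "card (past D k) \<le> card D" using assms by (intro card_mono) (auto simp: past_def)
  then have c: "real (card (past D k)) + 1 \<le> 2 * real (card D)" using False by linarith
  have "\<bar>\<sigma>2 v / (2 * card D) * (real (card (past D k)) + 1)\<bar> = \<bar>\<sigma>2 v\<bar> / (2 * card D) * (real (card (past D k)) + 1)"
    unfolding abs_mult abs_divide by simp
  also have "\<dots> \<le> \<bar>\<sigma>2 v\<bar> / (2 * card D) * (2 * real (card D))"
    using c by (intro mult_left_mono) auto
  also have "\<dots> = \<bar>\<sigma>2 v\<bar>" using False by simp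
  finally show ?thesis .
qed simp

lemma weight_bound:
  assumes "finite D"
  shows "cmod (weight v D k \<omega>) \<le> exp \<bar>\<sigma>2 v\<bar>"
  using order_trans[OF abs_ge_self weight_exponent_bound[OF assms, of v k]] by (simp add: weight_def norm_mult)

text \<open>Passing from \<open>k\<close> to \<open>k + l\<close> changes the past by at most \<open>\<eta> * card D\<close> sites; the sums over the added and over the removed sites have standard
  deviation at most \<open>sqrt (\<gamma>_total v * \<eta> * card D)\<close>, and the normalisation \<open>sqrt (card D)\<close> compensates the cardinality.\<close>
lemma weight_diff:
  assumes D: "finite D" "card D > 0" and \<eta>: "\<eta> \<ge> 0"
    and few: "real (card {j\<in>D. lex_less j k \<noteq> lex_less j (k + l)}) \<le> \<eta> * real (card D)"
  shows "expectation (\<lambda>\<omega>. cmod (weight v D (k + l) \<omega> - weight v D k \<omega>))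
    \<le> exp \<bar>\<sigma>2 v\<bar> * (\<bar>\<sigma>2 v\<bar> * \<eta> + 2 * sqrt (\<gamma>_total v * \<eta>))"
proof -
  define \<Delta> where "\<Delta> = {j\<in>D. lex_less j k \<noteq> lex_less j (k + l)}"
  define P where "P = past D k"
  define P' where "P' = past D (k + l)"
  define A1 where "A1 = P' - P"
  define A2 where "A2 = P - P'"
  define n where "n = real (card D)"
  define s where "s = 1 / sqrt n"
  have n: "n > 0" using D by (simp add: n_def)
  have s: "s \<ge> 0" using n by (simp add: s_def)
  have fin: "finite P" "finite P'" "finite A1" "finite A2" "finite \<Delta>"
    using D by (auto simp: P_def P'_def A1_def A2_def \<Delta>_def past_def)
  have sub: "A1 \<subseteq> \<Delta>" "A2 \<subseteq> \<Delta>" by (auto simp: A1_def A2_def \<Delta>_def P_def P'_def past_def)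
  have cA: "real (card A) \<le> \<eta> * n" if "A \<subseteq> \<Delta>" for A
  proof -
    have "card A \<le> card \<Delta>" using that fin by (intro card_mono)
    then have "real (card A) \<le> real (card \<Delta>)" by simp
    also have "\<dots> \<le> \<eta> * n" using few by (simp add: \<Delta>_def n_def)
    finally show ?thesis .
  qed
  have P'eq: "P' = (P \<inter> P') \<union> A1" and Peq: "P = (P \<inter> P') \<union> A2" by (auto simp: A1_def A2_def)
  have card1: "card P' = card (P \<inter> P') + card A1"
    by (subst P'eq, rule card_Un_disjoint) (use fin in \<open>auto simp: A1_def\<close>)
  have card2: "card P = card (P \<inter> P') + card A2"
    by (subst Peq, rule card_Un_disjoint) (use fin in \<open>auto simp: A2_def\<close>)
  have cd: "\<bar>real (card P') - real (card P)\<bar> \<le> \<eta> * n"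
    using cA[OF sub(1)] cA[OF sub(2)] card1 card2 by linarith
  have ps: "proj_sum v P' \<omega> - proj_sum v P \<omega> = proj_sum v A1 \<omega> - proj_sum v A2 \<omega>" for \<omega>
  proof -
    have "proj_sum v P' \<omega> = proj_sum v (P \<inter> P') \<omega> + proj_sum v A1 \<omega>"
      by (subst P'eq, rule proj_sum_union) (use fin in \<open>auto simp: A1_def\<close>)
    moreover have "proj_sum v P \<omega> = proj_sum v (P \<inter> P') \<omega> + proj_sum v A2 \<omega>"
      by (subst Peq, rule proj_sum_union) (use fin in \<open>auto simp: A2_def\<close>)
    ultimately show ?thesis by simp
  qed
  define x where "x = \<sigma>2 v / (2 * card D) * (real (card P) + 1)"
  define x' where "x' = \<sigma>2 v / (2 * card D) * (real (card P') + 1)"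
  let ?E = "exp \<bar>\<sigma>2 v\<bar>"
  have xb: "\<bar>x\<bar> \<le> \<bar>\<sigma>2 v\<bar>" "\<bar>x'\<bar> \<le> \<bar>\<sigma>2 v\<bar>"
    unfolding x_def x'_def P_def P'_def by (rule weight_exponent_bound[OF D(1)])+
  have xd: "\<bar>x' - x\<bar> \<le> \<bar>\<sigma>2 v\<bar> * \<eta>"
  proof -
    have "x' - x = \<sigma>2 v / (2 * n) * (real (card P') - real (card P))"
      unfolding x_def x'_def n_def right_diff_distrib[symmetric] by simp
    then have "\<bar>x' - x\<bar> = \<bar>\<sigma>2 v\<bar> / (2 * n) * \<bar>real (card P') - real (card P)\<bar>"
      using n by (simp add: abs_mult)
    also have "\<dots> \<le> \<bar>\<sigma>2 v\<bar> / (2 * n) * (\<eta> * n)" using cd n by (intro mult_left_mono) auto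
    also have "\<dots> = \<bar>\<sigma>2 v\<bar> * \<eta> / 2" using n by simp
    also have "\<dots> \<le> \<bar>\<sigma>2 v\<bar> * \<eta>" using \<eta> by simp
    finally show ?thesis .
  qed
  have w: "weight v D k \<omega> = complex_of_real (exp x) * iexp (s * proj_sum v P \<omega>)"
    "weight v D (k + l) \<omega> = complex_of_real (exp x') * iexp (s * proj_sum v P' \<omega>)" for \<omega>
    by (simp_all add: weight_def x_def x'_def P_def P'_def s_def n_def)
  have pt: "cmod (weight v D (k + l) \<omega> - weight v D k \<omega>) \<le> ?E * (\<bar>\<sigma>2 v\<bar> * \<eta> + s * (\<bar>proj_sum v A1 \<omega>\<bar> + \<bar>proj_sum v A2 \<omega>\<bar>))" for \<omega>
  proof -
    have "weight v D (k + l) \<omega> - weight v D k \<omega>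
      = complex_of_real (exp x' - exp x) * iexp (s * proj_sum v P' \<omega>)
        + complex_of_real (exp x) * (iexp (s * proj_sum v P' \<omega>) - iexp (s * proj_sum v P \<omega>))"
      unfolding w by (simp add: algebra_simps)
    also have "cmod \<dots> \<le> cmod (complex_of_real (exp x' - exp x) * iexp (s * proj_sum v P' \<omega>))
      + cmod (complex_of_real (exp x) * (iexp (s * proj_sum v P' \<omega>) - iexp (s * proj_sum v P \<omega>)))"
      by (rule norm_triangle_ineq)
    also have "\<dots> = \<bar>exp x' - exp x\<bar> + exp x * cmod (iexp (s * proj_sum v P' \<omega>) - iexp (s * proj_sum v P \<omega>))"
      by (simp only: norm_mult norm_of_real norm_exp_i_times abs_exp_cancel mult_1_right)
    also have "\<dots> \<le> ?E * \<bar>x' - x\<bar> + ?E * \<bar>s * proj_sum v P' \<omega> - s * proj_sum v P \<omega>\<bar>"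
      using xb by (intro add_mono mult_mono abs_exp_diff_le cmod_iexp_diff_le) auto
    also have "\<bar>s * proj_sum v P' \<omega> - s * proj_sum v P \<omega>\<bar> = s * \<bar>proj_sum v A1 \<omega> - proj_sum v A2 \<omega>\<bar>"
      unfolding right_diff_distrib[symmetric] ps abs_mult using s by simp
    also have "?E * \<bar>x' - x\<bar> + ?E * (s * \<bar>proj_sum v A1 \<omega> - proj_sum v A2 \<omega>\<bar>)
      \<le> ?E * (\<bar>\<sigma>2 v\<bar> * \<eta>) + ?E * (s * (\<bar>proj_sum v A1 \<omega>\<bar> + \<bar>proj_sum v A2 \<omega>\<bar>))"
      using xd s by (intro add_mono mult_left_mono abs_triangle_ineq4) auto
    finally show ?thesis by (simp add: distrib_left)
  qed
  have sq: "s * sqrt (\<gamma>_total v * real (card A)) \<le> sqrt (\<gamma>_total v * \<eta>)" if "A \<subseteq> \<Delta>" for A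
  proof -
    have "sqrt (\<gamma>_total v * real (card A)) \<le> sqrt (\<gamma>_total v * (\<eta> * n))"
      using cA[OF that] \<gamma>_total_nonneg by (intro real_sqrt_le_mono mult_left_mono)
    also have "\<dots> = sqrt (\<gamma>_total v * \<eta>) * sqrt n" by (simp add: real_sqrt_mult)
    finally have "s * sqrt (\<gamma>_total v * real (card A)) \<le> s * (sqrt (\<gamma>_total v * \<eta>) * sqrt n)"
      using s by (rule mult_left_mono)
    then show ?thesis using n by (simp add: s_def)
  qed
  have "expectation (\<lambda>\<omega>. cmod (weight v D (k + l) \<omega> - weight v D k \<omega>))
    \<le> expectation (\<lambda>\<omega>. ?E * (\<bar>\<sigma>2 v\<bar> * \<eta> + s * (\<bar>proj_sum v A1 \<omega>\<bar> + \<bar>proj_sum v A2 \<omega>\<bar>)))"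
  proof (rule integral_mono)
    show "integrable M (\<lambda>\<omega>. cmod (weight v D (k + l) \<omega> - weight v D k \<omega>))"
    proof (rule integrable_const_bound[of _ "2 * ?E"])
      show "AE \<omega> in M. norm (cmod (weight v D (k + l) \<omega> - weight v D k \<omega>)) \<le> 2 * ?E"
      proof (rule AE_I2)
        fix \<omega>
        show "norm (cmod (weight v D (k + l) \<omega> - weight v D k \<omega>)) \<le> 2 * ?E"
          using norm_triangle_ineq4[of "weight v D (k + l) \<omega>" "weight v D k \<omega>"]
            weight_bound[OF D(1), of v "k + l" \<omega>] weight_bound[OF D(1), of v k \<omega>] by simp
      qed
    qed measurable
    show "integrable M (\<lambda>\<omega>. ?E * (\<bar>\<sigma>2 v\<bar> * \<eta> + s * (\<bar>proj_sum v A1 \<omega>\<bar> + \<bar>proj_sum v A2 \<omega>\<bar>)))"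
      using proj_sum_abs(1)[OF fin(3), of v] proj_sum_abs(1)[OF fin(4), of v] by simp
  qed (rule pt)
  also have "\<dots> = ?E * (\<bar>\<sigma>2 v\<bar> * \<eta> + (s * expectation (\<lambda>\<omega>. \<bar>proj_sum v A1 \<omega>\<bar>) + s * expectation (\<lambda>\<omega>. \<bar>proj_sum v A2 \<omega>\<bar>)))"
    using proj_sum_abs(1)[OF fin(3), of v] proj_sum_abs(1)[OF fin(4), of v] by (simp add: prob_space distrib_left)
  also have "\<dots> \<le> ?E * (\<bar>\<sigma>2 v\<bar> * \<eta> + (sqrt (\<gamma>_total v * \<eta>) + sqrt (\<gamma>_total v * \<eta>)))"
    using s by (intro mult_left_mono add_left_mono add_mono order_trans[OF mult_left_mono[OF proj_sum_abs(2)] sq] fin sub) auto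
  finally show ?thesis by simp
qed

lemma weight_slow:
  assumes fin: "\<And>N. finite (D N)"
    and large: "filterlim (\<lambda>N. card (D N)) at_top sequentially"
    and bd: "(\<lambda>N. real (card (boundary (D N))) / real (card (D N))) \<longlonglongrightarrow> 0"
    and \<epsilon>: "\<epsilon> > 0"
  shows "\<forall>\<^sub>F N in sequentially. \<forall>k. expectation (\<lambda>\<omega>. cmod (weight v (D N) (k + l) \<omega> - weight v (D N) k \<omega>)) \<le> \<epsilon>"
proof -
  let ?E = "exp \<bar>\<sigma>2 v\<bar>"
  (* Each of the two terms of the bound in weight_diff gets a share of epsilon / 2. *)
  define \<eta> where "\<eta> = min (\<epsilon> / (2 * ?E * (\<bar>\<sigma>2 v\<bar> + 1))) ((\<epsilon> / (4 * ?E))\<^sup>2 / (\<gamma>_total v + 1))"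
  have gp: "\<gamma>_total v + 1 > 0" using \<gamma>_total_nonneg[of v] by linarith
  have \<eta>0: "\<eta> > 0" using \<epsilon> gp by (simp add: \<eta>_def)
  have "(\<bar>\<sigma>2 v\<bar> + 1) * \<eta> \<le> (\<bar>\<sigma>2 v\<bar> + 1) * (\<epsilon> / (2 * ?E * (\<bar>\<sigma>2 v\<bar> + 1)))"
    by (intro mult_left_mono) (auto simp: \<eta>_def)
  also have "\<dots> = \<epsilon> / (2 * ?E)"
  proof -
    have "c * (\<epsilon> / (d * c)) = \<epsilon> / d" if "c \<noteq> 0" "d \<noteq> 0" for c d :: real
      using that by (simp add: field_simps)
    moreover have "\<bar>\<sigma>2 v\<bar> + 1 \<noteq> 0" by linarith
    ultimately show ?thesis by simp
  qed
  finally have 1: "\<bar>\<sigma>2 v\<bar> * \<eta> \<le> \<epsilon> / (2 * ?E)" using \<eta>0 by (simp add: distrib_right)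
  have "\<gamma>_total v * \<eta> \<le> (\<gamma>_total v + 1) * \<eta>" using \<eta>0 by (intro mult_right_mono) auto
  also have "\<dots> \<le> (\<gamma>_total v + 1) * ((\<epsilon> / (4 * ?E))\<^sup>2 / (\<gamma>_total v + 1))"
    using gp by (intro mult_left_mono) (auto simp: \<eta>_def)
  also have "\<dots> = (\<epsilon> / (4 * ?E))\<^sup>2" using gp by simp
  finally have "sqrt (\<gamma>_total v * \<eta>) \<le> \<epsilon> / (4 * ?E)"
    using \<epsilon> by (intro real_le_lsqrt) (auto simp: \<gamma>_total_nonneg \<eta>0 less_imp_le)
  then have "\<bar>\<sigma>2 v\<bar> * \<eta> + 2 * sqrt (\<gamma>_total v * \<eta>) \<le> \<epsilon> / (2 * ?E) + 2 * (\<epsilon> / (4 * ?E))"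
    using 1 by linarith
  also have "\<dots> = \<epsilon> / ?E" by simp
  finally have "?E * (\<bar>\<sigma>2 v\<bar> * \<eta> + 2 * sqrt (\<gamma>_total v * \<eta>)) \<le> ?E * (\<epsilon> / ?E)"
    by (intro mult_left_mono) auto
  then have small: "?E * (\<bar>\<sigma>2 v\<bar> * \<eta> + 2 * sqrt (\<gamma>_total v * \<eta>)) \<le> \<epsilon>" by simp
  have "\<forall>\<^sub>F N in sequentially. card (D N) > 0"
    using large unfolding filterlim_at_top by (metis (mono_tags, lifting) eventually_mono less_eq_Suc_le)
  with lex_between_negligible[OF fin large bd \<eta>0, of l] show ?thesis
  proof eventually_elim
    case (elim N)
    show ?case
    proof
      fix k
      have "real (card {j\<in>D N. lex_less j k \<noteq> lex_less j (k + l)}) \<le> \<eta> * real (card (D N))"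
        using elim(1) by blast
      then show "expectation (\<lambda>\<omega>. cmod (weight v (D N) (k + l) \<omega> - weight v (D N) k \<omega>)) \<le> \<epsilon>"
        using weight_diff[OF fin elim(2) less_imp_le[OF \<eta>0], of k l v] small by linarith
    qed
  qed
qed

text \<open>Sum the single-site estimate over \<open>D\<close> in lexicographic order. The first line of the bound becomes small with large \<open>R\<close>, the
  others vanish for fixed \<open>R\<close> as the sets grow.\<close>
lemma char_distance_bound:
  fixes D :: "(int, 'm) vec set"
  assumes K: "\<And>s F k. finite F \<Longrightarrow> (\<And>p. p \<in> F \<Longrightarrow> lex_less p k) \<Longrightarrow>
      cmod (\<integral>\<omega>. iexp (s * proj_sum v F \<omega>) * complex_of_real (v \<bullet> X k \<omega>) \<partial>M) \<le> \<bar>s\<bar> * K * (\<Sum>p\<in>F. decay_weight (p - k))"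
    and K0: "K \<ge> 0"
    and tail: "\<And>F. finite F \<Longrightarrow> (\<And>t. t \<in> F \<Longrightarrow> int R \<le> supnorm t) \<Longrightarrow> sum decay_weight F \<le> \<tau>"
    and D: "finite D" "card D > 0" and R: "R \<ge> 1" and a: "\<bar>\<sigma>2 v\<bar> \<le> 2 * real (card D)"
  defines "n \<equiv> real (card D)"
  shows "cmod (exp (\<sigma>2 v / 2) * (\<integral>\<omega>. iexp (1 / sqrt n * proj_sum v D \<omega>) \<partial>M) - 1)
    \<le> exp \<bar>\<sigma>2 v\<bar> * (K * \<tau> + \<bar>\<sigma>2_box v R - \<sigma>2 v\<bar> / 2)
      + exp \<bar>\<sigma>2 v\<bar> * (3 * lindeberg_rest v R (1 / sqrt n) + (\<sigma>2 v)\<^sup>2 / (4 * n)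
          + 2 * expectation (\<lambda>\<omega>. (abs_ball_sum v R (\<lambda>t. X t \<omega>))\<^sup>2) * (real (card (sup_ball R) * R) * (real (card (boundary D)) / n)))
      + cmod ((\<Sum>k\<in>D. \<integral>\<omega>. weight v D k \<omega> * complex_of_real (local_square v R (\<lambda>t. X (t + k) \<omega>) - \<sigma>2_box v R) \<partial>M) / of_nat (card D)) / 2"
proof -
  define s where "s = 1 / sqrt n"
  define a where "a = \<sigma>2 v / (2 * n)"
  have n: "n > 0" using D by (simp add: n_def)
  have s: "s \<ge> 0" "s\<^sup>2 = 1 / n" using n by (simp_all add: s_def power_divide)
  have a1: "a = s\<^sup>2 * \<sigma>2 v / 2" by (simp add: a_def s)
  have a2: "\<bar>a\<bar> \<le> 1" using assms(7) n by (simp add: a_def n_def field_simps)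
  let ?E = "exp \<bar>\<sigma>2 v\<bar>"
  define g where "g A = complex_of_real (exp (a * card A)) * (\<integral>\<omega>. iexp (s * proj_sum v A \<omega>) \<partial>M)" for A
  define c where "c k = exp (a * (real (card (past D k)) + 1))" for k
  define IA where "IA k = (\<integral>\<omega>. iexp (s * proj_sum v (past D k) \<omega>) * (iexp (s * (v \<bullet> X k \<omega>)) - complex_of_real (exp (- a))) \<partial>M)" for k
  define IB where "IB k = (\<integral>\<omega>. iexp (s * proj_sum v (past D k) \<omega>) * complex_of_real (local_square v R (\<lambda>t. X (t + k) \<omega>) - \<sigma>2_box v R) \<partial>M)" for k
  define J where "J k = (\<integral>\<omega>. weight v D k \<omega> * complex_of_real (local_square v R (\<lambda>t. X (t + k) \<omega>) - \<sigma>2_box v R) \<partial>M)" for k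
  let ?ni = "\<lambda>k. if \<exists>l\<in>sup_ball R. k + l \<notin> D then 1 else 0 :: real"
  let ?T = "expectation (\<lambda>\<omega>. (abs_ball_sum v R (\<lambda>t. X t \<omega>))\<^sup>2)"
  have T0: "?T \<ge> 0" by simp
  have c_bound: "c k \<le> ?E" for k
    using order_trans[OF abs_ge_self weight_exponent_bound[OF D(1), of v k]] by (simp add: c_def a_def n_def)
  have J_eq: "J k = c k * IB k" for k
  proof -
    have "weight v D k \<omega> = c k * iexp (s * proj_sum v (past D k) \<omega>)" for \<omega>
      by (simp add: weight_def c_def a_def s_def n_def)
    then show ?thesis unfolding J_def IB_def by (simp only: mult.assoc integral_mult_right_zero)
  qed
  have iexp_int: "integrable M (\<lambda>\<omega>. iexp (s * proj_sum v A \<omega>))" for A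
    by (rule integrable_const_bound[of _ 1]) auto
  have step: "g (insert k (past D k)) - g (past D k) = c k * IA k" if "k \<in> D" for k
  proof -
    have fP: "finite (past D k)" "k \<notin> past D k" using D by (auto simp: past_def)
    have ps: "proj_sum v (insert k (past D k)) \<omega> = proj_sum v (past D k) \<omega> + v \<bullet> X k \<omega>" for \<omega>
      using fP by (simp add: proj_sum_def)
    have e: "exp (a * card (past D k)) = c k * exp (- a)"
      by (simp add: c_def exp_add[symmetric] distrib_left)
    have "IA k = (\<integral>\<omega>. iexp (s * proj_sum v (insert k (past D k)) \<omega>) - exp (- a) * iexp (s * proj_sum v (past D k) \<omega>) \<partial>M)"
      unfolding IA_def ps by (intro Bochner_Integration.integral_cong refl) (simp add: right_diff_distrib exp_add[symmetric] distrib_left mult.commute add.commute)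
    also have "\<dots> = (\<integral>\<omega>. iexp (s * proj_sum v (insert k (past D k)) \<omega>) \<partial>M) - exp (- a) * (\<integral>\<omega>. iexp (s * proj_sum v (past D k) \<omega>) \<partial>M)"
      using iexp_int by (subst Bochner_Integration.integral_diff) auto
    finally show ?thesis
      unfolding g_def e using fP by (simp add: c_def right_diff_distrib mult.assoc distrib_left)
  qed
  have "g D - g {} = (\<Sum>k\<in>D. g (insert k (past D k)) - g (past D k))"
    unfolding past_def by (rule lex_telescope[OF D(1), symmetric])
  also have "\<dots> = (\<Sum>k\<in>D. c k * IA k)" using step by (intro sum.cong) auto
  also have "g {} = 1" by (simp add: g_def proj_sum_def prob_space)
  finally have gD: "g D - 1 = (\<Sum>k\<in>D. c k * IA k)" .
  have site: "cmod (IA k + (s\<^sup>2 / 2) * IB k) \<le> s\<^sup>2 * (K * \<tau>) + 3 * (s\<^sup>2 * lindeberg_rest v R s) + a\<^sup>2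
      + (s\<^sup>2 / 2) * (\<bar>\<sigma>2_box v R - \<sigma>2 v\<bar> + 4 * ?T * ?ni k)" for k
  proof -
    have of2: "complex_of_real (s\<^sup>2 / 2) = (complex_of_real s)\<^sup>2 / 2" by simp
    show ?thesis
      unfolding IA_def IB_def past_def of2
      by (rule single_site_estimate[OF _ K0 _ D(1) R s(1) a1 a2]) (fact K tail)+
  qed
  define e0 where "e0 = s\<^sup>2 * (K * \<tau>) + 3 * (s\<^sup>2 * lindeberg_rest v R s) + a\<^sup>2 + (s\<^sup>2 / 2) * \<bar>\<sigma>2_box v R - \<sigma>2 v\<bar>"
  have "cmod ((g D - 1) + (s\<^sup>2 / 2) * (\<Sum>k\<in>D. J k)) = cmod (\<Sum>k\<in>D. c k * (IA k + (s\<^sup>2 / 2) * IB k))"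
    unfolding gD J_eq by (simp add: sum.distrib sum_distrib_left sum_divide_distrib distrib_left mult_ac)
  also have "\<dots> \<le> (\<Sum>k\<in>D. ?E * (e0 + 2 * s\<^sup>2 * ?T * ?ni k))"
  proof (rule sum_norm_le)
    fix k
    have "cmod (c k * (IA k + (s\<^sup>2 / 2) * IB k)) = c k * cmod (IA k + (s\<^sup>2 / 2) * IB k)"
      by (simp add: norm_mult c_def)
    also have "\<dots> \<le> ?E * (e0 + 2 * s\<^sup>2 * ?T * ?ni k)"
      using c_bound[of k] order_trans[OF site[of k], of "e0 + 2 * s\<^sup>2 * ?T * ?ni k"]
      by (intro mult_mono) (simp_all add: e0_def algebra_simps split del: if_split)
    finally show "cmod (c k * (IA k + (s\<^sup>2 / 2) * IB k)) \<le> ?E * (e0 + 2 * s\<^sup>2 * ?T * ?ni k)" .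
  qed
  also have "\<dots> = ?E * (real (card D) * e0 + (2 * s\<^sup>2 * ?T) * (\<Sum>k\<in>D. ?ni k))"
  proof -
    have "(\<Sum>k\<in>D. c * (e + t * f k)) = c * (real (card D) * e + t * sum f D)" for c e t and f :: "(int, 'm) vec \<Rightarrow> real"
      by (simp add: sum.distrib sum_distrib_left[symmetric])
    then show ?thesis .
  qed
  also have "\<dots> = ?E * (n * e0 + 2 * ?T * (s\<^sup>2 * (\<Sum>k\<in>D. ?ni k)))"
    by (simp only: n_def mult_ac)
  also have "\<dots> \<le> ?E * (n * e0 + 2 * ?T * (s\<^sup>2 * (real (card (sup_ball R) * R) * real (card (boundary D)))))"
  proof -
    have "(\<Sum>k\<in>D. ?ni k) = real (card {k\<in>D. \<exists>l\<in>sup_ball R. k + l \<notin> D})"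
      using D(1) by (simp add: sum.If_cases Collect_conj_eq Int_commute)
    also have "{k\<in>D. \<exists>l\<in>sup_ball R. k + l \<notin> D} = (\<Union>l\<in>sup_ball R. {k\<in>D. k + l \<notin> D})" by auto
    also have "real (card \<dots>) \<le> real (\<Sum>l\<in>sup_ball R. card {k\<in>D. k + l \<notin> D})"
      unfolding of_nat_le_iff by (rule card_UN_le) simp
    also have "(\<Sum>l\<in>sup_ball R. card {k\<in>D. k + l \<notin> D}) \<le> (\<Sum>l\<in>sup_ball R. R * card (boundary D))"
      by (rule sum_mono, rule card_exit_le[OF D(1)]) (simp add: sup_ball_def)
    then have "real (\<Sum>l\<in>sup_ball R. card {k\<in>D. k + l \<notin> D}) \<le> real (\<Sum>l\<in>sup_ball R. R * card (boundary D))"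
      unfolding of_nat_le_iff .
    finally have "(\<Sum>k\<in>D. ?ni k) \<le> real (card (sup_ball R) * R) * real (card (boundary D))" by (simp add: mult.assoc)
    then show ?thesis using T0 by (intro mult_left_mono add_left_mono) auto
  qed
  finally have main: "cmod ((g D - 1) + (s\<^sup>2 / 2) * (\<Sum>k\<in>D. J k))
     \<le> ?E * (n * e0 + 2 * ?T * (s\<^sup>2 * (real (card (sup_ball R) * R) * real (card (boundary D)))))" .
  have ne0: "n * e0 = K * \<tau> + \<bar>\<sigma>2_box v R - \<sigma>2 v\<bar> / 2 + (3 * lindeberg_rest v R s + (\<sigma>2 v)\<^sup>2 / (4 * n))"
    unfolding e0_def s(2) a_def using n by (simp add: field_simps power2_eq_square)
  have gDe: "g D = exp (\<sigma>2 v / 2) * (\<integral>\<omega>. iexp (1 / sqrt n * proj_sum v D \<omega>) \<partial>M)"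
    using n by (simp add: g_def a_def s_def n_def)
  have "cmod (g D - 1) \<le> cmod ((g D - 1) + (s\<^sup>2 / 2) * (\<Sum>k\<in>D. J k)) + cmod ((s\<^sup>2 / 2) * (\<Sum>k\<in>D. J k))"
    using norm_triangle_ineq4[of "(g D - 1) + (s\<^sup>2 / 2) * (\<Sum>k\<in>D. J k)" "(s\<^sup>2 / 2) * (\<Sum>k\<in>D. J k)"] by simp
  also have "cmod ((s\<^sup>2 / 2) * (\<Sum>k\<in>D. J k)) = cmod ((\<Sum>k\<in>D. J k) / of_nat (card D)) / 2"
    using n by (simp add: s(2) norm_mult norm_divide n_def)
  also have "cmod ((g D - 1) + (s\<^sup>2 / 2) * (\<Sum>k\<in>D. J k)) + cmod ((\<Sum>k\<in>D. J k) / of_nat (card D)) / 2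
    \<le> ?E * (n * e0 + 2 * ?T * (s\<^sup>2 * (real (card (sup_ball R) * R) * real (card (boundary D))))) + cmod ((\<Sum>k\<in>D. J k) / of_nat (card D)) / 2"
    using main by simp
  also have "?E * (n * e0 + 2 * ?T * (s\<^sup>2 * (real (card (sup_ball R) * R) * real (card (boundary D)))))
    = ?E * (K * \<tau> + \<bar>\<sigma>2_box v R - \<sigma>2 v\<bar> / 2)
      + ?E * (3 * lindeberg_rest v R (1 / sqrt n) + (\<sigma>2 v)\<^sup>2 / (4 * n)
          + 2 * ?T * (real (card (sup_ball R) * R) * (real (card (boundary D)) / n)))"
    unfolding ne0 by (simp add: s(2) s_def[symmetric] algebra_simps)
  finally show ?thesis unfolding gDe J_def .
qed

theorem char_proj_sum_tendsto:
  assumes erg: "ergodic_field M X"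
    and fin: "\<And>N. finite (D N)"
    and large: "filterlim (\<lambda>N. card (D N)) at_top sequentially"
    and bd: "(\<lambda>N. real (card (boundary (D N))) / real (card (D N))) \<longlonglongrightarrow> 0"
  shows "(\<lambda>N. \<integral>\<omega>. iexp (1 / sqrt (real (card (D N))) * proj_sum v (D N) \<omega>) \<partial>M) \<longlonglongrightarrow> complex_of_real (exp (- \<sigma>2 v / 2))"
proof -
  define n where "n N = real (card (D N))" for N
  define \<phi> where "\<phi> N = (\<integral>\<omega>. iexp (1 / sqrt (n N) * proj_sum v (D N) \<omega>) \<partial>M)" for N
  have n_inf: "filterlim n at_top sequentially"
    unfolding n_def[abs_def] by (rule filterlim_compose[OF filterlim_real_sequentially large])
  have s0: "(\<lambda>N. 1 / sqrt (n N)) \<longlonglongrightarrow> 0"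
    by (rule tendsto_divide_0[OF tendsto_const filterlim_at_top_imp_at_infinity[OF filterlim_compose[OF sqrt_at_top n_inf]]])
  obtain K where K0: "K \<ge> 0" and K: "\<And>s F k. finite F \<Longrightarrow> (\<And>p. p \<in> F \<Longrightarrow> lex_less p k) \<Longrightarrow>
      cmod (\<integral>\<omega>. iexp (s * proj_sum v F \<omega>) * complex_of_real (v \<bullet> X k \<omega>) \<partial>M) \<le> \<bar>s\<bar> * K * (\<Sum>p\<in>F. decay_weight (p - k))"
    by (rule past_expectation_bound[of v]) blast
  let ?E = "exp \<bar>\<sigma>2 v\<bar>"
  have "(\<lambda>N. complex_of_real (exp (\<sigma>2 v / 2)) * \<phi> N) \<longlonglongrightarrow> 1"
  proof (rule LIMSEQ_I)
    fix r :: real assume r: "r > 0"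
    define \<tau> where "\<tau> = r / (4 * ?E * (K + 1))"
    have \<tau>: "\<tau> > 0" using r K0 by (simp add: \<tau>_def)
    have "?E * (K * \<tau>) \<le> ?E * ((K + 1) * \<tau>)" using \<tau> by (intro mult_left_mono mult_right_mono) auto
    also have "\<dots> = r / 4"
    proof -
      have "e * (c * (r / (4 * e * c))) = r / 4" if "e \<noteq> 0" "c \<noteq> 0" for e c :: real
        using that by (simp add: field_simps)
      then show ?thesis unfolding \<tau>_def using K0 by simp
    qed
    finally have EK: "?E * (K * \<tau>) \<le> r / 4" .
    obtain R1 :: nat where R1: "R1 \<ge> 1" "\<And>F R'. R' \<ge> R1 \<Longrightarrow> finite F \<Longrightarrow> (\<And>t. t \<in> F \<Longrightarrow> int R' \<le> supnorm t) \<Longrightarrow> sum decay_weight F < \<tau>"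
      by (rule supnorm_tail_small[OF decay_weight_summable decay_weight_nonneg \<tau>]) blast
    obtain R2 where R2: "\<And>R. R \<ge> R2 \<Longrightarrow> norm (\<sigma>2_box v R - \<sigma>2 v) < r / (2 * ?E)"
      using LIMSEQ_D[OF \<sigma>2_box_tendsto[of v], of "r / (2 * ?E)"] r by auto
    define R where "R = max R1 R2"
    have R: "R \<ge> 1" using R1 by (simp add: R_def)
    have tail: "sum decay_weight F \<le> \<tau>" if "finite F" "\<And>t. t \<in> F \<Longrightarrow> int R \<le> supnorm t" for F
      by (rule less_imp_le, rule R1(2)[of R]) (use that in \<open>auto simp: R_def\<close>)
    have "\<bar>\<sigma>2_box v R - \<sigma>2 v\<bar> < r / (2 * ?E)" using R2[of R] by (simp add: R_def)
    then have "?E * (\<bar>\<sigma>2_box v R - \<sigma>2 v\<bar> / 2) \<le> ?E * (r / (2 * ?E) / 2)"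
      by (intro mult_left_mono divide_right_mono) auto
    then have EB: "?E * (\<bar>\<sigma>2_box v R - \<sigma>2 v\<bar> / 2) \<le> r / 4" by simp
    have bound1: "?E * (K * \<tau> + \<bar>\<sigma>2_box v R - \<sigma>2 v\<bar> / 2) \<le> r / 2"
      using EK EB by (simp add: distrib_left)
    define U where "U x = local_square v R x - \<sigma>2_box v R" for x
    have Um: "U \<in> borel_measurable (Pi\<^sub>M UNIV (\<lambda>_. borel))" unfolding U_def by measurable
    have Ui: "integrable M (\<lambda>\<omega>. U (\<lambda>t. X t \<omega>))" unfolding U_def using local_square_integrable by simp
    have U0: "expectation (\<lambda>\<omega>. U (\<lambda>t. X t \<omega>)) = 0"
      unfolding U_def using local_square_integrable expectation_local_square[OF R] by (simp add: prob_space)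
    let ?avg = "\<lambda>N. (\<Sum>k\<in>D N. \<integral>\<omega>. weight v (D N) k \<omega> * complex_of_real (U (\<lambda>t. X (t + k) \<omega>)) \<partial>M) / of_nat (card (D N))"
    have avg0: "?avg \<longlonglongrightarrow> 0"
      by (rule ergodic_weighted_average[OF erg Um Ui U0 fin bd weight_measurable weight_bound[OF fin] weight_slow[OF fin large bd]])
    let ?T = "expectation (\<lambda>\<omega>. (abs_ball_sum v R (\<lambda>t. X t \<omega>))\<^sup>2)"
    let ?rest = "\<lambda>N. ?E * (3 * lindeberg_rest v R (1 / sqrt (n N)) + (\<sigma>2 v)\<^sup>2 / (4 * n N)
          + 2 * ?T * (real (card (sup_ball R) * R) * (real (card (boundary (D N))) / n N))) + cmod (?avg N) / 2"
    have "?rest \<longlonglongrightarrow> ?E * (3 * 0 + 0 + 2 * ?T * (real (card (sup_ball R) * R) * 0)) + 0 / 2"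
    proof (intro tendsto_add tendsto_mult_left tendsto_divide tendsto_const)
      show "(\<lambda>N. lindeberg_rest v R (1 / sqrt (n N))) \<longlonglongrightarrow> 0"
        by (rule lindeberg_rest_tendsto[OF s0]) (simp add: n_def)
      show "(\<lambda>N. (\<sigma>2 v)\<^sup>2 / (4 * n N)) \<longlonglongrightarrow> 0"
        by (rule tendsto_divide_0[OF tendsto_const filterlim_at_top_imp_at_infinity])
          (rule filterlim_tendsto_pos_mult_at_top[OF tendsto_const _ n_inf], simp)
      show "(\<lambda>N. real (card (boundary (D N))) / n N) \<longlonglongrightarrow> 0" using bd by (simp add: n_def)
      show "(\<lambda>N. cmod (?avg N)) \<longlonglongrightarrow> 0" using tendsto_norm_zero[OF avg0] .
    qed simp
    then have "\<forall>\<^sub>F N in sequentially. ?rest N < r / 2" using r by (intro order_tendstoD) auto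
    moreover have "\<forall>\<^sub>F N in sequentially. n N \<ge> \<bar>\<sigma>2 v\<bar> + 1"
      using n_inf unfolding filterlim_at_top by blast
    ultimately have "\<forall>\<^sub>F N in sequentially. norm (complex_of_real (exp (\<sigma>2 v / 2)) * \<phi> N - 1) < r"
    proof eventually_elim
      case (elim N)
      have "real (card (D N)) > 0" "\<bar>\<sigma>2 v\<bar> \<le> 2 * real (card (D N))" using elim(2) unfolding n_def by linarith+
      then have "card (D N) > 0" "\<bar>\<sigma>2 v\<bar> \<le> 2 * real (card (D N))" by simp_all
      from char_distance_bound[OF K K0 tail fin this(1) R this(2)]
      have "norm (complex_of_real (exp (\<sigma>2 v / 2)) * \<phi> N - 1) \<le> ?E * (K * \<tau> + \<bar>\<sigma>2_box v R - \<sigma>2 v\<bar> / 2) + ?rest N"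
        unfolding \<phi>_def n_def U_def by (simp only: add.assoc)
      then show ?case using bound1 elim(1) by linarith
    qed
    then show "\<exists>no. \<forall>N\<ge>no. norm (complex_of_real (exp (\<sigma>2 v / 2)) * \<phi> N - 1) < r"
      by (simp add: eventually_sequentially)
  qed
  then have lim: "(\<lambda>N. complex_of_real (exp (- \<sigma>2 v / 2)) * (complex_of_real (exp (\<sigma>2 v / 2)) * \<phi> N)) \<longlonglongrightarrow> complex_of_real (exp (- \<sigma>2 v / 2)) * 1"
    by (rule tendsto_mult_left)
  have eq: "complex_of_real (exp (- \<sigma>2 v / 2)) * (complex_of_real (exp (\<sigma>2 v / 2)) * \<phi> N) = \<phi> N" for N
    unfolding mult.assoc[symmetric] of_real_mult[symmetric] exp_add[symmetric] by simp
  have "\<phi> \<longlonglongrightarrow> complex_of_real (exp (- \<sigma>2 v / 2))" using lim unfolding eq mult_1_right .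
  then show ?thesis unfolding \<phi>_def n_def .
qed

end

section \<open>The multivariate central limit theorem\<close>

lemma outer_product_eq_sum:
  "outer_product x y = (\<Sum>i\<in>UNIV. \<Sum>j\<in>UNIV. (x $ i * y $ j) *\<^sub>R axis i (axis j 1))"
proof -
  have "(\<Sum>a\<in>UNIV. \<Sum>b\<in>UNIV. (x $ a * y $ b) *\<^sub>R axis a (axis b 1)) $ i $ j = x $ i * y $ j" for i j
  proof -
    have "(\<Sum>a\<in>UNIV. \<Sum>b\<in>UNIV. (x $ a * y $ b) *\<^sub>R axis a (axis b 1)) $ i $ j
      = (\<Sum>a\<in>UNIV. \<Sum>b\<in>UNIV. ((x $ a * y $ b) *\<^sub>R axis a (axis b 1)) $ i $ j)"
      by simp
    also have "\<dots> = (\<Sum>a\<in>UNIV. \<Sum>b\<in>UNIV. if a = i then (if b = j then x $ a * y $ b else 0) else 0)"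
      by (intro sum.cong refl) (simp add: axis_def)
    also have "\<dots> = (\<Sum>a\<in>UNIV. if a = i then x $ a * y $ j else 0)"
      by (intro sum.cong refl) simp
    finally show ?thesis by simp
  qed
  then show ?thesis by (simp add: vec_eq_iff outer_product_def)
qed

lemma inner_outer_product: "v \<bullet> (outer_product x y *v v) = (v \<bullet> x) * (v \<bullet> y)"
  unfolding quadratic_form_eq_sum outer_product_def by (simp add: inner_vec_def sum_product mult_ac)

lemma norm_matrix_le_sum:
  fixes A :: "real ^ 'n::finite ^ 'm::finite"
  shows "norm A \<le> (\<Sum>i\<in>UNIV. \<Sum>j\<in>UNIV. \<bar>A $ i $ j\<bar>)"
proof -
  have "norm A \<le> (\<Sum>i\<in>UNIV. norm (A $ i))"
    unfolding norm_vec_def[of A] by (rule L2_set_le_sum) simp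
  also have "\<dots> \<le> (\<Sum>i\<in>UNIV. \<Sum>j\<in>UNIV. \<bar>A $ i $ j\<bar>)"
    by (intro sum_mono norm_le_l1_cart)
  finally show ?thesis .
qed

lemma bounded_linear_quadratic_form:
  fixes v :: "real ^ 'n::finite"
  shows "bounded_linear (\<lambda>A :: real ^ 'n ^ 'n. v \<bullet> (A *v v))"
  by (intro linear_conv_bounded_linear[THEN iffD1] linearI)
    (simp_all add: matrix_vector_mult_add_rdistrib inner_add_right scaleR_matrix_vector_assoc[symmetric])

lemma bounded_linear_transpose:
  "bounded_linear (transpose :: real ^ 'n::finite ^ 'n \<Rightarrow> real ^ 'n ^ 'n)"
  by (intro linear_conv_bounded_linear[THEN iffD1] linearI) (simp_all add: transpose_def vec_eq_iff)

context theta_field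
begin

lemma outer_product_integrable: "integrable M (\<lambda>\<omega>. outer_product (X s \<omega>) (X t \<omega>))"
proof -
  have "integrable M (\<lambda>\<omega>. X s \<omega> $ i * X t \<omega> $ j)" for i j
    using inner_product_integrable[of "axis i 1" s "axis j 1" t] by (simp add: inner_axis')
  then show ?thesis
    unfolding outer_product_eq_sum by (intro Bochner_Integration.integrable_sum integrable_scaleR_left) auto
qed

definition cov_matrix :: "(int, 'm) vec \<Rightarrow> real ^ 'n ^ 'n" where
  "cov_matrix k = (\<integral>\<omega>. outer_product (X 0 \<omega>) (X k \<omega>) \<partial>M)"

lemma cov_matrix_component: "cov_matrix k $ i $ j = expectation (\<lambda>\<omega>. (axis i 1 \<bullet> X 0 \<omega>) * (axis j 1 \<bullet> X k \<omega>))"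
proof -
  have bl: "bounded_linear (\<lambda>A :: real ^ 'n ^ 'n. A $ i $ j)"
    by (rule bounded_linear_compose[OF bounded_linear_vec_nth bounded_linear_vec_nth])
  show ?thesis
    unfolding cov_matrix_def integral_bounded_linear[OF bl outer_product_integrable, symmetric]
    by (simp add: outer_product_def inner_axis')
qed

lemma cov_matrix_norm_summable: "(\<lambda>k. norm (cov_matrix k)) summable_on UNIV"
proof -
  have "\<exists>K. \<forall>k. \<bar>cov_matrix k $ i $ j\<bar> \<le> K * decay_weight k" for i j
    unfolding cov_matrix_component by (rule covariance_decay[of "axis i 1" "axis j 1"]) blast
  then obtain K where K: "\<And>i j k. \<bar>cov_matrix k $ i $ j\<bar> \<le> K i j * decay_weight k" by metis
  have bound: "norm (cov_matrix k) \<le> (\<Sum>i\<in>UNIV. \<Sum>j\<in>UNIV. K i j) * decay_weight k" for k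
  proof -
    have "norm (cov_matrix k) \<le> (\<Sum>i\<in>UNIV. \<Sum>j\<in>UNIV. \<bar>cov_matrix k $ i $ j\<bar>)" by (rule norm_matrix_le_sum)
    also have "\<dots> \<le> (\<Sum>i\<in>UNIV. \<Sum>j\<in>UNIV. K i j * decay_weight k)" by (intro sum_mono K)
    finally show ?thesis by (simp add: sum_distrib_right)
  qed
  show ?thesis
    by (rule summable_on_comparison_test[OF summable_on_cmult_right[OF decay_weight_summable]]) (use bound in auto)
qed

lemma cov_matrix_summable: "cov_matrix summable_on UNIV"
  by (rule abs_summable_summable[OF cov_matrix_norm_summable])

definition long_run_cov :: "real ^ 'n ^ 'n" where
  "long_run_cov = infsum cov_matrix UNIV"

text \<open>Evaluating the quadratic form at \<open>v\<close> is a bounded linear map of the matrix, so it commutes with the integral and the sum.\<close>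
lemma quadratic_form_long_run_cov: "v \<bullet> (long_run_cov *v v) = \<sigma>2 v"
proof -
  have "v \<bullet> (long_run_cov *v v) = infsum (\<lambda>k. v \<bullet> (cov_matrix k *v v)) UNIV"
    unfolding long_run_cov_def
    using infsumI[OF has_sum_bounded_linear[OF bounded_linear_quadratic_form has_sum_infsum[OF cov_matrix_summable]], of v]
    by (simp add: o_def)
  also have "(\<lambda>k. v \<bullet> (cov_matrix k *v v)) = \<gamma> v"
  proof
    fix k
    show "v \<bullet> (cov_matrix k *v v) = \<gamma> v k"
      unfolding cov_matrix_def integral_bounded_linear[OF bounded_linear_quadratic_form outer_product_integrable, symmetric]
      by (simp add: inner_outer_product \<gamma>_def)
  qed
  finally show ?thesis by (simp add: \<sigma>2_def)
qed

text \<open>By stationarity, transposition maps the summand at \<open>k\<close> to the summand at \<open>- k\<close>.\<close>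
lemma transpose_long_run_cov: "transpose long_run_cov = long_run_cov"
proof -
  have tr: "transpose (cov_matrix k) = cov_matrix (- k)" for k
  proof -
    have "cov_matrix k $ i $ j = cov_matrix (- k) $ j $ i" for i j
    proof -
      have "expectation (\<lambda>\<omega>. (axis j 1 \<bullet> X (0 + k) \<omega>) * (axis i 1 \<bullet> X (- k + k) \<omega>))
        = expectation (\<lambda>\<omega>. (axis j 1 \<bullet> X 0 \<omega>) * (axis i 1 \<bullet> X (- k) \<omega>))"
        by (rule integral_pair_shift[of "\<lambda>x y. (axis j 1 \<bullet> x) * (axis i 1 \<bullet> y)"]) measurable
      then show ?thesis unfolding cov_matrix_component by (simp add: mult.commute)
    qed
    then show ?thesis by (simp add: transpose_def vec_eq_iff)
  qed
  have "transpose long_run_cov = infsum (\<lambda>k. transpose (cov_matrix k)) UNIV"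
    unfolding long_run_cov_def
    using infsumI[OF has_sum_bounded_linear[OF bounded_linear_transpose has_sum_infsum[OF cov_matrix_summable]]]
    by (simp add: o_def)
  also have "\<dots> = infsum (cov_matrix \<circ> uminus) UNIV" by (simp add: tr o_def)
  also have "\<dots> = infsum cov_matrix (range uminus)" by (rule infsum_reindex[symmetric]) simp
  also have "range uminus = (UNIV :: (int, 'm) vec set)" by (metis surj_def minus_minus)
  finally show ?thesis by (simp add: long_run_cov_def)
qed

theorem central_limit:
  assumes erg: "ergodic_field M X"
    and fin: "\<And>N. finite (D N)"
    and large: "filterlim (\<lambda>N. card (D N)) at_top sequentially"
    and bd: "(\<lambda>N. real (card (boundary (D N))) / real (card (D N))) \<longlonglongrightarrow> 0"
  shows "pos_semidefinite long_run_cov"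
    and "converges_in_distribution M (\<lambda>N \<omega>. (1 / sqrt (real (card (D N)))) *\<^sub>R (\<Sum>j\<in>D N. X j \<omega>))
      (multivariate_normal 0 long_run_cov)"
proof -
  note lim = char_proj_sum_tendsto[OF erg fin large bd]
  show psd: "pos_semidefinite long_run_cov"
    unfolding pos_semidefinite_def
  proof (intro conjI allI)
    show "transpose long_run_cov = long_run_cov" by (rule transpose_long_run_cov)
    fix v :: "real ^ 'n"
    have "cmod (\<integral>\<omega>. iexp (1 / sqrt (real (card (D N))) * proj_sum v (D N) \<omega>) \<partial>M) \<le> 1" for N
    proof -
      have "cmod (\<integral>\<omega>. iexp (1 / sqrt (real (card (D N))) * proj_sum v (D N) \<omega>) \<partial>M)
        \<le> (\<integral>\<omega>. cmod (iexp (1 / sqrt (real (card (D N))) * proj_sum v (D N) \<omega>)) \<partial>M)"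
        by (rule integral_norm_bound)
      also have "\<dots> = 1" by (simp only: norm_exp_i_times) (simp add: prob_space)
      finally show ?thesis .
    qed
    then have "cmod (complex_of_real (exp (- \<sigma>2 v / 2))) \<le> 1"
      using LIMSEQ_le_const2[OF tendsto_norm[OF lim[of v]]] by blast
    then show "0 \<le> v \<bullet> (long_run_cov *v v)"
      unfolding quadratic_form_long_run_cov by simp
  qed
  show "converges_in_distribution M (\<lambda>N \<omega>. (1 / sqrt (real (card (D N)))) *\<^sub>R (\<Sum>j\<in>D N. X j \<omega>))
      (multivariate_normal 0 long_run_cov)"
  proof (rule converges_in_distribution_if_char)
    show "prob_space M" by (rule prob_space_axioms)
    show "prob_space (multivariate_normal 0 long_run_cov)" by (rule prob_space_multivariate_normal)
    show "sets (multivariate_normal 0 long_run_cov) = sets borel" by simp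
    show "(\<lambda>\<omega>. (1 / sqrt (real (card (D N)))) *\<^sub>R (\<Sum>j\<in>D N. X j \<omega>)) \<in> borel_measurable M" for N
      by measurable
    fix v :: "real ^ 'n"
    show "(\<lambda>N. \<integral>\<omega>. iexp (v \<bullet> ((1 / sqrt (real (card (D N)))) *\<^sub>R (\<Sum>j\<in>D N. X j \<omega>))) \<partial>M)
      \<longlonglongrightarrow> (\<integral>x. iexp (v \<bullet> x) \<partial>multivariate_normal 0 long_run_cov)"
      unfolding char_multivariate_normal[OF psd] quadratic_form_long_run_cov inner_scaleR_right inner_sum_right
      using lim[of v] unfolding proj_sum_def .
  qed
qed

end

theorem corollary2p10:
  fixes M :: "'a measure"
    and X :: "int ^ 'm::{finite,linorder} \<Rightarrow> 'a \<Rightarrow> real ^ 'n::finite"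
    and D :: "nat \<Rightarrow> (int ^ 'm::{finite,linorder}) set"
    and \<delta> \<alpha> :: real
  defines "\<Sigma> \<equiv> (\<Sum>\<^sub>\<infinity>k\<in>UNIV. \<integral>\<omega>. outer_product (X 0 \<omega>) (X k \<omega>) \<partial>M)"
  assumes "prob_space M"
    and "random_field M X"
    and "strictly_stationary M X"
    and "ergodic_field M X"
    and "\<And>t. (\<integral>\<omega>. X t \<omega> \<partial>M) = 0"
    and "\<delta> > 0"
    and "\<And>t. integrable M (\<lambda>\<omega>. norm (X t \<omega>) powr (2 + \<delta>))"
    and "\<alpha> > real CARD('m) * (1 + 1 / \<delta>)"
    and "\<exists>C. \<forall>\<^sub>F h in sequentially. theta M X h \<le> ennreal (C * real h powr - \<alpha>)"
    and "\<And>N. finite (D N)"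
    and "filterlim (\<lambda>N. card (D N)) at_top sequentially"
    and "(\<lambda>N. real (card (boundary (D N))) / real (card (D N))) \<longlonglongrightarrow> 0"
  shows "(\<forall>k. integrable M (\<lambda>\<omega>. outer_product (X 0 \<omega>) (X k \<omega>))) \<and>
    ((\<lambda>k. norm (\<integral>\<omega>. outer_product (X 0 \<omega>) (X k \<omega>) \<partial>M)) summable_on UNIV) \<and>
    pos_semidefinite \<Sigma> \<and>
    converges_in_distribution M
      (\<lambda>N \<omega>. (1 / sqrt (real (card (D N)))) *\<^sub>R (\<Sum>j\<in>D N. X j \<omega>))
      (multivariate_normal 0 \<Sigma>)"
proof -
  interpret prob_space M by fact
  interpret theta_field M X \<delta> \<alpha>
    using assms(3-10) by unfold_locales (auto simp: random_field_def)
  have \<Sigma>: "\<Sigma> = long_run_cov"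
    by (simp add: \<Sigma>_def long_run_cov_def cov_matrix_def[abs_def])
  show ?thesis
    unfolding \<Sigma>
    using outer_product_integrable cov_matrix_norm_summable central_limit[OF assms(5) assms(11-13)]
    by (auto simp: cov_matrix_def)
qed

end
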